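(* Let $n\geq 4$ and let $d\geq 0$ be an integer. If $$d<\min\left\{k\left\lfloor\frac{n}{k+2}\right\rfloor \;\middle|\; k=2,\ldots,d+1\right\},$$ then $\mathrm{Aut}(F_n)$ has property $\mathrm{F}\mathcal{A}_d$. In particular, if $n\geq 4$ and $d<2\left\lfloor\frac{n}{4}\right\rfloor-1$, then $\mathrm{Aut}(F_n)$ has property $\mathrm{F}\mathcal{A}_d$.
   Context: $F_n$ is the free group of rank $n$ and $\mathrm{Aut}(F_n)$ its automorphism group. $\mathcal{A}_d$ denotes the class of (non-empty) complete CAT(0) metric spaces of covering dimension $d$. A group $G$ has property $\mathrm{F}\mathcal{A}_d$ if for every $X\in\mathcal{A}_d$, every action of $G$ on $X$ by isometries (i.e. every homomorphism $G\to\mathrm{Isom}(X)$) has a global fixed point, i.e. a point of $X$ fixed by all elements of $G$. For $d=0$ the set over which the minimum is taken is empty, and the minimum is read as $+\infty$ (i.e. the condition means $d<k\lfloor n/(k+2)\rfloor$ for every integer $k$ with $2\le k\le d+1$). *)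

theory Defs
  imports "HOL-Analysis.Analysis" "HOL-Algebra.Bij"
begin

section \<open>Free groups of finite rank\<close>

text \<open>
  A letter \<open>(i, e)\<close> stands for the \<open>i\<close>-th basis element if \<open>e\<close> is true and for its
  inverse otherwise. The free group on the basis \<open>{..<n}\<close> consists of the reduced words;
  the product of two words is the reduced form of their concatenation.
\<close>

type_synonym letter = "nat \<times> bool"

definition inv_letter :: "letter \<Rightarrow> letter" where
  "inv_letter x = (fst x, \<not> snd x)"

definition reduced :: "letter list \<Rightarrow> bool" where
  "reduced w \<longleftrightarrow> successively (\<lambda>x y. y \<noteq> inv_letter x) w"

fun cons_letter :: "letter \<Rightarrow> letter list \<Rightarrow> letter list" where
  "cons_letter x [] = [x]"
| "cons_letter x (y # w) = (if y = inv_letter x then w else x # y # w)"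

definition free_group :: "nat \<Rightarrow> letter list monoid" where
  "free_group n =
     \<lparr>carrier = {w. set w \<subseteq> {..<n} \<times> UNIV \<and> reduced w},
      mult = (\<lambda>u v. foldr cons_letter u v),
      one = []\<rparr>"

lemma inv_letter_inv_letter [simp]: "inv_letter (inv_letter x) = x"
  by (simp add: inv_letter_def)

lemma inv_letter_neq [simp]: "inv_letter x \<noteq> x" "x \<noteq> inv_letter x"
  by (simp_all add: inv_letter_def prod_eq_iff)

lemma reduced_Nil [simp]: "reduced []"
  by (simp add: reduced_def)

lemma reduced_Cons: "reduced (x # w) \<longleftrightarrow> reduced w \<and> (w = [] \<or> hd w \<noteq> inv_letter x)"
  by (cases w) (auto simp: reduced_def)

lemma reduced_cons_letter: "reduced w \<Longrightarrow> reduced (cons_letter x w)"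
  by (cases w) (auto simp: reduced_Cons)

lemma set_cons_letter: "set (cons_letter x w) \<subseteq> insert x (set w)"
  by (cases w) auto

lemma cons_letter_reduced: "reduced (x # w) \<Longrightarrow> cons_letter x w = x # w"
  by (cases w) (auto simp: reduced_Cons)

lemma cons_letter_inv: "reduced w \<Longrightarrow> cons_letter x (cons_letter (inv_letter x) w) = w"
  by (cases w) (auto simp: cons_letter_reduced)

lemma reduced_foldr: "reduced v \<Longrightarrow> reduced (foldr cons_letter u v)"
  by (induction u) (auto intro: reduced_cons_letter)

lemma set_foldr: "set (foldr cons_letter u v) \<subseteq> set u \<union> set v"
  by (induction u) (use set_cons_letter in fastforce)+

lemma foldr_cons_letter:
  assumes "reduced w"
  shows "foldr cons_letter (cons_letter x v) w = cons_letter x (foldr cons_letter v w)"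
proof (cases v)
  case (Cons y v')
  show ?thesis
    using cons_letter_inv[OF reduced_foldr[OF assms], of x v'] by (simp add: Cons)
qed auto

lemma foldr_assoc:
  assumes "reduced w"
  shows "foldr cons_letter (foldr cons_letter u v) w
       = foldr cons_letter u (foldr cons_letter v w)"
  by (induction u) (auto simp: foldr_cons_letter assms)

lemma foldr_cons_letter_Nil: "reduced w \<Longrightarrow> foldr cons_letter w [] = w"
  by (induction w) (auto simp: cons_letter_reduced reduced_Cons)

lemma foldr_inv_word: "reduced w \<Longrightarrow> foldr cons_letter (rev (map inv_letter w)) w = []"
  by (induction w) (auto simp: reduced_Cons)

lemma group_free_group: "group (free_group n)"
proof (rule groupI)
  fix x assume x: "x \<in> carrier (free_group n)"
  let ?y = "foldr cons_letter (rev (map inv_letter x)) []"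
  have "set ?y \<subseteq> {..<n} \<times> UNIV"
    using set_foldr[of "rev (map inv_letter x)" "[]"] x
    by (fastforce simp: free_group_def inv_letter_def)
  then have "?y \<in> carrier (free_group n)"
    by (simp add: free_group_def reduced_foldr)
  moreover have "?y \<otimes>\<^bsub>free_group n\<^esub> x = \<one>\<^bsub>free_group n\<^esub>"
    using x by (simp add: free_group_def foldr_assoc foldr_inv_word)
  ultimately show "\<exists>y\<in>carrier (free_group n). y \<otimes>\<^bsub>free_group n\<^esub> x = \<one>\<^bsub>free_group n\<^esub>" ..
qed (use set_foldr in \<open>fastforce simp: free_group_def reduced_foldr foldr_assoc\<close>)+


section \<open>Complete CAT(0) spaces\<close>

definition geodesic :: "'a metric \<Rightarrow> 'a \<Rightarrow> 'a \<Rightarrow> (real \<Rightarrow> 'a) \<Rightarrow> bool" where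
  "geodesic X x y c \<longleftrightarrow>
     c ` {0..mdist X x y} \<subseteq> mspace X \<and> c 0 = x \<and> c (mdist X x y) = y \<and>
     (\<forall>s\<in>{0..mdist X x y}. \<forall>t\<in>{0..mdist X x y}. mdist X (c s) (c t) = \<bar>s - t\<bar>)"

definition geodesic_segments :: "'a metric \<Rightarrow> 'a \<Rightarrow> 'a \<Rightarrow> 'a set set" where
  "geodesic_segments X x y = {c ` {0..mdist X x y} | c. geodesic X x y c}"

definition geodesic_space :: "'a metric \<Rightarrow> bool" where
  "geodesic_space X \<longleftrightarrow>
     (\<forall>x\<in>mspace X. \<forall>y\<in>mspace X. geodesic_segments X x y \<noteq> {})"

text \<open>
  The pairs of a point on a geodesic segment \<open>S\<close> issuing from \<open>x\<close> and its comparison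
  point on the Euclidean segment from \<open>a\<close> to \<open>b\<close>.
\<close>

definition comparison_points ::
  "'a metric \<Rightarrow> 'a \<Rightarrow> 'a set \<Rightarrow> real^2 \<Rightarrow> real^2 \<Rightarrow> ('a \<times> (real^2)) set" where
  "comparison_points X x S a b =
     {(p, p'). p \<in> S \<and> p' \<in> closed_segment a b \<and> dist a p' = mdist X x p}"

definition CAT0_space :: "'a metric \<Rightarrow> bool" where
  "CAT0_space X \<longleftrightarrow> geodesic_space X \<and>
     (\<forall>x\<in>mspace X. \<forall>y\<in>mspace X. \<forall>z\<in>mspace X.
      \<forall>S\<in>geodesic_segments X x y. \<forall>T\<in>geodesic_segments X y z. \<forall>U\<in>geodesic_segments X z x.
      \<forall>a b c. dist a b = mdist X x y \<and> dist b c = mdist X y z \<and> dist c a = mdist X z x \<longrightarrow>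
        (let C = comparison_points X x S a b \<union> comparison_points X y T b c
                   \<union> comparison_points X z U c a
         in \<forall>(p, p')\<in>C. \<forall>(q, q')\<in>C. mdist X p q \<le> dist p' q'))"


section \<open>Covering dimension\<close>

definition covering_dim_le :: "'a topology \<Rightarrow> nat \<Rightarrow> bool" where
  "covering_dim_le T m \<longleftrightarrow>
     (\<forall>\<U>. (\<forall>U\<in>\<U>. openin T U) \<and> \<Union>\<U> = topspace T \<longrightarrow>
       (\<exists>\<V>. (\<forall>V\<in>\<V>. openin T V) \<and> \<Union>\<V> = topspace T \<and>
            (\<forall>V\<in>\<V>. \<exists>U\<in>\<U>. V \<subseteq> U) \<and>
            (\<forall>x\<in>topspace T. finite {V\<in>\<V>. x \<in> V} \<and> card {V\<in>\<V>. x \<in> V} \<le> m + 1)))"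

text \<open>
  The value is \<open>\<infinity>\<close> if no bound exists. The usual convention that the empty space has
  dimension \<open>-1\<close> plays no role: only non-empty spaces are considered below.
\<close>

definition covering_dim :: "'a topology \<Rightarrow> enat" where
  "covering_dim T = (INF m\<in>{m. covering_dim_le T m}. enat m)"

definition complete_CAT0_spaces :: "nat \<Rightarrow> 'a metric set" where
  "complete_CAT0_spaces d =
     {X. mspace X \<noteq> {} \<and> mcomplete_of X \<and> CAT0_space X \<and> covering_dim (mtopology_of X) = enat d}"


section \<open>Isometric actions and fixed points\<close>

definition isometries :: "'a metric \<Rightarrow> ('a \<Rightarrow> 'a) set" where
  "isometries X =
     {f \<in> Bij (mspace X). \<forall>x\<in>mspace X. \<forall>y\<in>mspace X. mdist X (f x) (f y) = mdist X x y}"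

definition isometry_group :: "'a metric \<Rightarrow> ('a \<Rightarrow> 'a) monoid" where
  "isometry_group X = BijGroup (mspace X) \<lparr>carrier := isometries X\<rparr>"

lemma group_isometry_group: "group (isometry_group X)"
proof -
  have "subgroup (isometries X) (BijGroup (mspace X))"
  proof (rule subgroup.intro)
    show "isometries X \<subseteq> carrier (BijGroup (mspace X))"
      by (auto simp: isometries_def BijGroup_def)
  next
    fix f g assume "f \<in> isometries X" "g \<in> isometries X"
    then show "f \<otimes>\<^bsub>BijGroup (mspace X)\<^esub> g \<in> isometries X"
      using Bij_imp_funcset[of g "mspace X"]
      by (auto simp: isometries_def BijGroup_def compose_Bij compose_eq Pi_iff)
  next
    show "\<one>\<^bsub>BijGroup (mspace X)\<^esub> \<in> isometries X"
      by (simp add: isometries_def BijGroup_def id_Bij)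
  next
    fix f assume f: "f \<in> isometries X"
    then have *: "f ` mspace X = mspace X"
      by (auto simp: isometries_def Bij_def bij_betw_def)
    have "mdist X (inv_into (mspace X) f x) (inv_into (mspace X) f y) = mdist X x y"
      if "x \<in> mspace X" "y \<in> mspace X" for x y
      using f that inv_into_into[of _ f "mspace X"] f_inv_into_f[of _ f "mspace X"] *
      unfolding isometries_def by (smt (verit, best) mem_Collect_eq)
    then show "inv\<^bsub>BijGroup (mspace X)\<^esub> f \<in> isometries X"
      using f by (simp add: isometries_def inv_BijGroup restrict_inv_into_Bij)
  qed
  then show ?thesis
    by (simp add: isometry_group_def subgroup.subgroup_is_group group_BijGroup)
qed

text \<open>
  Since HOL cannot quantify over types inside a formula, the type in which the points of the
  spaces live is a parameter; a theorem that leaves it arbitrary speaks about all spaces.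
\<close>

definition property_FA :: "'a itself \<Rightarrow> nat \<Rightarrow> ('g, 'm) monoid_scheme \<Rightarrow> bool" where
  "property_FA (_ :: 'a itself) d G \<longleftrightarrow>
     (\<forall>X \<in> (complete_CAT0_spaces d :: 'a metric set). \<forall>\<phi> \<in> hom G (isometry_group X).
        \<exists>x\<in>mspace X. \<forall>g\<in>carrier G. \<phi> g x = x)"

end

(*
  Let F(S) be the fixed point set of a set S of isometries of a complete CAT(0) space X; it is closed
  and convex, and if S and T commute then projecting a point of F(T) to F(S) shows that F(S) and F(T)
  meet as soon as both are nonempty.  The Helly-type core ("ample duplication"): if each k of k+1
  isometries have a common fixed point, and there are m pairwise commuting conjugates of this family,
  then dim X < mk forces the whole family to fix a point.  Otherwise weighted barycentres map the
  m-fold product of k-simplices to X, sending each facet into the corresponding fixed point set.  A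
  refinement of order at most mk of the cover by complements of fixed point sets, pulled back to the
  product, yields a face-preserving self-map with image in finitely many simplices of dimension < mk;
  this contradicts the Poincare-Miranda theorem.

  Nielsen's theorem gives generators theta: x0 -> x0 x1, x1 -> x1^-1 and signed transpositions such that
  two of them generate a finite group, subsets without theta generate a finite group, and a
  non-commuting chain of k+1 generators containing theta moves only the first k+2 basis elements, so
  that it has n div (k+2) commuting conjugates.  Induction on the size of subsets of generators finishes.
*)

theory Submission
  imports Defs
begin

section \<open>Complete CAT(0) spaces\<close>

text \<open>The range of k reflects three regimes for a connected set of k + 1 generators containing
  theta. For k = 1 the set generates a finite dihedral group; the signs in the generators secure
  this. For k > d + 1 a single copy suffices, because d + 1 \<le> k already permits m = 1. In
  between several commuting copies are needed, and a support of k + 2 basis elements decides how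
  many fit. The extreme case is theta with (1 2), (2 3), ...: theta is linked directly to (1 2), so
  (0 1) may be skipped, which costs one extra basis element.

  The dimension count is made elementary by a point in general position. Its coordinates are powers
  of one number e, and it lies in the hull of at most mk vertices only if e is a root of one of
  finitely many nonzero polynomials. The product of simplices is never triangulated; a cube
  parametrises it in such a way that opposite faces of the cube give the sign conditions of
  Poincare-Miranda.

  Of CAT(0) geometry only one convexity inequality for squared distances is used.\<close>

lemma comparison_triangle_exists:
  fixes p q r :: real
  assumes "0 \<le> p" "0 \<le> q" "0 \<le> r" "p \<le> q + r" "q \<le> p + r" "r \<le> p + q"
  obtains a b c :: "real^2" where "dist a b = p" "dist b c = q" "dist c a = r"
proof (cases "p = 0")
  case True
  then have "q = r" using assms by simp
  have "dist (0::real^2) 0 = p" "dist 0 (vector [q, 0] :: real^2) = q"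
       "dist (vector [q, 0] :: real^2) 0 = r"
    using True \<open>q = r\<close> assms by (simp_all add: norm_vec_def L2_set_def sum_2)
  then show ?thesis by (rule that)
next
  case False
  then have p: "p > 0" using assms by simp
  \<comment> \<open>With a = 0 and b on the first axis, the law of cosines dictates the first
    coordinate of c. The triangle inequalities amount to |u| \<le> r, so the height \<open>v\<close>
    is real.\<close>
  define u where "u = (p\<^sup>2 + r\<^sup>2 - q\<^sup>2) / (2 * p)"
  have u: "2 * p * u = p\<^sup>2 + r\<^sup>2 - q\<^sup>2" using p by (simp add: u_def)
  have "(p - r)\<^sup>2 \<le> q\<^sup>2"
    using abs_le_square_iff[of "p - r" q] assms by linarith
  then have "2 * p * u \<le> 2 * p * r" unfolding u by (simp add: power2_eq_square algebra_simps)
  then have ur: "u \<le> r" using p by simp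
  have "q\<^sup>2 \<le> (p + r)\<^sup>2" using assms by (intro power_mono) auto
  then have "2 * p * (- r) \<le> 2 * p * u" unfolding u by (simp add: power2_eq_square algebra_simps)
  then have "- r \<le> u" using p by (subst (asm) mult_le_cancel_left_pos) auto
  then have le: "u\<^sup>2 \<le> r\<^sup>2" using ur assms(3) by (metis abs_le_iff abs_le_square_iff abs_of_nonneg minus_le_iff)
  define v where "v = sqrt (r\<^sup>2 - u\<^sup>2)"
  have v: "v\<^sup>2 = r\<^sup>2 - u\<^sup>2" using le by (simp add: v_def)
  have "u\<^sup>2 + v\<^sup>2 = r\<^sup>2" using v by simp
  moreover have "(p - u)\<^sup>2 + v\<^sup>2 = q\<^sup>2"
    using v u by (simp add: power2_eq_square algebra_simps)
  ultimately have "dist (0::real^2) (vector [p, 0]) = p" 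
      "dist (vector [p, 0] :: real^2) (vector [u, v]) = q"
      "dist (vector [u, v] :: real^2) 0 = r"
    using assms by (simp_all add: dist_norm norm_vec_def L2_set_def sum_2)
  then show ?thesis by (rule that)
qed

text \<open>Stewart's theorem on the length of a cevian. It removes the Euclidean triangle from the
  comparison.\<close>

lemma dist_convex_combination_squared:
  fixes a b c :: "'v::euclidean_space"
  shows "(dist (a + t *\<^sub>R (b - a)) c)\<^sup>2
       = (1 - t) * (dist c a)\<^sup>2 + t * (dist b c)\<^sup>2 - t * (1 - t) * (dist a b)\<^sup>2"
  unfolding dist_norm power2_norm_eq_inner
  by (simp add: inner_diff inner_add inner_commute algebra_simps)

text \<open>The Bruhat-Tits inequality at an arbitrary ratio t. A single comparison is made: a point
  of the side from x to y against the opposite vertex w, with the Euclidean distance supplied by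
  Stewart's theorem.\<close>

lemma CAT0_inequality:
  assumes "CAT0_space X" and xy: "x \<in> mspace X" "y \<in> mspace X" and t: "0 \<le> t" "t \<le> 1"
  obtains z where "z \<in> mspace X"
    "\<And>w. w \<in> mspace X \<Longrightarrow> (mdist X w z)\<^sup>2
       \<le> (1 - t) * (mdist X w x)\<^sup>2 + t * (mdist X w y)\<^sup>2 - t * (1 - t) * (mdist X x y)\<^sup>2"
proof -
  have geo: "geodesic_space X" using assms by (simp add: CAT0_space_def)
  then obtain g where g: "geodesic X x y g"
    using xy by (fastforce simp: geodesic_space_def geodesic_segments_def)
  define D where "D = mdist X x y"
  have D: "0 \<le> D" by (simp add: D_def)
  have tD: "t * D \<in> {0..D}" using t D by (auto intro: mult_left_le_one_le)
  define S where "S = g ` {0..D}"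
  have S: "S \<in> geodesic_segments X x y"
    using g by (auto simp: geodesic_segments_def S_def D_def)
  define z where "z = g (t * D)"
  have zM: "z \<in> mspace X" and zS: "z \<in> S" using g tD by (auto simp: geodesic_def z_def S_def D_def)
  have zx: "mdist X x z = t * D"
  proof -
    have "mdist X (g 0) (g (t * D)) = \<bar>0 - t * D\<bar>"
      using g tD D unfolding geodesic_def D_def by auto
    then show ?thesis using g t D by (simp add: geodesic_def z_def)
  qed
  show ?thesis
  proof (rule that[OF zM])
    fix w assume w: "w \<in> mspace X"
    obtain T where T: "T \<in> geodesic_segments X y w"
      using geo xy w by (fastforce simp: geodesic_space_def)
    obtain U where U: "U \<in> geodesic_segments X w x"
      using geo xy w by (fastforce simp: geodesic_space_def)
    \<comment> \<open>Comparison points lie on sides, so the vertex w enters as the far end of the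
      side \<open>T\<close>.\<close>
    have wT: "w \<in> T"
    proof -
      obtain h where h: "geodesic X y w h" "T = h ` {0..mdist X y w}"
        using T by (auto simp: geodesic_segments_def)
      then show ?thesis unfolding geodesic_def by (metis atLeastAtMost_iff imageI mdist_nonneg order_refl)
    qed
    obtain a b c :: "real^2" where abc: "dist a b = mdist X x y" "dist b c = mdist X y w"
        "dist c a = mdist X w x"
      by (rule comparison_triangle_exists[of "mdist X x y" "mdist X y w" "mdist X w x"])
        (use mdist_triangle[of x X w y] mdist_triangle[of y X x w] mdist_triangle[of w X y x] xy w
          in \<open>simp_all add: mdist_commute add.commute\<close>)
    define p where "p = a + t *\<^sub>R (b - a)"
    have "p \<in> closed_segment a b"
      unfolding in_segment p_def using t by (intro exI[of _ t]) (simp add: algebra_simps)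
    moreover have "dist a p = mdist X x z"
      using t abc(1) by (simp add: p_def dist_norm zx D_def norm_minus_commute)
    ultimately have 1: "(z, p) \<in> comparison_points X x S a b"
      using zS by (simp add: comparison_points_def)
    have 2: "(w, c) \<in> comparison_points X y T b c"
      using wT abc by (simp add: comparison_points_def)
    have "mdist X z w \<le> dist p c"
    proof -
      have "let C = comparison_points X x S a b \<union> comparison_points X y T b c
                   \<union> comparison_points X w U c a
         in \<forall>(p, p')\<in>C. \<forall>(q, q')\<in>C. mdist X p q \<le> dist p' q'"
        using assms(1) xy w S T U abc unfolding CAT0_space_def by blast
      then show ?thesis using 1 2 by (fastforce simp: Let_def)
    qed
    then have "(mdist X z w)\<^sup>2 \<le> (dist p c)\<^sup>2" by (simp add: power_mono)
    then show "(mdist X w z)\<^sup>2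
       \<le> (1 - t) * (mdist X w x)\<^sup>2 + t * (mdist X w y)\<^sup>2 - t * (1 - t) * (mdist X x y)\<^sup>2"
      unfolding p_def dist_convex_combination_squared abc by (simp add: mdist_commute)
  qed
qed

text \<open>The inequality is all that is kept of the CAT(0) condition; inside this locale there are
  no geodesics or comparison triangles. It expresses uniform convexity of squared distances.\<close>

locale hadamard_space = Metric_space M d for M :: "'a set" and d +
  assumes complete: mcomplete and nonempty: "M \<noteq> {}"
    and convex_inequality: "\<lbrakk>x \<in> M; y \<in> M; 0 \<le> t; t \<le> 1\<rbrakk> \<Longrightarrow> \<exists>z\<in>M. \<forall>w\<in>M. (d w z)\<^sup>2
       \<le> (1 - t) * (d w x)\<^sup>2 + t * (d w y)\<^sup>2 - t * (1 - t) * (d x y)\<^sup>2"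
begin

text \<open>Stands in for the point at ratio t of the geodesic from x to y. Testing the inequality
  at w = x and at w = y bounds the distances to both ends.\<close>

definition between :: "real \<Rightarrow> 'a \<Rightarrow> 'a \<Rightarrow> 'a \<Rightarrow> bool" where
  "between t x y z \<longleftrightarrow> z \<in> M \<and> (\<forall>w\<in>M. (d w z)\<^sup>2
       \<le> (1 - t) * (d w x)\<^sup>2 + t * (d w y)\<^sup>2 - t * (1 - t) * (d x y)\<^sup>2)"

definition closed_convex :: "'a set \<Rightarrow> bool" where
  "closed_convex C \<longleftrightarrow> closedin mtopology C \<and>
     (\<forall>x\<in>C. \<forall>y\<in>C. \<forall>t z. 0 \<le> t \<longrightarrow> t \<le> 1 \<longrightarrow> between t x y z \<longrightarrow> z \<in> C)"

lemma closed_convexD: "closed_convex C \<Longrightarrow> closedin mtopology C" "closed_convex C \<Longrightarrow> C \<subseteq> M"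
  using closedin_subset[of mtopology C] by (auto simp: closed_convex_def)

lemma closed_convex_M: "closed_convex M"
  by (simp add: closed_convex_def between_def)

lemma closed_convexI:
  assumes "closedin mtopology C"
    and "\<And>x y t z. \<lbrakk>x \<in> C; y \<in> C; 0 \<le> t; t \<le> 1; between t x y z\<rbrakk> \<Longrightarrow> z \<in> C"
  shows "closed_convex C"
  using assms unfolding closed_convex_def by metis

lemma closed_convex_between:
  "\<lbrakk>closed_convex C; x \<in> C; y \<in> C; 0 \<le> t; t \<le> 1; between t x y z\<rbrakk> \<Longrightarrow> z \<in> C"
  unfolding closed_convex_def by metis

lemma closed_convex_INT:
  assumes "I \<noteq> {}" and C: "\<And>i. i \<in> I \<Longrightarrow> closed_convex (C i)"
  shows "closed_convex (\<Inter>i\<in>I. C i)"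
proof (rule closed_convexI)
  show "closedin mtopology (\<Inter>i\<in>I. C i)"
    using assms closed_convexD(1) by (intro closedin_INT) auto
  fix x y t z
  assume *: "x \<in> (\<Inter>i\<in>I. C i)" "y \<in> (\<Inter>i\<in>I. C i)" and t: "0 \<le> t" "t \<le> 1" "between t x y z"
  show "z \<in> (\<Inter>i\<in>I. C i)"
  proof
    fix i assume i: "i \<in> I"
    then show "z \<in> C i" using closed_convex_between[OF C[OF i] _ _ t] * by simp
  qed
qed

lemma between_distances:
  assumes "between t x y z" "x \<in> M" "y \<in> M"
  shows "(d x z)\<^sup>2 \<le> t\<^sup>2 * (d x y)\<^sup>2" "(d y z)\<^sup>2 \<le> (1 - t)\<^sup>2 * (d x y)\<^sup>2"
proof -
  have "(d x z)\<^sup>2 \<le> (1 - t) * (d x x)\<^sup>2 + t * (d x y)\<^sup>2 - t * (1 - t) * (d x y)\<^sup>2"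
    using assms by (auto simp: between_def)
  also have "\<dots> = t\<^sup>2 * (d x y)\<^sup>2" using assms by (simp add: algebra_simps power2_eq_square)
  finally show "(d x z)\<^sup>2 \<le> t\<^sup>2 * (d x y)\<^sup>2" .
  have "(d y z)\<^sup>2 \<le> (1 - t) * (d y x)\<^sup>2 + t * (d y y)\<^sup>2 - t * (1 - t) * (d x y)\<^sup>2"
    using assms by (auto simp: between_def)
  also have "\<dots> = (1 - t)\<^sup>2 * (d x y)\<^sup>2"
    using assms by (simp add: algebra_simps power2_eq_square commute)
  finally show "(d y z)\<^sup>2 \<le> (1 - t)\<^sup>2 * (d x y)\<^sup>2" .
qed

text \<open>The image \<open>f z\<close> is as far from the fixed points x and y as z is. Testing
  the inequality at w = \<open>f z\<close> leaves nothing on the right, because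
  \<open>(1 - t) * t\<^sup>2 + t * (1 - t)\<^sup>2 = t * (1 - t)\<close>.\<close>

lemma closed_convex_fixed_points:
  assumes f: "f \<in> M \<rightarrow> M" "\<And>x y. x \<in> M \<Longrightarrow> y \<in> M \<Longrightarrow> d (f x) (f y) = d x y"
  shows "closed_convex {x\<in>M. f x = x}"
  unfolding closed_convex_def
proof (intro conjI ballI allI impI)
  have "continuous_map mtopology mtopology f"
    unfolding metric_continuous_map[OF Metric_space_axioms] using f by (auto simp: Pi_iff)
  then have "closedin mtopology {x \<in> topspace mtopology. f x = id x}"
    by (intro closedin_continuous_maps_eq[OF Hausdorff_space_mtopology]) auto
  then show "closedin mtopology {x\<in>M. f x = x}" by simp
next
  fix x y t z assume xy: "x \<in> {x \<in> M. f x = x}" "y \<in> {x \<in> M. f x = x}"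
    and t: "0 \<le> t" "t \<le> 1" and b: "between t x y z"
  have z: "z \<in> M" "f z \<in> M" using b f by (auto simp: between_def)
  have "d (f z) x = d x z" "d (f z) y = d y z" using f(2)[OF z(1)] xy by (metis (mono_tags, lifting) commute mem_Collect_eq)+
  then have "(d (f z) z)\<^sup>2 \<le> (1 - t) * (d x z)\<^sup>2 + t * (d y z)\<^sup>2 - t * (1 - t) * (d x y)\<^sup>2"
    using b z by (auto simp: between_def)
  also have "\<dots> \<le> (1 - t) * (t\<^sup>2 * (d x y)\<^sup>2) + t * ((1 - t)\<^sup>2 * (d x y)\<^sup>2) - t * (1 - t) * (d x y)\<^sup>2"
    using between_distances[OF b] xy t by (intro diff_right_mono add_mono mult_left_mono) auto
  also have "\<dots> = 0" by (simp add: algebra_simps power2_eq_square)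
  finally show "z \<in> {x \<in> M. f x = x}" using z by simp
qed

section \<open>Weighted squared distances: minimisers, projections and barycentres\<close>

definition energy :: "'b set \<Rightarrow> ('b \<Rightarrow> 'a) \<Rightarrow> ('b \<Rightarrow> real) \<Rightarrow> 'a \<Rightarrow> real" where
  "energy V x w y = (\<Sum>v\<in>V. w v * (d y (x v))\<^sup>2)"

definition weights :: "'b set \<Rightarrow> ('b \<Rightarrow> real) \<Rightarrow> bool" where
  "weights V w \<longleftrightarrow> finite V \<and> (\<forall>v\<in>V. 0 \<le> w v) \<and> (\<Sum>v\<in>V. w v) = 1"

lemma energy_nonneg: "weights V w \<Longrightarrow> 0 \<le> energy V x w y"
  by (auto simp: weights_def energy_def intro: sum_nonneg)

lemma energy_between:
  assumes w: "weights V w" and x: "x ` V \<subseteq> M" and b: "between t p q z" and pq: "p \<in> M" "q \<in> M"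
  shows "energy V x w z \<le> (1 - t) * energy V x w p + t * energy V x w q - t * (1 - t) * (d p q)\<^sup>2"
proof -
  have "energy V x w z \<le> (\<Sum>v\<in>V. w v * ((1 - t) * (d p (x v))\<^sup>2 + t * (d q (x v))\<^sup>2 - t * (1 - t) * (d p q)\<^sup>2))"
    unfolding energy_def
  proof (intro sum_mono mult_left_mono)
    fix v assume "v \<in> V"
    then show "0 \<le> w v" using w by (simp add: weights_def)
    have "x v \<in> M" using x \<open>v \<in> V\<close> by auto
    then show "(d z (x v))\<^sup>2 \<le> (1 - t) * (d p (x v))\<^sup>2 + t * (d q (x v))\<^sup>2 - t * (1 - t) * (d p q)\<^sup>2"
      using b by (metis between_def commute)
  qed
  also have "\<dots> = (1 - t) * energy V x w p + t * energy V x w q - (\<Sum>v\<in>V. w v) * (t * (1 - t) * (d p q)\<^sup>2)"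
    unfolding energy_def sum_distrib_left sum_distrib_right sum.distrib[symmetric] sum_subtractf[symmetric]
    by (intro sum.cong) (simp_all add: algebra_simps)
  also have "\<dots> = (1 - t) * energy V x w p + t * energy V x w q - t * (1 - t) * (d p q)\<^sup>2"
    using w by (simp add: weights_def)
  finally show ?thesis .
qed

lemma between_exists:
  assumes "closed_convex C" "p \<in> C" "q \<in> C" "0 \<le> t" "t \<le> 1"
  obtains z where "z \<in> C" "between t p q z"
proof -
  have "p \<in> M" "q \<in> M" using assms closed_convexD(2) by auto
  then obtain z where "between t p q z" using convex_inequality[of p q t] assms by (auto simp: between_def)
  then show ?thesis using that closed_convex_between[OF assms] by blast
qed

definition minimizer :: "'a set \<Rightarrow> ('a \<Rightarrow> real) \<Rightarrow> 'a \<Rightarrow> bool" where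
  "minimizer C F z \<longleftrightarrow> z \<in> C \<and> (\<forall>y\<in>C. F z \<le> F y)"

text \<open>Move from z towards y by a small ratio t. The energy does not drop below its minimum;
  dividing the convexity estimate by t and letting t tend to 0 leaves the full squared
  distance.\<close>

lemma variance_inequality:
  assumes w: "weights V w" and x: "x ` V \<subseteq> M" and C: "closed_convex C"
    and z: "minimizer C (energy V x w) z" and y: "y \<in> C"
  shows "energy V x w z + (d z y)\<^sup>2 \<le> energy V x w y"
proof (rule field_le_epsilon)
  fix e :: real assume e: "0 < e"
  have zM: "z \<in> M" "y \<in> M" "z \<in> C" using z y C closed_convexD(2) by (auto simp: minimizer_def)
  \<comment> \<open>Chosen so that the error term \<open>t * (d z y)\<^sup>2\<close> is at most e;
    the summand 1 covers y = z.\<close>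
  define t where "t = min 1 (e / (1 + (d z y)\<^sup>2))"
  have pos: "0 < 1 + (d z y)\<^sup>2" by (simp add: add_pos_nonneg)
  have t: "0 < t" "t \<le> 1" using e pos by (auto simp: t_def)
  have "t * (d z y)\<^sup>2 \<le> e / (1 + (d z y)\<^sup>2) * (1 + (d z y)\<^sup>2)"
    using t e pos by (intro mult_mono) (auto simp: t_def)
  then have te: "t * (d z y)\<^sup>2 \<le> e" using pos by simp
  obtain m where m: "m \<in> C" "between t z y m"
    using between_exists[OF C, of z y t] zM y t by auto
  have "energy V x w z \<le> (1 - t) * energy V x w z + t * energy V x w y - t * (1 - t) * (d z y)\<^sup>2"
    using energy_between[OF w x m(2) zM(1,2)] z m(1) by (force simp: minimizer_def)
  then have "t * (energy V x w z + (1 - t) * (d z y)\<^sup>2) \<le> t * energy V x w y"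
    by (simp add: algebra_simps)
  then have "energy V x w z + (1 - t) * (d z y)\<^sup>2 \<le> energy V x w y" using t by simp
  then show "energy V x w z + (d z y)\<^sup>2 \<le> energy V x w y + e" 
    using te by (simp only: left_diff_distrib mult_1 mult_1_left)
qed

lemma minimizer_unique:
  assumes "weights V w" "x ` V \<subseteq> M" "closed_convex C"
    and "minimizer C (energy V x w) z" and y: "y \<in> C" "energy V x w y \<le> energy V x w z"
  shows "y = z"
proof -
  have "(d z y)\<^sup>2 \<le> 0" using order_trans[OF variance_inequality[OF assms(1-5)] y(2)] by simp
  moreover have "z \<in> M" "y \<in> M" using assms closed_convexD(2) by (auto simp: minimizer_def)
  ultimately show ?thesis by simp
qed

text \<open>Two points of almost minimal energy are close, since the energy at their midpoint is not
  below the infimum. Hence a minimising sequence is Cauchy.\<close>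

lemma minimizer_exists:
  assumes w: "weights V w" and x: "x ` V \<subseteq> M" and C: "closed_convex C" "C \<noteq> {}"
  obtains z where "minimizer C (energy V x w) z"
proof -
  let ?F = "energy V x w"
  have CM: "C \<subseteq> M" using C closed_convexD by blast
  define I where "I = Inf (?F ` C)"
  have bdd: "bdd_below (?F ` C)" using energy_nonneg[OF w] by (auto simp: bdd_below_def)
  have I: "I \<le> ?F y" if "y \<in> C" for y unfolding I_def using that bdd by (simp add: cInf_lower)
  have "\<exists>y\<in>C. ?F y < I + 1 / Suc n" for n
    using cInf_lessD[of "?F ` C" "I + 1 / Suc n"] C by (force simp: I_def)
  then obtain s where s: "\<And>n. s n \<in> C" "\<And>n. ?F (s n) < I + 1 / Suc n" by metis
  have sM: "s n \<in> M" for n using s CM by auto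
  have sq: "(d (s m) (s n))\<^sup>2 \<le> 2 * (1 / Suc m + 1 / Suc n)" for m n
  proof -
    obtain z where z: "z \<in> C" "between (1/2) (s m) (s n) z"
      using between_exists[OF C(1), of "s m" "s n" "1/2"] s by auto
    have "I \<le> (1 - 1/2) * ?F (s m) + 1/2 * ?F (s n) - 1/2 * (1 - 1/2) * (d (s m) (s n))\<^sup>2"
      using energy_between[OF w x z(2)] I[OF z(1)] sM by force
    then show ?thesis using s(2)[of m] s(2)[of n] by simp
  qed
  have "MCauchy s"
    unfolding MCauchy_def
  proof (intro conjI allI impI)
    show "range s \<subseteq> M" using sM by auto
    fix e :: real assume "e > 0"
    obtain N where N: "1 / real (Suc N) < e\<^sup>2 / 4" using \<open>e > 0\<close> nat_approx_posE[of "e\<^sup>2/4"] by auto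
    show "\<exists>N. \<forall>n n'. N \<le> n \<longrightarrow> N \<le> n' \<longrightarrow> d (s n) (s n') < e"
    proof (intro exI allI impI)
      fix m n assume "N \<le> m" "N \<le> n"
      then have "1 / real (Suc m) \<le> 1 / real (Suc N)" "1 / real (Suc n) \<le> 1 / real (Suc N)"
        by (simp_all add: frac_le)
      moreover have "2 * (a + b) < e\<^sup>2" if "a \<le> c" "b \<le> c" "c < e\<^sup>2 / 4" for a b c
        using that by simp
      ultimately have "2 * (1 / real (Suc m) + 1 / real (Suc n)) < e\<^sup>2" using N by blast
      then have "(d (s m) (s n))\<^sup>2 < e\<^sup>2" using sq[of m n] by (rule le_less_trans[rotated])
      then show "d (s m) (s n) < e" using \<open>e > 0\<close> by (simp add: power2_less_imp_less)
    qed
  qed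
  then obtain z where z: "limitin mtopology s z sequentially" using complete by (auto simp: mcomplete_def)
  have zC: "z \<in> C"
    using limitin_closedin[OF z closed_convexD(1)[OF C(1)]] s by auto
  then have zM: "z \<in> M" using CM by auto
  have dz: "(\<lambda>n. d (s n) z) \<longlonglongrightarrow> 0"
    using z sM by (simp add: limitin_metric_dist_null)
  have "(\<lambda>n. d (s n) (x v)) \<longlonglongrightarrow> d z (x v)" if "v \<in> V" for v
  proof -
    have "x v \<in> M" using x that by auto
    then have "\<forall>n. norm (d (s n) (x v) - d z (x v)) \<le> d (s n) z"
      using mdist_reverse_triangle[OF sM _ zM, of "x v"] by (simp add: commute[of "x v" z])
    then have "(\<lambda>n. d (s n) (x v) - d z (x v)) \<longlonglongrightarrow> 0"
      by (intro Lim_null_comparison[OF _ dz]) auto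
    then show ?thesis using Lim_null by blast
  qed
  then have "(\<lambda>n. ?F (s n)) \<longlonglongrightarrow> ?F z"
    unfolding energy_def by (intro tendsto_intros) auto
  moreover have "(\<lambda>n. I + 1 / real (Suc n)) \<longlonglongrightarrow> I + 0"
    by (intro tendsto_intros) (use LIMSEQ_inverse_real_of_nat in \<open>simp add: inverse_eq_divide\<close>)
  ultimately have "?F z \<le> I"
    using s(2) by (intro LIMSEQ_le[of "\<lambda>n. ?F (s n)" "?F z" "\<lambda>n. I + 1 / real (Suc n)" I]) (auto simp: less_imp_le)
  then have "minimizer C ?F z" using zC I by (force simp: minimizer_def)
  then show ?thesis by (rule that)
qed

text \<open>For one point of weight 1 the energy is the squared distance, so the nearest point is a
  minimiser and the variance inequality becomes the obtuse-angle estimate.\<close>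

lemma projection:
  assumes C: "closed_convex C" "C \<noteq> {}" and y: "y \<in> M"
  obtains p where "p \<in> C" "\<forall>c\<in>C. (d p y)\<^sup>2 + (d p c)\<^sup>2 \<le> (d c y)\<^sup>2"
proof -
  have w: "weights {()} (\<lambda>_. 1)" by (simp add: weights_def)
  have x: "(\<lambda>_. y) ` {()} \<subseteq> M" using y by auto
  obtain p where p: "minimizer C (energy {()} (\<lambda>_. y) (\<lambda>_. 1)) p"
    using minimizer_exists[OF w x C] .
  show ?thesis
  proof (rule that)
    show "p \<in> C" using p by (simp add: minimizer_def)
    show "\<forall>c\<in>C. (d p y)\<^sup>2 + (d p c)\<^sup>2 \<le> (d c y)\<^sup>2"
      using variance_inequality[OF w x C(1) p] by (simp add: energy_def)
  qed
qed

text \<open>f carries the nearest point p of C to a point of C at the same distance from y, and the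
  obtuse-angle estimate makes the two equal. One p serves all such f at once, as a common fixed
  point requires.\<close>

lemma projection_fixed_point:
  assumes C: "closed_convex C" "C \<noteq> {}" and y: "y \<in> M"
  obtains p where "p \<in> C"
    "\<And>f. \<lbrakk>f y = y; f ` C \<subseteq> C; \<And>a b. a \<in> M \<Longrightarrow> b \<in> M \<Longrightarrow> d (f a) (f b) = d a b\<rbrakk> \<Longrightarrow> f p = p"
proof -
  obtain p where p: "p \<in> C" "\<forall>c\<in>C. (d p y)\<^sup>2 + (d p c)\<^sup>2 \<le> (d c y)\<^sup>2"
    by (rule projection[OF C y]) (rule that)
  show ?thesis
  proof (rule that[OF p(1)])
    fix f assume f: "f y = y" "f ` C \<subseteq> C" "\<And>a b. a \<in> M \<Longrightarrow> b \<in> M \<Longrightarrow> d (f a) (f b) = d a b"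
    have CM: "C \<subseteq> M" using C closed_convexD by blast
    have "d (f p) y = d p y" using f(1) f(3)[of p y] p(1) CM y by auto
    then have "(d p (f p))\<^sup>2 \<le> 0" using bspec[OF p(2), of "f p"] f(2) p(1) by (force simp: image_subset_iff)
    moreover have "p \<in> M" "f p \<in> M" using p(1) f(2) CM by auto
    ultimately show "f p = p" by simp
  qed
qed

definition barycenter :: "'b set \<Rightarrow> ('b \<Rightarrow> 'a) \<Rightarrow> ('b \<Rightarrow> real) \<Rightarrow> 'a" where
  "barycenter V x w = (SOME z. minimizer M (energy V x w) z)"

lemma barycenter:
  assumes "weights V w" "x ` V \<subseteq> M"
  shows "minimizer M (energy V x w) (barycenter V x w)"
  unfolding barycenter_def using minimizer_exists[OF assms closed_convex_M nonempty] by (metis someI_ex)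

lemma barycenter_in_M: "\<lbrakk>weights V w; x ` V \<subseteq> M\<rbrakk> \<Longrightarrow> barycenter V x w \<in> M"
  using barycenter[of V w x] by (simp add: minimizer_def)

text \<open>Projecting the barycentre to C brings it no farther from any \<open>x v\<close> in C, so
  the projection has minimal energy too. Points of weight 0 are exempt, and this is what sends faces
  of a simplex into the right sets.\<close>

lemma barycenter_mem:
  assumes w: "weights V w" and x: "x ` V \<subseteq> M" and C: "closed_convex C"
    and xC: "\<And>v. v \<in> V \<Longrightarrow> w v \<noteq> 0 \<Longrightarrow> x v \<in> C"
  shows "barycenter V x w \<in> C"
proof -
  let ?z = "barycenter V x w"
  have zM: "?z \<in> M" by (rule barycenter_in_M[OF w x])
  have "\<exists>v\<in>V. w v \<noteq> 0" using w sum.neutral[of V w] unfolding weights_def by (metis zero_neq_one)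
  then have ne: "C \<noteq> {}" using xC by blast
  obtain p where p: "p \<in> C" "\<forall>c\<in>C. (d p ?z)\<^sup>2 + (d p c)\<^sup>2 \<le> (d c ?z)\<^sup>2"
    by (rule projection[OF C ne zM]) (rule that)
  have "energy V x w p \<le> energy V x w ?z"
    unfolding energy_def
  proof (intro sum_mono)
    fix v assume v: "v \<in> V"
    show "w v * (d p (x v))\<^sup>2 \<le> w v * (d ?z (x v))\<^sup>2"
    proof (cases "w v = 0")
      case False
      then have "(d p (x v))\<^sup>2 \<le> (d ?z (x v))\<^sup>2"
        using bspec[OF p(2) xC[OF v False]] zero_le_power2[of "d p ?z"]
        unfolding commute[of "x v" ?z] by linarith
      then show ?thesis using v w by (auto simp: weights_def intro: mult_left_mono)
    qed auto
  qed
  moreover have "p \<in> M" using p C closed_convexD by blast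
  ultimately have "p = ?z" by (intro minimizer_unique[OF w x closed_convex_M barycenter[OF w x]])
  then show ?thesis using p by simp
qed

text \<open>Adding the variance inequalities for w and w' leaves an expression linear in the
  difference of the weights. The result is Hoelder continuity of exponent 1/2.\<close>

lemma barycenter_dist:
  assumes w: "weights V w" and w': "weights V w'" and x: "x ` V \<subseteq> M"
  defines "B \<equiv> \<Sum>u\<in>V. \<Sum>v\<in>V. (d (x u) (x v))\<^sup>2"
  shows "(d (barycenter V x w) (barycenter V x w'))\<^sup>2 \<le> B * (\<Sum>v\<in>V. \<bar>w v - w' v\<bar>)"
proof -
  \<comment> \<open>The energy at \<open>x u\<close> bounds the squared distance from
    \<open>x u\<close> to the barycentre, and weights are at most 1; so the constant B is
    independent of the weights.\<close>
  have bound: "(d (barycenter V x w) (x u))\<^sup>2 \<le> B" if w: "weights V w" and u: "u \<in> V" for w u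
  proof -
    have fin: "finite V" using w by (simp add: weights_def)
    have "x u \<in> M" using x u by auto
    have "(d (barycenter V x w) (x u))\<^sup>2 \<le> energy V x w (x u)"
      using variance_inequality[OF w x closed_convex_M barycenter[OF w x] \<open>x u \<in> M\<close>]
        energy_nonneg[OF w, of x "barycenter V x w"] by linarith
    also have "\<dots> \<le> (\<Sum>v\<in>V. (d (x u) (x v))\<^sup>2)"
      unfolding energy_def
    proof (intro sum_mono mult_left_le_one_le)
      fix v assume v: "v \<in> V"
      show "w v \<le> 1" using w v fin member_le_sum[of v V w] by (auto simp: weights_def)
      show "0 \<le> w v" using w v by (auto simp: weights_def)
    qed auto
    also have "\<dots> \<le> B" unfolding B_def
      by (rule member_le_sum[OF u _ fin]) (auto intro: sum_nonneg)
    finally show ?thesis .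
  qed
  let ?z = "barycenter V x w" and ?z' = "barycenter V x w'"
  have "2 * (d ?z ?z')\<^sup>2 \<le> energy V x w ?z' - energy V x w ?z + (energy V x w' ?z - energy V x w' ?z')"
    using variance_inequality[OF w x closed_convex_M barycenter[OF w x] barycenter_in_M[OF w' x]]
      variance_inequality[OF w' x closed_convex_M barycenter[OF w' x] barycenter_in_M[OF w x]]
    by (simp add: commute)
  also have "\<dots> = (\<Sum>v\<in>V. (w v - w' v) * ((d ?z' (x v))\<^sup>2 - (d ?z (x v))\<^sup>2))"
    unfolding energy_def sum.distrib[symmetric] sum_subtractf[symmetric]
    by (intro sum.cong) (simp_all add: algebra_simps)
  also have "\<dots> \<le> (\<Sum>v\<in>V. \<bar>w v - w' v\<bar> * B)"
  proof (intro sum_mono)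
    fix v assume v: "v \<in> V"
    have "\<bar>(d ?z' (x v))\<^sup>2 - (d ?z (x v))\<^sup>2\<bar> \<le> B"
      using bound[OF w v] bound[OF w' v] by (smt (verit) zero_le_power2)
    then have "\<bar>w v - w' v\<bar> * \<bar>(d ?z' (x v))\<^sup>2 - (d ?z (x v))\<^sup>2\<bar> \<le> \<bar>w v - w' v\<bar> * B"
      by (intro mult_left_mono) auto
    then show "(w v - w' v) * ((d ?z' (x v))\<^sup>2 - (d ?z (x v))\<^sup>2) \<le> \<bar>w v - w' v\<bar> * B"
      unfolding abs_mult[symmetric] by linarith
  qed
  also have "\<dots> = B * (\<Sum>v\<in>V. \<bar>w v - w' v\<bar>)" by (simp add: sum_distrib_left mult.commute)
  finally have "2 * (d ?z ?z')\<^sup>2 \<le> B * (\<Sum>v\<in>V. \<bar>w v - w' v\<bar>)" .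
  then show ?thesis using zero_le_power2[of "d ?z ?z'"] by linarith
qed

text \<open>With equal weights the energy is invariant under permutations of the set, so an isometry
  that preserves the set fixes the unique minimiser.\<close>

lemma finite_invariant_set_fixed_point:
  assumes O: "finite O'" "O' \<noteq> {}" "O' \<subseteq> M"
  obtains z where "z \<in> M"
    "\<And>f. \<lbrakk>f \<in> M \<rightarrow> M; f ` O' \<subseteq> O'; \<And>a b. a \<in> M \<Longrightarrow> b \<in> M \<Longrightarrow> d (f a) (f b) = d a b\<rbrakk> \<Longrightarrow> f z = z"
proof -
  define w where "w = (\<lambda>_::'a. 1 / real (card O'))"
  have w: "weights O' w" using O by (simp add: weights_def w_def)
  have x: "(\<lambda>x. x) ` O' \<subseteq> M" using O by auto
  let ?z = "barycenter O' (\<lambda>x. x) w"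
  have zM: "?z \<in> M" by (rule barycenter_in_M[OF w x])
  show ?thesis
  proof (rule that[OF zM])
    fix f assume f: "f \<in> M \<rightarrow> M" "f ` O' \<subseteq> O'" "\<And>a b. a \<in> M \<Longrightarrow> b \<in> M \<Longrightarrow> d (f a) (f b) = d a b"
    have inj: "inj_on f O'"
    proof (rule inj_onI)
      fix a b assume ab: "a \<in> O'" "b \<in> O'" "f a = f b"
      then have M: "a \<in> M" "b \<in> M" "f b \<in> M" using O f(1) by auto
      then have "d a b = 0" using f(3)[of a b] ab(3) by simp
      then show "a = b" using M by simp
    qed
    then have perm: "bij_betw f O' O'"
      using O(1) f(2) by (simp add: bij_betw_def endo_inj_surj)
    have "energy O' (\<lambda>x. x) w (f ?z) = (\<Sum>v\<in>O'. w (f v) * (d (f ?z) (f v))\<^sup>2)"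
      unfolding energy_def by (rule sum.reindex_bij_betw[OF perm, symmetric])
    also have "\<dots> = energy O' (\<lambda>x. x) w ?z"
      unfolding energy_def by (intro sum.cong) (use f(3) zM O in \<open>auto simp: w_def subset_iff\<close>)
    finally show "f ?z = ?z"
      using minimizer_unique[OF w x closed_convex_M barycenter[OF w x]] f(1) zM by (auto simp: Pi_iff)
  qed
qed

end

lemma CAT0_imp_hadamard:
  assumes "CAT0_space X" "mcomplete_of X" "mspace X \<noteq> {}"
  shows "hadamard_space (mspace X) (mdist X)"
proof -
  interpret Metric_space "mspace X" "mdist X" by (rule Metric_space_mspace_mdist)
  show ?thesis
  proof
    show mcomplete using assms by (simp add: mcomplete_of_def)
  next
    fix x y t assume "x \<in> mspace X" "y \<in> mspace X" "0 \<le> t" "t \<le> (1::real)"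
    then show "\<exists>z\<in>mspace X. \<forall>w\<in>mspace X. (mdist X w z)\<^sup>2
       \<le> (1 - t) * (mdist X w x)\<^sup>2 + t * (mdist X w y)\<^sup>2 - t * (1 - t) * (mdist X x y)\<^sup>2"
      by (rule CAT0_inequality[OF assms(1)]) blast
  qed (use assms in auto)
qed

section \<open>The Poincare-Miranda theorem and covers of a product of simplices\<close>

text \<open>Coordinates range over a whole type, so that one type of index pairs serves for all m
  and k. For a countable type the cube is still compact and metrisable.\<close>

definition cube :: "('i \<Rightarrow> real) set" where
  "cube = {t. \<forall>i. 0 \<le> t i \<and> t i \<le> 1}"

lemma compact_cube: "compact (cube :: ('i::countable \<Rightarrow> real) set)"
proof -
  have "cube = (PiE UNIV (\<lambda>_. {0..1}) :: ('i \<Rightarrow> real) set)" by (auto simp: cube_def PiE_def Pi_def)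
  moreover have "compactin (product_topology (\<lambda>_. euclidean) UNIV) (PiE UNIV (\<lambda>_::'i. {0..1::real}))"
    by (simp add: compactin_PiE)
  ultimately show ?thesis by (simp add: euclidean_product_topology)
qed

lemma tendsto_coordinatewise:
  fixes f :: "nat \<Rightarrow> 'i \<Rightarrow> real"
  shows "f \<longlonglongrightarrow> l \<longleftrightarrow> (\<forall>i. (\<lambda>n. f n i) \<longlonglongrightarrow> l i)"
  using limitin_componentwise[of "\<lambda>_::'i. euclidean" UNIV f l sequentially]
  by (simp add: euclidean_product_topology)

text \<open>On each grid, Kuhn's combinatorial lemma finds a small cell in which every
  \<open>G i\<close> is somewhere \<le> 0 and somewhere \<ge> 0. By compactness such cells
  accumulate at a common zero.\<close>

theorem poincare_miranda:
  fixes G :: "'i::countable \<Rightarrow> ('i \<Rightarrow> real) \<Rightarrow> real"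
  assumes J: "finite J" and cont: "\<And>i. i \<in> J \<Longrightarrow> continuous_on cube (G i)"
    and low: "\<And>i t. \<lbrakk>i \<in> J; t \<in> cube; t i = 0\<rbrakk> \<Longrightarrow> G i t \<le> 0"
    and high: "\<And>i t. \<lbrakk>i \<in> J; t \<in> cube; t i = 1\<rbrakk> \<Longrightarrow> 0 \<le> G i t"
  obtains t where "t \<in> cube" "\<And>i. i \<in> J \<Longrightarrow> G i t = 0"
proof -
  obtain h where h: "bij_betw h {0..<card J} J"
    using ex_bij_betw_nat_finite[OF J] by blast
  define n where "n = card J"
  define h' where "h' = inv_into {0..<n} h"
  have h': "h' i < n" "h (h' i) = i" if "i \<in> J" for i
    using that h unfolding h'_def n_def bij_betw_def
    by (metis atLeastLessThan_iff inv_into_into, metis f_inv_into_f)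
  have hJ: "h a \<in> J" "h' (h a) = a" if "a < n" for a
    using that h bij_betw_inv_into_left[OF h, of a] unfolding h'_def n_def
    by (auto simp: bij_betw_def)
  have step: "\<exists>z\<in>cube. \<forall>i\<in>J. \<exists>a\<in>cube. \<exists>b\<in>cube. G i a \<le> 0 \<and> 0 \<le> G i b \<and>
     (\<forall>j. \<bar>a j - z j\<bar> \<le> 1 / real (Suc N)) \<and> (\<forall>j. \<bar>b j - z j\<bar> \<le> 1 / real (Suc N))" for N
  proof -
    define p where "p = Suc N"
    \<comment> \<open>Grid points vary the coordinates in J and put 0 in all others.\<close>
    define pt where "pt = (\<lambda>(x::nat\<Rightarrow>nat) i. if i \<in> J then real (x (h' i)) / real p else 0)"
    have pt: "pt x \<in> cube" if "\<forall>i<n. x i \<le> p" for x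
    proof -
      have "real (x (h' i)) \<le> real p" if "i \<in> J" for i
        using \<open>\<forall>i<n. x i \<le> p\<close> h'(1)[OF that] by simp
      then show ?thesis by (simp add: pt_def cube_def p_def)
    qed
    \<comment> \<open>The sign of \<open>G\<close>, overridden on the faces to meet the boundary
      condition of Kuhn's lemma; \<open>low\<close> and \<open>high\<close> make the override agree
      with the weak sign of \<open>G\<close>.\<close>
    define label where "label = (\<lambda>x a. if x a = 0 then 0 else if x a = p then 1
       else if G (h a) (pt x) < 0 then 0 else (1::nat))"
    have pth: "pt x (h a) = real (x a) / real p" if "a < n" for x a
      using hJ[OF that] by (simp add: pt_def)
    have lab0: "G (h a) (pt x) \<le> 0" if "\<forall>i<n. x i \<le> p" "a < n" "label x a = 0" for x a
      using that low[OF hJ(1) pt, of a x] pth[of a x]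
      by (auto simp: label_def split: if_splits)
    have lab1: "0 \<le> G (h a) (pt x)" if "\<forall>i<n. x i \<le> p" "a < n" "label x a \<noteq> 0" for x a
      using that high[OF hJ(1) pt, of a x] pth[of a x]
      by (auto simp: label_def p_def split: if_splits)
    obtain q where q: "\<forall>i<n. q i < p"
      "\<forall>i<n. \<exists>r s. (\<forall>j<n. q j \<le> r j \<and> r j \<le> q j + 1) \<and> (\<forall>j<n. q j \<le> s j \<and> s j \<le> q j + 1)
         \<and> label r i \<noteq> label s i"
      by (rule kuhn_lemma[of p n label]) (auto simp: label_def p_def)
    have near: "\<bar>pt r j - pt q j\<bar> \<le> 1 / real (Suc N)" if "\<forall>j<n. q j \<le> r j \<and> r j \<le> q j + 1" for r j
    proof (cases "j \<in> J")
      case True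
      then have "q (h' j) \<le> r (h' j)" "r (h' j) \<le> q (h' j) + 1" using that h' by auto
      then have "\<bar>real (r (h' j)) - real (q (h' j))\<bar> \<le> 1" by linarith
      then have "\<bar>real (r (h' j)) - real (q (h' j))\<bar> / real p \<le> 1 / real p" by (intro divide_right_mono) auto
      then show ?thesis using True by (simp add: pt_def p_def diff_divide_distrib[symmetric])
    qed (simp add: pt_def)
    show ?thesis
    proof (rule bexI[of _ "pt q"], rule ballI)
      fix i assume i: "i \<in> J"
      obtain r s where rs: "\<forall>j<n. q j \<le> r j \<and> r j \<le> q j + 1" "\<forall>j<n. q j \<le> s j \<and> s j \<le> q j + 1"
          "label r (h' i) \<noteq> label s (h' i)"
        using q(2) h'(1)[OF i] by blast
      have rp: "\<forall>j<n. r j \<le> p" "\<forall>j<n. s j \<le> p"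
        using rs q(1) by (metis Suc_eq_plus1 Suc_leI le_trans)+
      have *: "\<exists>a\<in>cube. \<exists>b\<in>cube. G i a \<le> 0 \<and> 0 \<le> G i b \<and>
         (\<forall>j. \<bar>a j - pt q j\<bar> \<le> 1 / real (Suc N)) \<and> (\<forall>j. \<bar>b j - pt q j\<bar> \<le> 1 / real (Suc N))"
        if "\<forall>j<n. r j \<le> p" "\<forall>j<n. s j \<le> p" "label r (h' i) = 0" "label s (h' i) \<noteq> 0"
          "\<forall>j<n. q j \<le> r j \<and> r j \<le> q j + 1" "\<forall>j<n. q j \<le> s j \<and> s j \<le> q j + 1" for r s
        using lab0[OF that(1) h'(1)[OF i] that(3)] lab1[OF that(2) h'(1)[OF i] that(4)] pt[OF that(1)] pt[OF that(2)]
          near[OF that(5)] near[OF that(6)]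
        unfolding h'(2)[OF i] by blast
      show "\<exists>a\<in>cube. \<exists>b\<in>cube. G i a \<le> 0 \<and> 0 \<le> G i b \<and>
         (\<forall>j. \<bar>a j - pt q j\<bar> \<le> 1 / real (Suc N)) \<and> (\<forall>j. \<bar>b j - pt q j\<bar> \<le> 1 / real (Suc N))"
      proof (cases "label r (h' i) = 0")
        case True
        then show ?thesis using *[OF rp True] rs by simp
      next
        case False
        then have "label s (h' i) = 0" using rs(3) by (auto simp: label_def split: if_splits)
        then show ?thesis using *[OF rp(2,1) _ False] rs by simp
      qed
    next
      show "pt q \<in> cube" using q by (intro pt) auto
    qed
  qed
  then obtain z where z: "\<And>N. z N \<in> cube"
    and z2: "\<And>N. \<forall>i\<in>J. \<exists>a\<in>cube. \<exists>b\<in>cube. G i a \<le> 0 \<and> 0 \<le> G i b \<and>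
     (\<forall>j. \<bar>a j - z N j\<bar> \<le> 1 / real (Suc N)) \<and> (\<forall>j. \<bar>b j - z N j\<bar> \<le> 1 / real (Suc N))"
    by metis
  obtain t r where t: "t \<in> cube" and r: "strict_mono r" "(z \<circ> r) \<longlonglongrightarrow> t"
    using compact_cube z unfolding compact_eq_seq_compact_metric seq_compact_def by metis
  have inv0: "(\<lambda>n. 1 / real (Suc (r n))) \<longlonglongrightarrow> 0"
    using LIMSEQ_subseq_LIMSEQ[OF LIMSEQ_inverse_real_of_nat r(1)] by (simp add: o_def inverse_eq_divide)
  show ?thesis
  proof (rule that[OF t])
    fix i assume i: "i \<in> J"
    obtain a b where ab: "\<And>N. a N \<in> cube" "\<And>N. b N \<in> cube" "\<And>N. G i (a N) \<le> 0" "\<And>N. 0 \<le> G i (b N)"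
      "\<And>N j. \<bar>a N j - z N j\<bar> \<le> 1 / real (Suc N)" "\<And>N j. \<bar>b N j - z N j\<bar> \<le> 1 / real (Suc N)"
    proof -
      have "\<forall>N. \<exists>a b. a \<in> cube \<and> b \<in> cube \<and> G i a \<le> 0 \<and> 0 \<le> G i b \<and>
        (\<forall>j. \<bar>a j - z N j\<bar> \<le> 1 / real (Suc N)) \<and> (\<forall>j. \<bar>b j - z N j\<bar> \<le> 1 / real (Suc N))"
        using z2 i by blast
      then obtain a b where "\<forall>N. a N \<in> cube \<and> b N \<in> cube \<and> G i (a N) \<le> 0 \<and> 0 \<le> G i (b N) \<and>
        (\<forall>j. \<bar>a N j - z N j\<bar> \<le> 1 / real (Suc N)) \<and> (\<forall>j. \<bar>b N j - z N j\<bar> \<le> 1 / real (Suc N))"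
        by metis
      then show ?thesis using that[of a b] by blast
    qed
    have lim: "(\<lambda>n. y (r n)) \<longlonglongrightarrow> t" if y: "\<And>N j. \<bar>y N j - z N j\<bar> \<le> 1 / real (Suc N)" for y
      unfolding tendsto_coordinatewise
    proof
      fix j
      have "(\<lambda>n. y (r n) j - z (r n) j) \<longlonglongrightarrow> 0"
        by (rule Lim_null_comparison[OF _ inv0]) (use y in auto)
      moreover have "(\<lambda>n. z (r n) j) \<longlonglongrightarrow> t j" using r(2) by (simp add: tendsto_coordinatewise)
      ultimately show "(\<lambda>n. y (r n) j) \<longlonglongrightarrow> t j" using tendsto_add by fastforce
    qed
    have "(\<lambda>n. G i (a (r n))) \<longlonglongrightarrow> G i t"
      by (rule continuous_on_tendsto_compose[OF cont[OF i] lim t]) (use ab in auto)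
    then have "G i t \<le> 0" by (rule LIMSEQ_le_const2) (use ab in auto)
    moreover have "(\<lambda>n. G i (b (r n))) \<longlonglongrightarrow> G i t"
      by (rule continuous_on_tendsto_compose[OF cont[OF i] lim t]) (use ab in auto)
    then have "0 \<le> G i t" by (rule LIMSEQ_le_const) (use ab in auto)
    ultimately show "G i t = 0" by simp
  qed
qed

lemma openin_bump:
  fixes S :: "'x::metric_space set"
  assumes "openin (top_of_set S) W" "closed S"
  obtains f :: "'x \<Rightarrow> real" where "continuous_on S f" "\<And>t. t \<in> S \<Longrightarrow> 0 \<le> f t"
    "\<And>t. t \<in> S \<Longrightarrow> f t \<noteq> 0 \<longleftrightarrow> t \<in> W"
proof (cases "S \<subseteq> W")
  case True
  \<comment> \<open>By convention \<open>infdist\<close> to the empty set is 0, so the distance to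
    the complement, used in the other case, would fail here.\<close>
  show ?thesis by (rule that[of "\<lambda>_. 1"]) (use True in auto)
next
  case False
  obtain T where T: "open T" "W = S \<inter> T" using assms(1) by (auto simp: openin_open)
  then have cl: "closed (S - T)" using assms(2) by (simp add: closed_Diff)
  have ne: "S - T \<noteq> {}" using T False by auto
  show ?thesis
    by (rule that[of "\<lambda>t. infdist t (S - T)"])
      (use T in_closed_iff_infdist_zero[OF cl ne] in \<open>auto intro: continuous_intros infdist_nonneg\<close>)
qed

section \<open>Linear algebra and points in general position in a product of simplices\<close>

lemma homogeneous_system_nontrivial_solution:
  fixes M :: "'v \<Rightarrow> 'b \<Rightarrow> real"
  assumes "finite T" "finite B" "card T < card B"
  shows "\<exists>u. (\<exists>b\<in>B. u b \<noteq> 0) \<and> (\<forall>v\<in>T. (\<Sum>b\<in>B. u b * M v b) = 0)"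
  using assms
proof (induction T arbitrary: B M rule: finite_induct)
  case empty
  then show ?case by (intro exI[of _ "\<lambda>_. 1"]) (auto simp: card_gt_0_iff)
next
  case (insert v T)
  show ?case
  proof (cases "\<forall>b\<in>B. M v b = 0")
    case True
    then show ?thesis using insert.IH[of B M] insert by auto
  next
    case False
    then obtain b0 where b0: "b0 \<in> B" "M v b0 \<noteq> 0" by auto
    \<comment> \<open>Gaussian elimination: a multiple of the equation for v is subtracted from each
      other equation so that the pivot b0 disappears.\<close>
    define M' where "M' = (\<lambda>v' b. M v' b - M v' b0 / M v b0 * M v b)"
    obtain u where u: "\<exists>b\<in>B - {b0}. u b \<noteq> 0" "\<forall>v'\<in>T. (\<Sum>b\<in>B - {b0}. u b * M' v' b) = 0"
    proof -
      have "card T < card (B - {b0})" using insert b0 by simp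
      then show ?thesis using that insert.IH[of "B - {b0}" M'] insert.prems(1) by blast
    qed
    define s where "s = (\<Sum>b\<in>B - {b0}. u b * M v b)"
    define u' where "u' = u(b0 := - s / M v b0)"
    have split: "(\<Sum>b\<in>B. u' b * M v' b) = - s / M v b0 * M v' b0 + (\<Sum>b\<in>B - {b0}. u b * M v' b)" for v'
      using insert.prems(1) b0(1) by (simp add: sum.remove[of B b0] u'_def)
    have "(\<Sum>b\<in>B. u' b * M v' b) = 0" if "v' \<in> insert v T" for v'
    proof (cases "v' = v")
      case True
      then show ?thesis using b0 by (simp add: split s_def)
    next
      case False
      then have "(\<Sum>b\<in>B - {b0}. u b * M' v' b) = 0" using that u by auto
      also have "(\<Sum>b\<in>B - {b0}. u b * M' v' b) = (\<Sum>b\<in>B - {b0}. u b * M v' b) - M v' b0 / M v b0 * s"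
        unfolding s_def sum_distrib_left sum_subtractf[symmetric]
        by (intro sum.cong) (simp_all add: M'_def algebra_simps)
      finally show ?thesis by (simp add: split)
    qed
    moreover have "\<exists>b\<in>B. u' b \<noteq> 0" using u(1) by (auto simp: u'_def)
    ultimately show ?thesis by blast
  qed
qed

text \<open>Stick-breaking: in factor i, coordinate j takes the fraction t (i, j) of what the
  earlier ones left, and coordinate k takes the rest. On the face t (i, j) = 0 coordinate j
  vanishes, on the face t (i, j) = 1 all later ones do.\<close>

definition stick :: "nat \<Rightarrow> (nat \<times> nat \<Rightarrow> real) \<Rightarrow> nat \<Rightarrow> nat \<Rightarrow> real" where
  "stick k t i j = (if j < k then t (i, j) else 1) * (\<Prod>l<j. 1 - t (i, l))"

lemma stick_nonneg: "t \<in> cube \<Longrightarrow> 0 \<le> stick k t i j"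
  by (auto simp: stick_def cube_def intro!: mult_nonneg_nonneg prod_nonneg)

lemma sum_stick: "(\<Sum>j\<le>k. stick k t i j) = 1"
proof -
  have *: "(\<Sum>j<J. t (i, j) * (\<Prod>l<j. 1 - t (i, l))) = 1 - (\<Prod>l<J. 1 - t (i, l))" for J
    by (induction J) (auto simp: algebra_simps)
  have "(\<Sum>j\<le>k. stick k t i j) = (\<Sum>j<k. stick k t i j) + stick k t i k"
    by (simp add: lessThan_Suc_atMost[symmetric])
  also have "(\<Sum>j<k. stick k t i j) = (\<Sum>j<k. t (i, j) * (\<Prod>l<j. 1 - t (i, l)))"
    by (intro sum.cong) (auto simp: stick_def)
  finally show ?thesis by (simp add: * stick_def)
qed

lemma stick_eq_0: "j < k \<Longrightarrow> t (i, j) = 0 \<Longrightarrow> stick k t i j = 0"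
  by (simp add: stick_def)

lemma stick_eq_0': "j < l \<Longrightarrow> t (i, j) = 1 \<Longrightarrow> stick k t i l = 0"
  unfolding stick_def by (auto intro!: prod_zero)

lemma continuous_on_stick [continuous_intros]: "continuous_on S (\<lambda>t. stick k t i j)"
  unfolding stick_def by (cases "j < k") (auto intro!: continuous_intros continuous_on_product_coordinates[THEN continuous_on_subset])

text \<open>The target point lies on a moment curve. Any T of at most mk vertices satisfies a
  nontrivial affine equation, and inserting the powers of e turns it into a nonzero polynomial in e.
  As there are finitely many T, some small e avoids all roots. The factor \<open>S\<close> admits
  masses that are not normalised.\<close>

lemma generic_point:
  fixes m k :: nat and V :: "(nat \<Rightarrow> nat) set"
  assumes "finite V"
  obtains e :: real where "0 < e" "real k * e < 1"
    "\<nexists>T \<mu> S. T \<subseteq> V \<and> card T \<le> m * k \<and> 0 < S \<and> (\<Sum>v\<in>T. \<mu> v) = S \<and>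
       (\<forall>i<m. \<forall>j<k. (\<Sum>v\<in>{v\<in>T. v i = j}. \<mu> v) = S * e ^ (1 + i * k + j))"
proof -
  define N where "N = m * k"
  \<comment> \<open>Row 0 is constant, for the total mass; row 1 + i * k + j records whether v has
    vertex j in factor i. Vertex k of a factor is determined by the others and gets no row, so there
    are mk + 1 rows in all.\<close>
  define M :: "(nat \<Rightarrow> nat) \<Rightarrow> nat \<Rightarrow> real" where
    "M = (\<lambda>v n. if n = 0 then 1 else if v ((n - 1) div k) = (n - 1) mod k then 1 else 0)"
  define TT where "TT = {T. T \<subseteq> V \<and> card T \<le> N}"
  have "finite TT" using assms by (simp add: TT_def)
  have "\<forall>T\<in>TT. \<exists>u. (\<exists>b\<in>{..N}. u b \<noteq> 0) \<and> (\<forall>v\<in>T. (\<Sum>b\<le>N. u b * M v b) = 0)"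
    using assms by (auto simp: TT_def intro!: homogeneous_system_nontrivial_solution finite_subset[of _ V])
  then obtain u where u: "\<And>T. T \<in> TT \<Longrightarrow> \<exists>b\<in>{..N}. u T b \<noteq> 0"
      "\<And>T v. T \<in> TT \<Longrightarrow> v \<in> T \<Longrightarrow> (\<Sum>b\<le>N. u T b * M v b) = 0" by metis
  have "finite (\<Union>T\<in>TT. {x. (\<Sum>b\<le>N. u T b * x ^ b) = 0})"
    using \<open>finite TT\<close> u(1) polyfun_finite_roots[where n = N] by (intro finite_UN_I) auto
  \<comment> \<open>The bound 1 / (k + 1) leaves positive mass for coordinate k of each
    factor.\<close>
  then have "infinite ({0<..<1 / real (Suc k)} - (\<Union>T\<in>TT. {x. (\<Sum>b\<le>N. u T b * x ^ b) = 0}))"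
    by (intro Diff_infinite_finite) (auto simp: infinite_Ioo)
  then obtain e where "e \<in> {0<..<1 / real (Suc k)} - (\<Union>T\<in>TT. {x. (\<Sum>b\<le>N. u T b * x ^ b) = 0})"
    using infinite_imp_nonempty by blast
  then have e: "e \<in> {0<..<1 / real (Suc k)}" "\<And>T. T \<in> TT \<Longrightarrow> (\<Sum>b\<le>N. u T b * e ^ b) \<noteq> 0"
    by auto
  show ?thesis
  proof (rule that)
    show "0 < e" using e by simp
    have "real (Suc k) * e < 1" using e by (simp add: field_simps)
    then show "real k * e < 1" using \<open>0 < e\<close> by (simp add: algebra_simps)
  next
    have False if T: "T \<subseteq> V" "card T \<le> m * k" and S: "0 < S" "(\<Sum>v\<in>T. \<mu> v) = S"
      and eq: "\<forall>i<m. \<forall>j<k. (\<Sum>v\<in>{v\<in>T. v i = j}. \<mu> v) = S * e ^ (1 + i * k + j)" for T \<mu> and S :: real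
    proof -
    have finT: "finite T" using T assms finite_subset by blast
    have TT: "T \<in> TT" using T by (simp add: TT_def N_def)
    have M: "(\<Sum>v\<in>T. \<mu> v * M v b) = S * e ^ b" if "b \<le> N" for b
    proof (cases "b = 0")
      case True
      then show ?thesis using S by (simp add: M_def)
    next
      case False
      then have k: "k > 0" using that by (auto simp: N_def intro: gr0I)
      define i j where "i = (b - 1) div k" and "j = (b - 1) mod k"
      have ij: "i < m" "j < k" using False that k by (auto simp: i_def j_def N_def less_mult_imp_div_less)
      have b: "1 + i * k + j = b" using False by (simp add: i_def j_def)
      have "(\<Sum>v\<in>T. \<mu> v * M v b) = (\<Sum>v\<in>T. if v i = j then \<mu> v else 0)"
        using False by (intro sum.cong) (auto simp: M_def i_def j_def)
      also have "\<dots> = (\<Sum>v\<in>{v\<in>T. v i = j}. \<mu> v)" using finT by (simp add: sum.inter_filter)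
      also have "\<dots> = S * e ^ (1 + i * k + j)" using eq ij by blast
      finally show ?thesis unfolding b .
    qed
    have "S * (\<Sum>b\<le>N. u T b * e ^ b) = (\<Sum>b\<le>N. u T b * (\<Sum>v\<in>T. \<mu> v * M v b))"
      unfolding sum_distrib_left by (intro sum.cong refl) (use M in \<open>simp add: sum_distrib_left[symmetric]\<close>)
    also have "\<dots> = (\<Sum>v\<in>T. \<mu> v * (\<Sum>b\<le>N. u T b * M v b))"
      unfolding sum_distrib_left by (subst sum.swap) (simp add: mult.left_commute)
    also have "\<dots> = 0" using u(2)[OF TT] by (intro sum.neutral) simp
    finally show False using S e(2)[OF TT] by simp
    qed
    then show "\<nexists>T \<mu> S. T \<subseteq> V \<and> card T \<le> m * k \<and> 0 < S \<and> (\<Sum>v\<in>T. \<mu> v) = S \<and>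
       (\<forall>i<m. \<forall>j<k. (\<Sum>v\<in>{v\<in>T. v i = j}. \<mu> v) = S * e ^ (1 + i * k + j))" by blast
  qed
qed

text \<open>The refinement provided by covering dimension may be infinite, since the CAT(0) space is
  not assumed compact. Compactness of the cube makes finitely many of its members enough.\<close>

lemma finite_subcover_of_pullback:
  assumes f: "continuous_map (top_of_set Q) T f" and Q: "compact Q"
    and V: "\<And>A. A \<in> \<V> \<Longrightarrow> openin T A" "topspace T \<subseteq> \<Union>\<V>"
  obtains \<A> where "finite \<A>" "\<A> \<subseteq> \<V>" "\<And>t. t \<in> Q \<Longrightarrow> \<exists>A\<in>\<A>. f t \<in> A"
proof -
  let ?p = "\<lambda>A. {t \<in> Q. f t \<in> A}"
  have op: "openin (top_of_set Q) (?p A)" if "A \<in> \<V>" for A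
    using openin_continuous_map_preimage[OF f V(1)[OF that]] by simp
  have "Q \<subseteq> \<Union>(?p ` \<V>)"
    using continuous_map_image_subset_topspace[OF f] V(2) by auto
  then obtain D where D: "D \<subseteq> ?p ` \<V>" "finite D" "Q \<subseteq> \<Union>D"
    using Q op unfolding compact_eq_openin_cover by (metis (no_types, lifting) imageE)
  obtain \<A> where "\<A> \<subseteq> \<V>" "finite \<A>" "D = ?p ` \<A>"
    using finite_subset_image[OF D(2,1)] by blast
  have "\<exists>A\<in>\<A>. f t \<in> A" if "t \<in> Q" for t
    using that D(3) \<open>D = ?p ` \<A>\<close> by auto
  then show ?thesis using that \<open>finite \<A>\<close> \<open>\<A> \<subseteq> \<V>\<close> by metis
qed

section \<open>A Helly theorem for products of simplices\<close>

context hadamard_space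
begin

lemma continuous_map_barycenter:
  assumes w: "\<And>t. t \<in> Q \<Longrightarrow> weights V (w t)" and x: "x ` V \<subseteq> M"
    and cont: "\<And>v. v \<in> V \<Longrightarrow> continuous_on Q (\<lambda>t. w t v)"
  shows "continuous_map (top_of_set Q) mtopology (\<lambda>t. barycenter V x (w t))"
  unfolding continuous_map_to_metric
proof (intro ballI allI impI)
  fix t0 and r :: real assume "t0 \<in> topspace (top_of_set Q)" and r: "0 < r"
  then have t0: "t0 \<in> Q" by simp
  define B where "B = (\<Sum>u\<in>V. \<Sum>v\<in>V. (d (x u) (x v))\<^sup>2)"
  define g where "g = (\<lambda>t. B * (\<Sum>v\<in>V. \<bar>w t v - w t0 v\<bar>))"
  have "continuous_on Q g" unfolding g_def by (intro continuous_intros cont)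
  then have "openin (top_of_set Q) (Q \<inter> g -` {..<r\<^sup>2})"
    by (intro continuous_openin_preimage_gen) auto
  moreover have "t0 \<in> Q \<inter> g -` {..<r\<^sup>2}" using t0 r by (simp add: g_def)
  moreover have "barycenter V x (w t) \<in> mball (barycenter V x (w t0)) r" if "t \<in> Q \<inter> g -` {..<r\<^sup>2}" for t
  proof -
    have t: "t \<in> Q" "g t < r\<^sup>2" using that by auto
    have "(d (barycenter V x (w t)) (barycenter V x (w t0)))\<^sup>2 \<le> g t"
      unfolding g_def B_def by (rule barycenter_dist[OF w[OF t(1)] w[OF t0] x])
    then have "(d (barycenter V x (w t)) (barycenter V x (w t0)))\<^sup>2 < r\<^sup>2" using t(2) by (rule le_less_trans)
    then have "d (barycenter V x (w t)) (barycenter V x (w t0)) < r"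
      using r by (simp add: power2_less_imp_less)
    then show ?thesis
      using barycenter_in_M[OF w[OF t(1)] x] barycenter_in_M[OF w[OF t0] x] by (simp add: commute)
  qed
  ultimately show "\<exists>U. openin (top_of_set Q) U \<and> t0 \<in> U \<and>
     (\<forall>y\<in>U. barycenter V x (w y) \<in> mball (barycenter V x (w t0)) r)" by blast
qed

text \<open>Each factor has k + 1 sets, so mk is the dimension of the product of simplices. The
  dimension of the space enters once: at most D + 1 \<le> mk sets of the refinement overlap, so each
  value of the self-map is carried by at most mk vertices, too few for the generic point.\<close>

theorem product_Helly:
  fixes F :: "nat \<Rightarrow> nat \<Rightarrow> 'a set" and m k D :: nat
  assumes dim: "covering_dim_le mtopology D" "D + 1 \<le> m * k"
    and conv: "\<And>i j. \<lbrakk>i < m; j \<le> k\<rbrakk> \<Longrightarrow> closed_convex (F i j)"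
    and meet: "\<And>v. \<forall>i<m. v i \<le> k \<Longrightarrow> \<exists>x\<in>M. \<forall>i<m. \<forall>j\<le>k. j \<noteq> v i \<longrightarrow> x \<in> F i j"
  shows "\<exists>i<m. \<exists>x\<in>M. \<forall>j\<le>k. x \<in> F i j"
proof (rule ccontr)
  assume "\<not> ?thesis"
  then have empty: "\<exists>j\<le>k. x \<notin> F i j" if "i < m" "x \<in> M" for i x using that by blast
  define V :: "(nat \<Rightarrow> nat) set" where "V = (\<Pi>\<^sub>E i\<in>{..<m}. {..k})"
  have finV: "finite V" unfolding V_def by (intro finite_PiE) auto
  have Vi: "v i \<le> k" if "v \<in> V" "i < m" for v i using that by (auto simp: V_def PiE_def Pi_def)
  have "\<forall>v\<in>V. \<exists>x\<in>M. \<forall>i<m. \<forall>j\<le>k. j \<noteq> v i \<longrightarrow> x \<in> F i j" using meet Vi by blast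
  then obtain x where x: "\<And>v. v \<in> V \<Longrightarrow> x v \<in> M"
    "\<And>v i j. \<lbrakk>v \<in> V; i < m; j \<le> k; j \<noteq> v i\<rbrakk> \<Longrightarrow> x v \<in> F i j" by metis
  have xM: "x ` V \<subseteq> M" using x by auto
  \<comment> \<open>The weight of the vertex v is a product over the factors. The weights sum to 1
    because a product of sums is a sum over choice functions.\<close>
  define w where "w = (\<lambda>(t::nat \<times> nat \<Rightarrow> real) v. \<Prod>i<m. stick k t i (v i))"
  have w: "weights V (w t)" if "t \<in> cube" for t
  proof -
    have "(\<Prod>i<m. \<Sum>j\<le>k. stick k t i j) = (\<Sum>v\<in>V. w t v)"
      unfolding w_def V_def by (rule prod_sum_PiE) auto
    then show ?thesis
      using finV stick_nonneg[OF that] by (auto simp: weights_def sum_stick w_def intro: prod_nonneg)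
  qed
  define f where "f = (\<lambda>t. barycenter V x (w t))"
  have f: "continuous_map (top_of_set cube) mtopology f"
    unfolding f_def
  proof (rule continuous_map_barycenter[OF w xM])
    show "continuous_on cube (\<lambda>t. w t v)" for v unfolding w_def by (intro continuous_intros)
  qed
  have fM: "f t \<in> M" if "t \<in> cube" for t
    unfolding f_def by (rule barycenter_in_M[OF w[OF that] xM])
  have face: "f t \<in> F i j" if t: "t \<in> cube" "i < m" "j \<le> k" "stick k t i j = 0" for t i j
    unfolding f_def
  proof (rule barycenter_mem[OF w[OF t(1)] xM conv[OF t(2,3)]])
    fix v assume v: "v \<in> V" "w t v \<noteq> 0"
    then have "stick k t i (v i) \<noteq> 0" using t(2) by (auto simp: w_def)
    then have "j \<noteq> v i" using t(4) by auto
    then show "x v \<in> F i j" using x(2)[OF v(1) t(2,3)] by simp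
  qed
  \<comment> \<open>No point lies in all sets of a factor, so every point y admits a vertex v with y
    outside \<open>F i (v i)\<close> for each i; hence these sets cover.\<close>
  define U where "U = (\<lambda>v. {y\<in>M. \<forall>i<m. y \<notin> F i (v i)})"
  have opU: "openin mtopology (U v)" if "v \<in> V" for v
  proof -
    have "U v = topspace mtopology - (\<Union>i<m. F i (v i))" by (auto simp: U_def)
    moreover have "closedin mtopology (\<Union>i<m. F i (v i))"
      using Vi[OF that] conv closed_convexD(1) by (intro closedin_Union) auto
    ultimately show ?thesis by (simp add: openin_diff)
  qed
  have covU: "\<exists>v\<in>V. y \<in> U v" if y: "y \<in> M" for y
  proof -
    obtain j where j: "\<And>i. i < m \<Longrightarrow> j i \<le> k \<and> y \<notin> F i (j i)"
      using empty[OF _ y] by metis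
    then have "restrict j {..<m} \<in> V" "y \<in> U (restrict j {..<m})"
      using y by (auto simp: V_def U_def)
    then show ?thesis by blast
  qed
  have "\<Union>(U ` V) = M"
  proof
    show "\<Union>(U ` V) \<subseteq> M" by (auto simp: U_def)
    show "M \<subseteq> \<Union>(U ` V)" using covU by (meson UN_I subsetI)
  qed
  then have "(\<forall>A\<in>U ` V. openin mtopology A) \<and> \<Union>(U ` V) = topspace mtopology"
    using opU by simp
  note mp[OF spec[OF dim(1)[unfolded covering_dim_le_def]] this]
  then obtain \<V> where \<V>: "\<forall>A\<in>\<V>. openin mtopology A" "\<Union>\<V> = M" "\<forall>A\<in>\<V>. \<exists>B\<in>U ` V. A \<subseteq> B"
    "\<forall>y\<in>M. finite {A\<in>\<V>. y \<in> A} \<and> card {A\<in>\<V>. y \<in> A} \<le> D + 1"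
    unfolding topspace_mtopology by (elim exE conjE) (rule that)
  have "\<forall>A\<in>\<V>. \<exists>v\<in>V. A \<subseteq> U v" using \<V>(3) by blast
  \<comment> \<open>The vertex to which A is charged: A misses \<open>F i (\<tau> A i)\<close> for
    every i, so f t is outside A whenever coordinate \<open>\<tau> A i\<close> of factor i vanishes
    at t.\<close>
  then obtain \<tau> where \<tau>: "\<And>A. A \<in> \<V> \<Longrightarrow> \<tau> A \<in> V" "\<And>A. A \<in> \<V> \<Longrightarrow> A \<subseteq> U (\<tau> A)" by metis
  obtain \<A> where \<A>: "finite \<A>" "\<A> \<subseteq> \<V>" "\<And>t. t \<in> cube \<Longrightarrow> \<exists>A\<in>\<A>. f t \<in> A"
    using finite_subcover_of_pullback[OF f compact_cube, of \<V>] \<V>(1,2) by (metis order_refl topspace_mtopology)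
  have "\<forall>A\<in>\<A>. \<exists>l :: (nat \<times> nat \<Rightarrow> real) \<Rightarrow> real. continuous_on cube l \<and> (\<forall>t\<in>cube. 0 \<le> l t \<and> (l t \<noteq> 0 \<longleftrightarrow> f t \<in> A))"
  proof
    fix A assume "A \<in> \<A>"
    then have "openin (top_of_set cube) {t\<in>cube. f t \<in> A}"
      using openin_continuous_map_preimage[OF f, of A] \<V>(1) \<A>(2) by (simp add: subset_iff)
    then show "\<exists>l :: (nat \<times> nat \<Rightarrow> real) \<Rightarrow> real. continuous_on cube l \<and> (\<forall>t\<in>cube. 0 \<le> l t \<and> (l t \<noteq> 0 \<longleftrightarrow> f t \<in> A))"
    proof (rule openin_bump[OF _ compact_imp_closed[OF compact_cube]])
      fix l :: "(nat \<times> nat \<Rightarrow> real) \<Rightarrow> real"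
      assume L: "continuous_on cube l" "\<And>t. t \<in> cube \<Longrightarrow> 0 \<le> l t"
        "\<And>t. t \<in> cube \<Longrightarrow> l t \<noteq> 0 \<longleftrightarrow> t \<in> {t\<in>cube. f t \<in> A}"
      have "\<forall>t\<in>cube. 0 \<le> l t \<and> (l t \<noteq> 0 \<longleftrightarrow> f t \<in> A)" using L(2,3) by simp
      then show "\<exists>l :: (nat \<times> nat \<Rightarrow> real) \<Rightarrow> real. continuous_on cube l \<and> (\<forall>t\<in>cube. 0 \<le> l t \<and> (l t \<noteq> 0 \<longleftrightarrow> f t \<in> A))"
        using L(1) by blast
    qed
  qed
  then obtain l :: "'a set \<Rightarrow> (nat \<times> nat \<Rightarrow> real) \<Rightarrow> real" where l: "\<And>A. A \<in> \<A> \<Longrightarrow> continuous_on cube (l A)"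
    "\<And>A t. \<lbrakk>A \<in> \<A>; t \<in> cube\<rbrakk> \<Longrightarrow> 0 \<le> l A t"
    "\<And>A t. \<lbrakk>A \<in> \<A>; t \<in> cube\<rbrakk> \<Longrightarrow> l A t \<noteq> 0 \<longleftrightarrow> f t \<in> A" by metis
  obtain e :: real where e: "0 < e" "real k * e < 1"
    and generic: "\<nexists>T \<mu> S. T \<subseteq> V \<and> card T \<le> m * k \<and> 0 < S \<and> (\<Sum>v\<in>T. \<mu> v) = S \<and>
       (\<forall>i<m. \<forall>j<k. (\<Sum>v\<in>{v\<in>T. v i = j}. \<mu> v) = S * e ^ (1 + i * k + j))"
    by (rule generic_point[OF finV, of k m]) (rule that)
  \<comment> \<open>Completes the generic coordinates to a point of the product. All coordinates are
    positive because k * e < 1, so the tails occurring in \<open>G\<close> can be cancelled.\<close>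
  define c where "c = (\<lambda>i j. if j < k then e ^ (1 + i * k + j) else 1 - (\<Sum>j<k. e ^ (1 + i * k + j)))"
  have c_pos: "0 < c i j" for i j
  proof (cases "j < k")
    case False
    have e1: "k = 0 \<or> e \<le> 1"
    proof (cases "k = 0")
      case False
      then have "1 * e \<le> real k * e" using e by (intro mult_right_mono) auto
      then show ?thesis using e by linarith
    qed simp
    have "(\<Sum>j<k. e ^ (1 + i * k + j)) \<le> (\<Sum>j<k. e)"
      using e e1 by (intro sum_mono) (auto intro!: mult_left_le power_le_one)
    then show ?thesis using False e by (simp add: c_def)
  qed (use e in \<open>simp add: c_def\<close>)
  have c_sum: "(\<Sum>j\<le>k. c i j) = 1" for i
    by (simp add: c_def lessThan_Suc_atMost[symmetric])
  \<comment> \<open>Unnormalised coordinates of the self-map: the mass charged to vertex j of factor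
    i.\<close>
  define h where "h = (\<lambda>i j t. \<Sum>A\<in>{A\<in>\<A>. \<tau> A i = j}. l A t)"
  \<comment> \<open>Compares the share of \<open>h i j\<close> in the tail j, ..., k with the share
    that c prescribes. Tails fit stick-breaking: on one face \<open>h i j\<close> vanishes, on the
    opposite face the rest of the tail does, which gives the two signs.\<close>
  define G where "G = (\<lambda>(i, j) t. h i j t * (\<Sum>j'\<in>{j..k}. c i j') - c i j * (\<Sum>j'\<in>{j..k}. h i j' t))"
  have h_nonneg: "0 \<le> h i j t" if "t \<in> cube" for i j t
    unfolding h_def using l(2) that by (intro sum_nonneg) auto
  have h_face: "h i j t = 0" if t: "t \<in> cube" "i < m" "j \<le> k" "stick k t i j = 0" for t i j
    unfolding h_def
  proof (rule sum.neutral, rule ballI)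
    fix A assume A: "A \<in> {A \<in> \<A>. \<tau> A i = j}"
    then have "f t \<notin> A" using face[OF t] \<tau>(2)[of A] \<A>(2) t(2) by (auto simp: U_def)
    then show "l A t = 0" using l(3)[of A t] A t(1) by auto
  qed
  obtain t where t: "t \<in> cube" "\<And>p. p \<in> {..<m} \<times> {..<k} \<Longrightarrow> G p t = 0"
  proof (rule poincare_miranda[of "{..<m} \<times> {..<k}" G])
    fix p assume p: "p \<in> {..<m} \<times> {..<k}"
    obtain i j where ij: "p = (i, j)" "i < m" "j < k" using p by auto
    show "continuous_on cube (G p)"
      unfolding ij(1) G_def h_def using l(1) by (auto intro!: continuous_intros)
    fix t :: "nat \<times> nat \<Rightarrow> real" assume t: "t \<in> cube"
    show "G p t \<le> 0" if "t p = 0"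
    proof -
      have "h i j t = 0" using h_face[OF t, of i j] stick_eq_0[of j k t i] that ij by simp
      moreover have "0 \<le> c i j * (\<Sum>j'\<in>{j..k}. h i j' t)"
        by (intro mult_nonneg_nonneg sum_nonneg less_imp_le[OF c_pos] h_nonneg[OF t])
      ultimately show ?thesis by (simp add: ij(1) G_def)
    qed
    show "0 \<le> G p t" if "t p = 1"
    proof -
      have z: "h i j' t = 0" if "j < j'" "j' \<le> k" for j'
        using h_face[OF t, of i j'] stick_eq_0'[of j j' t i k] that \<open>t p = 1\<close> ij by simp
      have split: "(\<Sum>j'\<in>{j..k}. g j') = g j + (\<Sum>j'\<in>{Suc j..k}. g j')" for g :: "nat \<Rightarrow> real"
        using ij by (simp add: sum.atLeast_Suc_atMost)
      have "(\<Sum>j'\<in>{Suc j..k}. h i j' t) = 0" using z by (intro sum.neutral) auto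
      then have "G p t = h i j t * (\<Sum>j'\<in>{Suc j..k}. c i j')"
        by (simp add: ij(1) G_def split algebra_simps)
      then show ?thesis
        by (auto intro!: mult_nonneg_nonneg sum_nonneg less_imp_le[OF c_pos] h_nonneg[OF t])
    qed
  qed auto
  define S where "S = (\<Sum>A\<in>\<A>. l A t)"
  have total: "(\<Sum>j\<le>k. h i j t) = S" if i: "i < m" for i
  proof -
    have "(\<Sum>j\<in>{..k}. \<Sum>A\<in>{A\<in>\<A>. \<tau> A i = j}. l A t) = S"
      unfolding S_def by (rule sum.group) (use \<A> \<tau>(1) Vi i in auto)
    then show ?thesis by (simp add: h_def)
  qed
  \<comment> \<open>At a common zero of the \<open>G\<close> the shares are fixed one after the
    other, starting from the total S, until h equals S times c.\<close>
  have tail: "(\<Sum>j'\<in>{j..k}. h i j' t) = S * (\<Sum>j'\<in>{j..k}. c i j')" if "i < m" "j \<le> k" for i j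
    using that(2)
  proof (induction j)
    case 0
    then show ?case using total[OF that(1)] c_sum[of i] by (simp add: atLeast0AtMost)
  next
    case (Suc j)
    let ?C = "\<lambda>j. \<Sum>j'\<in>{j..k}. c i j'" and ?H = "\<lambda>j. \<Sum>j'\<in>{j..k}. h i j' t"
    have "?C j > 0" using Suc c_pos by (intro sum_pos) auto
    have IH: "?H j = S * ?C j" using Suc by simp
    have "G (i, j) t = 0" using t(2) that(1) Suc by auto
    then have "h i j t * ?C j = (c i j * S) * ?C j" using IH by (simp add: G_def algebra_simps)
    then have hj: "h i j t = c i j * S" using \<open>?C j > 0\<close> by simp
    have split: "(\<Sum>j'\<in>{j..k}. g j') = g j + (\<Sum>j'\<in>{Suc j..k}. g j')" for g :: "nat \<Rightarrow> real"
      using Suc by (simp add: sum.atLeast_Suc_atMost)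
    show ?case using IH hj by (simp add: split algebra_simps)
  qed
  have hc: "h i j t = S * e ^ (1 + i * k + j)" if "i < m" "j < k" for i j
  proof -
    have split: "(\<Sum>j'\<in>{j..k}. g j') = g j + (\<Sum>j'\<in>{Suc j..k}. g j')" for g :: "nat \<Rightarrow> real"
      using that by (simp add: sum.atLeast_Suc_atMost)
    have "h i j t = S * c i j"
      using tail[of i j] tail[of i "Suc j"] that by (simp add: split algebra_simps)
    then show ?thesis using that by (simp add: c_def)
  qed
  \<comment> \<open>The members that contain f t, at most D + 1 in number; several may be charged to
    one vertex, which only lowers the count of vertices.\<close>
  define A1 where "A1 = {A\<in>\<A>. l A t \<noteq> 0}"
  have A1: "finite A1" "A1 \<subseteq> \<A>" "A1 \<subseteq> {A\<in>\<V>. f t \<in> A}"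
    using \<A> l(3) t(1) by (auto simp: A1_def)
  have "card A1 \<le> D + 1"
    using \<V>(4) fM[OF t(1)] card_mono[OF _ A1(3)] by force
  define T where "T = \<tau> ` A1"
  define \<mu> where "\<mu> = (\<lambda>v. \<Sum>A\<in>{A\<in>A1. \<tau> A = v}. l A t)"
  have S1: "S = (\<Sum>A\<in>A1. l A t)"
    unfolding S_def A1_def using \<A>(1) by (intro sum.mono_neutral_right) auto
  have h1: "h i j t = (\<Sum>A\<in>{A\<in>A1. \<tau> A i = j}. l A t)" for i j
    unfolding h_def A1_def using \<A>(1) by (intro sum.mono_neutral_right) auto
  have "T \<subseteq> V \<and> card T \<le> m * k \<and> 0 < S \<and> (\<Sum>v\<in>T. \<mu> v) = S \<and>
       (\<forall>i<m. \<forall>j<k. (\<Sum>v\<in>{v\<in>T. v i = j}. \<mu> v) = S * e ^ (1 + i * k + j))"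
  proof (intro conjI allI impI)
    show "T \<subseteq> V" using A1 \<A>(2) \<tau>(1) by (auto simp: T_def)
    show "card T \<le> m * k" using \<open>card A1 \<le> D + 1\<close> dim(2) card_image_le[OF A1(1), of \<tau>] by (simp add: T_def)
    obtain A where "A \<in> \<A>" "f t \<in> A" using \<A>(3)[OF t(1)] by auto
    then show "0 < S" unfolding S_def
      using l(2,3)[OF _ t(1)] by (intro sum_pos2[OF \<A>(1), of A]) (auto simp: less_le)
    show "(\<Sum>v\<in>T. \<mu> v) = S"
      unfolding \<mu>_def S1 T_def by (rule sum.group) (use A1 in auto)
    fix i j assume ij: "i < m" "j < k"
    have "(\<Sum>v\<in>{v\<in>T. v i = j}. \<mu> v) = (\<Sum>v\<in>{v\<in>T. v i = j}. \<Sum>A\<in>{A\<in>{A\<in>A1. \<tau> A i = j}. \<tau> A = v}. l A t)"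
      unfolding \<mu>_def by (intro sum.cong) auto
    also have "\<dots> = (\<Sum>A\<in>{A\<in>A1. \<tau> A i = j}. l A t)"
      by (rule sum.group) (use A1 in \<open>auto simp: T_def\<close>)
    finally show "(\<Sum>v\<in>{v\<in>T. v i = j}. \<mu> v) = S * e ^ (1 + i * k + j)" using hc[OF ij] h1 by simp
  qed
  then show False using generic by blast
qed

end

section \<open>Substitutions in free groups\<close>

text \<open>Group operations on bare lists, without the rank n, so that word identities ask for
  reducedness alone. A product is reduced as soon as its right factor is.\<close>

definition wmul :: "letter list \<Rightarrow> letter list \<Rightarrow> letter list" where
  "wmul u v = foldr cons_letter u v"

definition winv :: "letter list \<Rightarrow> letter list" where
  "winv w = rev (map inv_letter w)"

abbreviation "words n \<equiv> carrier (free_group n)"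

lemma words_iff: "w \<in> words n \<longleftrightarrow> set w \<subseteq> {..<n} \<times> UNIV \<and> reduced w"
  by (simp add: free_group_def)

lemma mult_free_group: "u \<otimes>\<^bsub>free_group n\<^esub> v = wmul u v"
  by (simp add: free_group_def wmul_def)

lemma wmul_Nil [simp]: "wmul [] w = w" by (simp add: wmul_def)

lemma wmul_Cons: "wmul (x # v) w = cons_letter x (wmul v w)" by (simp add: wmul_def)

lemma wmul_Nil_right [simp]: "reduced w \<Longrightarrow> wmul w [] = w"
  by (simp add: wmul_def foldr_cons_letter_Nil)

lemma wmul_append: "wmul (u @ v) w = wmul u (wmul v w)"
  by (simp add: wmul_def)

lemma reduced_wmul [simp]: "reduced v \<Longrightarrow> reduced (wmul u v)"
  by (simp add: wmul_def reduced_foldr)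

lemma wmul_assoc: "reduced w \<Longrightarrow> wmul (wmul u v) w = wmul u (wmul v w)"
  by (simp add: wmul_def foldr_assoc)

lemma wmul_words: "u \<in> words n \<Longrightarrow> v \<in> words n \<Longrightarrow> wmul u v \<in> words n"
  using set_foldr[of u v] by (auto simp: words_iff wmul_def reduced_foldr)

lemma wmul_reduced: "reduced (u @ v) \<Longrightarrow> wmul u v = u @ v"
proof (induction u)
  case (Cons x u)
  then have "wmul u v = u @ v" by (simp add: reduced_Cons)
  then show ?case using Cons.prems cons_letter_reduced[of x "u @ v"] by (simp add: wmul_Cons)
qed simp

lemma reduced_append:
  "reduced (u @ v) \<longleftrightarrow> reduced u \<and> reduced v \<and> (u = [] \<or> v = [] \<or> hd v \<noteq> inv_letter (last u))"
  by (auto simp: reduced_def successively_append_iff)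

lemma inv_letter_eq_iff: "inv_letter x = inv_letter y \<longleftrightarrow> x = y"
  by (metis inv_letter_inv_letter)

lemma fst_inv_letter [simp]: "fst (inv_letter x) = fst x"
  by (simp add: inv_letter_def)

lemma winv_Nil [simp]: "winv [] = []" by (simp add: winv_def)

lemma length_winv [simp]: "length (winv w) = length w" by (simp add: winv_def)

lemma winv_append: "winv (u @ v) = winv v @ winv u" by (simp add: winv_def)

lemma winv_winv [simp]: "winv (winv w) = w" by (simp add: winv_def rev_map o_def)

lemma winv_Cons: "winv (x # w) = winv w @ [inv_letter x]" by (simp add: winv_def)

lemma winv_eq_Nil [simp]: "winv w = [] \<longleftrightarrow> w = []" by (simp add: winv_def)

lemma reduced_winv [simp]: "reduced (winv w) \<longleftrightarrow> reduced w"
proof -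
  have "reduced (winv w)" if "reduced w" for w
    using that
  proof (induction w)
    case (Cons x w)
    then show ?case
      by (cases w) (auto simp: winv_Cons reduced_append reduced_Cons inv_letter_eq_iff)
  qed simp
  then show ?thesis by (metis winv_winv)
qed

lemma winv_words: "w \<in> words n \<Longrightarrow> winv w \<in> words n"
  by (auto simp: words_iff) (auto simp: winv_def inv_letter_def)

lemma wmul_winv_left: "reduced w \<Longrightarrow> wmul (winv w) w = []"
  by (simp add: wmul_def winv_def foldr_inv_word)

lemma wmul_winv_right: "reduced w \<Longrightarrow> wmul w (winv w) = []"
  using wmul_winv_left[of "winv w"] by simp

lemma wmul_winv_cancel: "reduced v \<Longrightarrow> reduced w \<Longrightarrow> wmul v (wmul (winv v) w) = w"
  by (metis wmul_Nil wmul_assoc wmul_winv_right)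

lemma winv_unique: "\<lbrakk>reduced v; reduced w; wmul v w = []\<rbrakk> \<Longrightarrow> w = winv v"
  by (metis reduced_winv wmul_Nil wmul_Nil_right wmul_assoc wmul_winv_left)

lemma winv_wmul: "\<lbrakk>reduced u; reduced v\<rbrakk> \<Longrightarrow> winv (wmul u v) = wmul (winv v) (winv u)"
  by (rule winv_unique[symmetric]) (simp_all add: wmul_assoc wmul_winv_cancel wmul_winv_right)

section \<open>Endomorphisms given by the images of the basis\<close>

definition letter_image :: "(nat \<Rightarrow> letter list) \<Rightarrow> letter \<Rightarrow> letter list" where
  "letter_image u x = (if snd x then u (fst x) else winv (u (fst x)))"

definition subst :: "(nat \<Rightarrow> letter list) \<Rightarrow> letter list \<Rightarrow> letter list" where
  "subst u w = foldr (\<lambda>x. wmul (letter_image u x)) w []"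

text \<open>Indices from n on are sent to themselves. Thus \<open>u i\<close> is reduced for every
  i, and the algebra of \<open>subst\<close> carries no bounds on indices.\<close>

definition proper :: "nat \<Rightarrow> (nat \<Rightarrow> letter list) \<Rightarrow> bool" where
  "proper n u \<longleftrightarrow> (\<forall>i<n. u i \<in> words n) \<and> (\<forall>i\<ge>n. u i = [(i, True)])"

lemma reduced_singleton [simp]: "reduced [x]" by (simp add: reduced_def)

lemma proper_reduced: "proper n u \<Longrightarrow> reduced (u i)"
  by (cases "i < n") (auto simp: proper_def words_iff)

lemma subst_Nil [simp]: "subst u [] = []" by (simp add: subst_def)

lemma subst_Cons: "subst u (x # w) = wmul (letter_image u x) (subst u w)" by (simp add: subst_def)

lemma letter_image_inv [simp]: "letter_image u (inv_letter x) = winv (letter_image u x)"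
  by (simp add: letter_image_def inv_letter_def)

context
  fixes u :: "nat \<Rightarrow> letter list"
  assumes u: "\<And>i. reduced (u i)"
begin

lemma reduced_letter_image: "reduced (letter_image u x)"
  using u by (simp add: letter_image_def)

lemma reduced_subst: "reduced (subst u w)"
  by (induction w) (auto simp: subst_Cons)

lemma subst_singleton: "subst u [x] = letter_image u x"
  by (simp add: subst_Cons reduced_letter_image)

lemma subst_append: "subst u (v @ w) = wmul (subst u v) (subst u w)"
  by (induction v) (auto simp: subst_Cons wmul_assoc reduced_subst)

lemma subst_cons_letter: "subst u (cons_letter x w) = wmul (letter_image u x) (subst u w)"
proof (cases w)
  case (Cons y v)
  show ?thesis
    using wmul_winv_cancel[OF reduced_letter_image reduced_subst, of x v]
    by (auto simp: Cons subst_Cons)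
qed (simp add: subst_Cons)

lemma subst_wmul: "subst u (wmul v w) = wmul (subst u v) (subst u w)"
  by (induction v) (auto simp: wmul_Cons subst_cons_letter subst_Cons wmul_assoc reduced_subst)

lemma subst_winv: "reduced w \<Longrightarrow> subst u (winv w) = winv (subst u w)"
  by (rule winv_unique) (simp_all add: reduced_subst subst_wmul[symmetric] wmul_winv_right)

lemma subst_letter_image:
  "(\<And>i. reduced (v i)) \<Longrightarrow> subst u (letter_image v x) = letter_image (\<lambda>i. subst u (v i)) x"
  by (simp add: letter_image_def subst_winv)

lemma subst_subst:
  assumes "\<And>i. reduced (v i)"
  shows "subst u (subst v w) = subst (\<lambda>i. subst u (v i)) w"
  by (induction w) (simp_all add: subst_Cons subst_wmul subst_letter_image assms)

end

lemma letter_image_words: "\<lbrakk>proper n u; fst x < n\<rbrakk> \<Longrightarrow> letter_image u x \<in> words n"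
  by (auto simp: proper_def letter_image_def winv_words)

lemma subst_words: "\<lbrakk>proper n u; w \<in> words n\<rbrakk> \<Longrightarrow> subst u w \<in> words n"
proof (induction w)
  case (Cons x w)
  then show ?case by (auto simp: subst_Cons words_iff[of "_ # _"] reduced_Cons words_iff[of w]
      intro!: wmul_words letter_image_words)
qed simp

lemma subst_cong:
  assumes "\<And>x. x \<in> set w \<Longrightarrow> u (fst x) = v (fst x)"
  shows "subst u w = subst v w"
  using assms by (induction w) (simp_all add: subst_Cons letter_image_def)

lemma subst_trivial:
  assumes "reduced w" "\<And>x. x \<in> set w \<Longrightarrow> u (fst x) = [(fst x, True)]"
  shows "subst u w = w"
  using assms
proof (induction w)
  case (Cons x w)
  have "letter_image u x = [x]"
    using Cons.prems(2)[of x] by (cases x) (auto simp: letter_image_def winv_def inv_letter_def)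
  then show ?case using Cons by (simp add: subst_Cons reduced_Cons[of x w] wmul_Cons cons_letter_reduced)
qed simp

section \<open>Automorphisms as substitutions\<close>

definition subst_aut :: "nat \<Rightarrow> (nat \<Rightarrow> letter list) \<Rightarrow> letter list \<Rightarrow> letter list" where
  "subst_aut n u = restrict (subst u) (words n)"

definition comp_subst :: "(nat \<Rightarrow> letter list) \<Rightarrow> (nat \<Rightarrow> letter list) \<Rightarrow> nat \<Rightarrow> letter list" where
  "comp_subst u v i = subst u (v i)"

lemma proper_comp_subst: "\<lbrakk>proper n u; proper n v\<rbrakk> \<Longrightarrow> proper n (comp_subst u v)"
  using proper_reduced[of n u]
  by (auto simp: proper_def[of n v] proper_def[of n "comp_subst u v"] comp_subst_def subst_words subst_singleton)
     (simp add: letter_image_def proper_def)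

abbreviation "Aut n \<equiv> AutoGroup (free_group n)"

lemma carrier_Aut: "carrier (Aut n) = auto (free_group n)" by (simp add: AutoGroup_def)

lemma group_Aut: "group (Aut n)" by (rule group.AutoGroup[OF group_free_group])

lemma mult_Aut: "\<lbrakk>f \<in> carrier (Aut n); g \<in> carrier (Aut n)\<rbrakk> \<Longrightarrow> f \<otimes>\<^bsub>Aut n\<^esub> g = compose (words n) f g"
  by (simp add: AutoGroup_def BijGroup_def auto_def)

lemma one_Aut: "\<one>\<^bsub>Aut n\<^esub> = restrict (\<lambda>x. x) (words n)"
  by (simp add: AutoGroup_def BijGroup_def)

lemma subst_aut_in_Aut:
  assumes u: "proper n u" and v: "proper n v"
    and uv: "\<And>i. i < n \<Longrightarrow> subst u (v i) = [(i, True)]" and vu: "\<And>i. i < n \<Longrightarrow> subst v (u i) = [(i, True)]"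
  shows "subst_aut n u \<in> carrier (Aut n)"
proof -
  note ru = proper_reduced[OF u] and rv = proper_reduced[OF v]
  have "subst u (subst v w) = w" if "w \<in> words n" for w
    unfolding subst_subst[OF ru rv] using that uv by (intro subst_trivial) (auto simp: words_iff)
  moreover have "subst v (subst u w) = w" if "w \<in> words n" for w
    unfolding subst_subst[OF rv ru] using that vu by (intro subst_trivial) (auto simp: words_iff)
  ultimately have "bij_betw (subst u) (words n) (words n)"
    using subst_words[OF u] subst_words[OF v]
    by (intro bij_betwI[where g = "subst v"]) auto
  then have "bij_betw (subst_aut n u) (words n) (words n)"
    by (simp add: subst_aut_def)
  moreover have "subst_aut n u \<in> hom (free_group n) (free_group n)"
    using subst_words[OF u]
    by (auto simp: hom_def subst_aut_def mult_free_group wmul_words subst_wmul[OF ru])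
  ultimately show ?thesis
    by (simp add: carrier_Aut auto_def Bij_def subst_aut_def)
qed

lemma subst_aut_mult:
  assumes "proper n u" "proper n v" "subst_aut n u \<in> carrier (Aut n)" "subst_aut n v \<in> carrier (Aut n)"
  shows "subst_aut n u \<otimes>\<^bsub>Aut n\<^esub> subst_aut n v = subst_aut n (comp_subst u v)"
  unfolding mult_Aut[OF assms(3,4)]
proof (rule ext)
  fix w
  show "compose (words n) (subst_aut n u) (subst_aut n v) w = subst_aut n (comp_subst u v) w"
    using subst_words[OF assms(2)] subst_subst[OF proper_reduced[OF assms(1)] proper_reduced[OF assms(2)]]
    by (auto simp: compose_def subst_aut_def comp_subst_def[abs_def])
qed

lemma subst_aut_cong:
  assumes "\<And>i. i < n \<Longrightarrow> u i = v i"
  shows "subst_aut n u = subst_aut n v"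
proof (rule ext)
  fix w show "subst_aut n u w = subst_aut n v w"
  proof (cases "w \<in> words n")
    case True
    then have "subst u w = subst v w" by (intro subst_cong assms) (auto simp: words_iff)
    then show ?thesis by (simp add: subst_aut_def)
  qed (simp add: subst_aut_def)
qed

definition basis_images :: "nat \<Rightarrow> (letter list \<Rightarrow> letter list) \<Rightarrow> nat \<Rightarrow> letter list" where
  "basis_images n \<alpha> i = (if i < n then \<alpha> [(i, True)] else [(i, True)])"

lemma singleton_words: "fst x < n \<Longrightarrow> [x] \<in> words n"
  by (cases x) (auto simp: words_iff)

lemma Aut_words: "\<lbrakk>\<alpha> \<in> carrier (Aut n); w \<in> words n\<rbrakk> \<Longrightarrow> \<alpha> w \<in> words n"
  by (auto simp: carrier_Aut auto_def hom_def)

lemma Aut_wmul: "\<lbrakk>\<alpha> \<in> carrier (Aut n); v \<in> words n; w \<in> words n\<rbrakk> \<Longrightarrow> \<alpha> (wmul v w) = wmul (\<alpha> v) (\<alpha> w)"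
  by (auto simp: carrier_Aut auto_def hom_def mult_free_group)

lemma Nil_words [simp]: "[] \<in> words n" by (simp add: words_iff)

lemma Aut_Nil:
  assumes "\<alpha> \<in> carrier (Aut n)"
  shows "\<alpha> [] = []"
proof -
  have r: "reduced (\<alpha> [])" using Aut_words[OF assms Nil_words] by (simp add: words_iff)
  have "wmul (\<alpha> []) (\<alpha> []) = \<alpha> []" using Aut_wmul[OF assms Nil_words Nil_words] by simp
  then have "wmul (winv (\<alpha> [])) (wmul (\<alpha> []) (\<alpha> [])) = []" using r by (simp add: wmul_winv_left)
  then show ?thesis using r by (simp add: wmul_assoc[symmetric] wmul_winv_left)
qed

lemma proper_basis_images: "\<alpha> \<in> carrier (Aut n) \<Longrightarrow> proper n (basis_images n \<alpha>)"
  by (simp add: proper_def basis_images_def Aut_words singleton_words)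

lemma subst_basis_images:
  assumes a: "\<alpha> \<in> carrier (Aut n)" and w: "w \<in> words n"
  shows "subst (basis_images n \<alpha>) w = \<alpha> w"
  using w
proof (induction w)
  case Nil
  then show ?case using Aut_Nil[OF a] by simp
next
  case (Cons x w)
  then have xw: "fst x < n" "w \<in> words n" "x # w = wmul [x] w"
    by (auto simp: words_iff reduced_Cons[of x w] wmul_Cons cons_letter_reduced)
  have inv: "\<alpha> [(i, False)] = winv (\<alpha> [(i, True)])" if "i < n" for i
  proof (rule winv_unique)
    have wd: "[(i, True)] \<in> words n" "[(i, False)] \<in> words n" using that by (auto intro: singleton_words)
    show "reduced (\<alpha> [(i, True)])" "reduced (\<alpha> [(i, False)])"
      using Aut_words[OF a] wd by (auto simp: words_iff)
    show "wmul (\<alpha> [(i, True)]) (\<alpha> [(i, False)]) = []"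
      using Aut_wmul[OF a wd] Aut_Nil[OF a] by (simp add: wmul_Cons inv_letter_def)
  qed
  have "letter_image (basis_images n \<alpha>) x = \<alpha> [x]"
    using xw(1) inv by (cases x) (auto simp: letter_image_def basis_images_def)
  then show ?case
    using Cons.IH[OF xw(2)] Aut_wmul[OF a singleton_words[OF xw(1)] xw(2)] unfolding xw(3)[symmetric] by (simp add: subst_Cons)
qed

lemma subst_aut_basis_images:
  assumes "\<alpha> \<in> carrier (Aut n)"
  shows "subst_aut n (basis_images n \<alpha>) = \<alpha>"
proof (rule ext)
  fix w
  have "\<alpha> \<in> extensional (words n)" using assms by (auto simp: carrier_Aut auto_def Bij_def)
  then show "subst_aut n (basis_images n \<alpha>) w = \<alpha> w"
    using subst_basis_images[OF assms] by (auto simp: subst_aut_def extensional_def)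
qed

section \<open>Nielsen's theorem\<close>

text \<open>The number of letters lost by each factor. For reduced words the difference of lengths
  is even, so the division is exact.\<close>

definition cancellation :: "letter list \<Rightarrow> letter list \<Rightarrow> nat" where
  "cancellation x y = (length x + length y - length (wmul x y)) div 2"

lemma cancellation_decomposition:
  assumes "reduced x" "reduced y"
  obtains a b c where "x = a @ c" "y = winv c @ b" "wmul x y = a @ b" "reduced (a @ b)"
    "length c = cancellation x y"
proof -
  have "\<exists>a b c. x = a @ c \<and> y = winv c @ b \<and> wmul x y = a @ b"
    using assms(1)
  proof (induction x)
    case (Cons z x)
    then obtain a b c where *: "x = a @ c" "y = winv c @ b" "wmul x y = a @ b"
      by (auto simp: reduced_Cons)
    show ?case
    proof (cases "a = [] \<and> b \<noteq> [] \<and> hd b = inv_letter z")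
      case True
      then obtain b' where "b = inv_letter z # b'" by (cases b) auto
      then show ?thesis using * True
        by (intro exI[of _ "[]"] exI[of _ b'] exI[of _ "z # c"]) (simp add: wmul_Cons winv_Cons)
    next
      case False
      have "cons_letter z (a @ b) = z # a @ b"
      proof (cases a)
        case Nil
        then show ?thesis using False by (cases b) auto
      next
        case (Cons w a')
        then show ?thesis using Cons.prems * by (auto simp: reduced_Cons)
      qed
      then show ?thesis using *
        by (intro exI[of _ "z # a"] exI[of _ b] exI[of _ c]) (simp add: wmul_Cons)
    qed
  qed auto
  then obtain a b c where "x = a @ c" "y = winv c @ b" "wmul x y = a @ b" by blast
  moreover have "reduced (a @ b)" using reduced_wmul[OF assms(2), of x] calculation by simp
  moreover have "length c = cancellation x y" using calculation by (simp add: cancellation_def)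
  ultimately show ?thesis by (rule that)
qed

text \<open>If half of w cancelled against w, each letter would be the inverse of the one opposite
  to it. In the centre a letter would then be its own inverse, or two neighbours would
  cancel.\<close>

lemma cancellation_self:
  assumes w: "reduced w" "w \<noteq> []"
  shows "2 * cancellation w w < length w"
proof (rule ccontr)
  assume contra: "\<not> 2 * cancellation w w < length w"
  obtain a b c where c: "w = a @ c" "w = winv c @ b" "length c = cancellation w w"
    using cancellation_decomposition[OF w(1) w(1)] by metis
  define N k where "N = length w" and "k = length c"
  have "N \<le> 2 * k" using contra c(3) by (simp add: N_def k_def)
  moreover have "0 < N" using w(2) by (simp add: N_def)
  moreover have "k \<le> N" using c(1) by (simp add: N_def k_def)
  ultimately have k: "k \<le> N" "N \<le> 2 * k" "0 < N" by simp_all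
  have inv: "w ! i = inv_letter (w ! (N - 1 - i))" if "i < k" for i
  proof -
    have "w ! i = winv c ! i" using c(2) that k_def by (metis length_winv nth_append)
    also have "\<dots> = inv_letter (c ! (k - 1 - i))" using that by (simp add: winv_def k_def rev_nth)
    also have "c ! (k - 1 - i) = w ! (N - 1 - i)"
    proof -
      have "N - 1 - i = length a + (k - 1 - i)" using c(1) that by (simp add: N_def k_def)
      then show ?thesis using c(1) by (metis nth_append_length_plus)
    qed
    finally show ?thesis .
  qed
  show False
  proof (cases "even N")
    case True
    then obtain q where q: "N = 2 * q" by blast
    then have "q > 0" "q \<le> k" using k by auto
    then have "w ! (q - 1) = inv_letter (w ! q)"
      using inv[of "q - 1"] q by (simp add: mult_2)
    moreover have "w ! Suc (q - 1) \<noteq> inv_letter (w ! (q - 1))"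
    proof -
      have "\<forall>i. Suc i < length w \<longrightarrow> w ! Suc i \<noteq> inv_letter (w ! i)"
        using w(1) by (simp add: reduced_def successively_conv_nth)
      moreover have "Suc (q - 1) < length w" using \<open>q > 0\<close> q by (simp add: N_def)
      ultimately show ?thesis by blast
    qed
    ultimately show False using \<open>q > 0\<close> by simp
  next
    case False
    then obtain q where q: "N = 2 * q + 1" by (rule oddE)
    then show False using inv[of q] k by simp
  qed
qed

text \<open>Reads w as a numeral in base 2 * n with letters as digits; on words of a fixed length
  this realises the lexicographic order.\<close>

fun code :: "nat \<Rightarrow> letter list \<Rightarrow> nat" where
  "code n [] = 0"
| "code n (x # w) = (2 * fst x + of_bool (snd x)) * (2 * n) ^ length w + code n w"

lemma code_append: "code n (v @ w) = code n v * (2 * n) ^ length w + code n w"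
  by (induction v) (auto simp: algebra_simps power_add)

lemma code_less: "set w \<subseteq> {..<n} \<times> UNIV \<Longrightarrow> code n w < (2 * n) ^ length w"
proof (induction w)
  case (Cons x w)
  let ?B = "(2 * n) ^ length w"
  have "2 * fst x + of_bool (snd x) + 1 \<le> 2 * n" using Cons.prems by (cases x) auto
  then have "(2 * fst x + of_bool (snd x) + 1) * ?B \<le> 2 * n * ?B" by (rule mult_right_mono) simp
  then show ?case using Cons by (simp add: algebra_simps)
qed simp

lemma code_inj:
  "\<lbrakk>set v \<subseteq> {..<n} \<times> UNIV; set w \<subseteq> {..<n} \<times> UNIV; length v = length w; code n v = code n w\<rbrakk> \<Longrightarrow> v = w"
proof (induction v arbitrary: w)
  case (Cons x v)
  obtain y w' where w: "w = y # w'" using Cons.prems(3) by (cases w) simp_all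
  let ?B = "(2 * n) ^ length v"
  have less: "code n v < ?B" "code n w' < ?B" using Cons.prems code_less[of v n] code_less[of w' n] w by auto
  have eq: "(2 * fst x + of_bool (snd x)) * ?B + code n v = (2 * fst y + of_bool (snd y)) * ?B + code n w'"
    using Cons.prems w by simp
  have quotient: "(a * B + c) div B = a" if "c < B" for a B c :: nat using that by simp
  have "2 * fst x + of_bool (snd x) = (2 * fst y + of_bool (snd y) :: nat)"
    using quotient[OF less(1)] quotient[OF less(2)] eq by metis
  then have "fst x = fst y \<and> snd x = snd y"
    by (cases "snd x"; cases "snd y"; simp; arith)
  then have "x = y" by (simp add: prod_eq_iff)
  moreover have "v = w'" using Cons.IH[of w'] Cons.prems eq w \<open>x = y\<close> by simp
  ultimately show ?case using w by simp
qed simp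

definition half :: "letter list \<Rightarrow> letter list" where
  "half w = take (length w - length w div 2) w"

text \<open>Among words of equal length, the secondary complexity breaks the ties \<open>|p| = |q|\<close> for
  \<open>y = p q\<^sup>-\<^sup>1\<close> in Nielsen's reduction: it decides whether to trade \<open>p\<close> for \<open>q\<close> or \<open>q\<close> for \<open>p\<close>.\<close>

definition complexity :: "nat \<Rightarrow> letter list \<Rightarrow> nat" where
  "complexity n w = code n (half w) + code n (half (winv w))"

lemma complexity_winv [simp]: "complexity n (winv w) = complexity n w"
  by (simp add: complexity_def)

text \<open>As c is not longer than a, the initial halves of both words lie in a and agree. The
  halves of the inverses start with the exchanged parts and continue with the same digits.\<close>

lemma complexity_swap:
  assumes "n > 0" "length b = length c" "length c \<le> length a"
    and "complexity n (a @ c) \<le> complexity n (a @ b)"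
  shows "code n (winv c) \<le> code n (winv b)"
proof -
  define l where "l = length (a @ c) - length (a @ c) div 2"
  have l: "length c \<le> l" "l \<le> length a" using assms(3) by (auto simp: l_def)
  have half: "half (a @ c) = take l a" "half (a @ b) = take l a"
    "half (winv (a @ c)) = winv c @ take (l - length c) (winv a)"
    "half (winv (a @ b)) = winv b @ take (l - length c) (winv a)"
    using l assms(2) by (simp_all add: half_def l_def winv_append add.commute[of "length c"])
  have "code n (winv c) * (2 * n) ^ length (take (l - length c) (winv a))
     \<le> code n (winv b) * (2 * n) ^ length (take (l - length c) (winv a))"
    using assms(4) by (simp add: complexity_def half code_append)
  then show ?thesis using assms(1) by (subst (asm) mult_le_cancel2) simp
qed

text \<open>The transvection taking the letter x to x y for either sign of x; if x is an inverse
  letter, its basis element goes to the inverse of x y. So one family contains both left and right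
  multiplications.\<close>

definition nielsen :: "letter \<Rightarrow> letter \<Rightarrow> nat \<Rightarrow> letter list" where
  "nielsen x y i = (if i = fst x then (if snd x then [x, y] else [inv_letter y, inv_letter x]) else [(i, True)])"

definition signed_perm :: "nat \<Rightarrow> (nat \<Rightarrow> nat) \<Rightarrow> (nat \<Rightarrow> bool) \<Rightarrow> nat \<Rightarrow> letter list" where
  "signed_perm n p \<epsilon> i = (if i < n then [(p i, \<epsilon> i)] else [(i, True)])"

lemma subst_nielsen:
  assumes u: "\<And>i. reduced (u i)"
  shows "subst u (nielsen x y i)
     = (if i = fst x then (if snd x then wmul (letter_image u x) (letter_image u y)
          else winv (wmul (letter_image u x) (letter_image u y)))
        else u i)"
proof -
  have "subst u [(i, True)] = u i"
    using subst_singleton[where u = u, OF u] by (simp add: letter_image_def)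
  then show ?thesis
    using u by (auto simp: nielsen_def subst_Cons reduced_letter_image[OF u] winv_wmul)
qed

lemma proper_nielsen: "\<lbrakk>fst x < n; fst y < n; fst x \<noteq> fst y\<rbrakk> \<Longrightarrow> proper n (nielsen x y)"
  by (cases x; cases y) (auto simp: proper_def nielsen_def words_iff reduced_Cons inv_letter_def)

lemma subst_nielsen_inverse:
  assumes "fst x \<noteq> fst y"
  shows "subst (nielsen x y) (nielsen x (inv_letter y) i) = [(i, True)]"
proof -
  have r: "reduced (nielsen x y i)" for i
    using assms by (cases x; cases y) (auto simp: nielsen_def reduced_Cons inv_letter_def)
  have *: "letter_image (nielsen x y) x = [x, y]" "letter_image (nielsen x y) y = [y]"
    using assms by (cases x; cases y; auto simp: letter_image_def nielsen_def winv_def inv_letter_def)+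
  have **: "wmul [x, y] (winv [y]) = [x]" by (simp add: wmul_Cons winv_def)
  show ?thesis
    unfolding subst_nielsen[OF r] letter_image_inv *(2) *(1) **
    by (cases x) (auto simp: winv_def inv_letter_def nielsen_def)
qed

lemma nielsen_in_Aut:
  assumes "fst x < n" "fst y < n" "fst x \<noteq> fst y"
  shows "subst_aut n (nielsen x y) \<in> carrier (Aut n)"
  by (rule subst_aut_in_Aut[OF proper_nielsen proper_nielsen[of x n "inv_letter y"]])
    (use assms subst_nielsen_inverse[of x y] subst_nielsen_inverse[of x "inv_letter y"] in auto)

text \<open>A system u at which no elementary move lowers the length, nor the complexity at equal
  length. The aim is that a reduced product of images never swallows one of its factors.\<close>

context
  fixes n :: nat and u :: "nat \<Rightarrow> letter list"
  assumes u: "proper n u"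
    and nontrivial: "\<And>x. fst x < n \<Longrightarrow> letter_image u x \<noteq> []"
    and short: "\<And>x y. \<lbrakk>fst x < n; fst y < n; fst x \<noteq> fst y\<rbrakk> \<Longrightarrow>
      length (letter_image u x) \<le> length (wmul (letter_image u x) (letter_image u y))"
    and simple: "\<And>x y. \<lbrakk>fst x < n; fst y < n; fst x \<noteq> fst y;
      length (wmul (letter_image u x) (letter_image u y)) = length (letter_image u x)\<rbrakk> \<Longrightarrow>
      complexity n (letter_image u x) \<le> complexity n (wmul (letter_image u x) (letter_image u y))"
begin

lemma reduced_image: "reduced (letter_image u x)"
  by (rule reduced_letter_image[OF proper_reduced[OF u]])

abbreviation "canc x y \<equiv> cancellation (letter_image u x) (letter_image u y)"

lemma cancellation_inv: "canc (inv_letter y) (inv_letter x) = canc x y"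
proof -
  have "length (wmul (winv (letter_image u y)) (winv (letter_image u x)))
      = length (wmul (letter_image u x) (letter_image u y))"
    using winv_wmul[OF reduced_image reduced_image, of x y] by (metis length_winv)
  then show ?thesis by (simp add: cancellation_def add.commute)
qed

text \<open>If more than half of the image of y cancelled, the move x to x y would shorten the image
  of x. For x = y there is no such move, and the strict bound comes from the word itself being
  reduced.\<close>

lemma cancellation_le_right:
  assumes "fst x < n" "fst y < n" "y \<noteq> inv_letter x"
  shows "2 * canc x y \<le> length (letter_image u y) \<and> (fst x = fst y \<longrightarrow> 2 * canc x y < length (letter_image u y))"
proof (cases "fst x = fst y")
  case True
  then have "x = y" using assms by (cases x; cases y) (auto simp: inv_letter_def)
  then show ?thesis using cancellation_self[OF reduced_image nontrivial[OF assms(2)]] by simp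
next
  case False
  obtain a b c where *: "letter_image u x = a @ c" "letter_image u y = winv c @ b"
    "wmul (letter_image u x) (letter_image u y) = a @ b" "length c = canc x y"
    by (rule cancellation_decomposition[OF reduced_image[of x] reduced_image[of y]]) (rule that)
  then have "length (a @ c) \<le> length (a @ b)" using short[OF assms(1,2) False] by metis
  then show ?thesis using * False by simp
qed

lemma cancellation_le_left:
  assumes "fst x < n" "fst y < n" "y \<noteq> inv_letter x"
  shows "2 * canc x y \<le> length (letter_image u x)"
  using cancellation_le_right[of "inv_letter y" "inv_letter x"] assms cancellation_inv
  by (auto simp: inv_letter_eq_iff)

text \<open>When exactly half of y cancels, the move x to x y keeps the length and exchanges the
  ending \<open>winv p\<close> for q. That it does not lower the complexity orders p against
  \<open>winv q\<close>.\<close>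

lemma cancellation_tie:
  assumes xy: "fst x < n" "fst y < n" "fst x \<noteq> fst y" and tie: "2 * canc x y = length (letter_image u y)"
    and y: "letter_image u y = p @ q" "length p = length q"
  shows "code n p \<le> code n (winv q)"
proof -
  obtain a b c where *: "letter_image u x = a @ c" "letter_image u y = winv c @ b"
    "wmul (letter_image u x) (letter_image u y) = a @ b" "length c = canc x y"
    by (rule cancellation_decomposition[OF reduced_image[of x] reduced_image[of y]]) (rule that)
  have "winv c @ b = p @ q" using *(2) y(1) by simp
  moreover have "length (winv c) = length p" using *(4) tie y by simp
  ultimately have pq: "winv c = p" "b = q" by simp_all
  have lens: "length b = length c" using *(2,4) tie by simp
  have "y \<noteq> inv_letter x" using xy(3) by auto
  then have "length c \<le> length a"
    using cancellation_le_left[OF xy(1,2)] *(1,4) by simp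
  moreover have "complexity n (a @ c) \<le> complexity n (a @ b)"
    using simple[OF xy] *(1,3) lens by simp
  ultimately have "code n (winv c) \<le> code n (winv b)"
    using complexity_swap[of n b c a] lens xy(1) by simp
  then show ?thesis using pq by simp
qed

text \<open>If cancellation from both sides used up y, each side would take exactly half. The two
  ties give opposite inequalities between the codes of p and \<open>winv q\<close>, so p =
  \<open>winv q\<close> and y would cancel in its own middle.\<close>

lemma nielsen_reduced:
  assumes xyz: "fst x < n" "fst y < n" "fst z < n" and "y \<noteq> inv_letter x" "z \<noteq> inv_letter y"
  shows "canc x y + canc y z < length (letter_image u y)"
proof (rule ccontr)
  let ?Y = "letter_image u y"
  assume "\<not> canc x y + canc y z < length ?Y"
  moreover note xy = cancellation_le_right[OF xyz(1,2) assms(4)]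
  moreover have yz: "2 * canc y z \<le> length ?Y" by (rule cancellation_le_left[OF xyz(2,3) assms(5)])
  moreover have yz': "2 * canc y z < length ?Y" if "fst y = fst z"
  proof -
    have "z = y" using that assms(5) by (cases z; cases y) (auto simp: inv_letter_def)
    then show ?thesis using cancellation_self[OF reduced_image nontrivial[OF xyz(2)]] by simp
  qed
  ultimately have tie: "2 * canc x y = length ?Y" "2 * canc y z = length ?Y" "fst x \<noteq> fst y" "fst y \<noteq> fst z"
    by linarith+
  define p q where "p = take (canc x y) ?Y" and "q = drop (canc x y) ?Y"
  have pq: "?Y = p @ q" "length p = length q" using tie(1) by (auto simp: p_def q_def)
  have "code n p \<le> code n (winv q)" by (rule cancellation_tie[OF xyz(1,2) tie(3,1) pq])
  moreover have "code n (winv q) \<le> code n (winv (winv p))"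
  proof (rule cancellation_tie)
    show "2 * canc (inv_letter z) (inv_letter y) = length (letter_image u (inv_letter y))"
      using tie(2) unfolding cancellation_inv by simp
    show "letter_image u (inv_letter y) = winv q @ winv p" using pq(1) by (simp add: winv_append)
  qed (use xyz tie(4) pq(2) in auto)
  ultimately have "code n p = code n (winv q)" by simp
  moreover have "?Y \<in> words n" by (rule letter_image_words[OF u xyz(2)])
  then have sets: "set p \<subseteq> {..<n} \<times> UNIV" "set q \<subseteq> {..<n} \<times> UNIV" "reduced (p @ q)"
    using pq(1) by (auto simp: words_iff)
  moreover have "set (winv q) \<subseteq> {..<n} \<times> UNIV"
    using sets(2) by (auto simp: winv_def inv_letter_def)
  ultimately have "p = winv q" using code_inj[of p n "winv q"] pq(2) by simp
  moreover have "q \<noteq> []" using nontrivial[OF xyz(2)] pq by auto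
  ultimately show False
    using sets(3) by (cases q) (auto simp: winv_Cons reduced_append reduced_Cons)
qed

text \<open>A nonempty part of the image of every letter survives in the image of a reduced word.\<close>

lemma length_subst:
  assumes w: "w \<in> words n" "w = v @ [x]"
  shows "\<exists>z t s. subst u w = z @ s \<and> letter_image u x = t @ s \<and> length v \<le> length z \<and>
    (\<forall>y. fst y < n \<longrightarrow> y \<noteq> inv_letter x \<longrightarrow> canc x y < length s)"
  using w
proof (induction v arbitrary: w x rule: rev_induct)
  case Nil
  then have x: "fst x < n" by (auto simp: words_iff)
  have "canc x y < length (letter_image u x)" if "fst y < n" "y \<noteq> inv_letter x" for y
    using cancellation_le_left[OF x that(1,2)] nontrivial[OF x] by (cases "letter_image u x") auto
  then show ?case using Nil subst_singleton[where u = u, OF proper_reduced[OF u], of x]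
    by (intro exI[of _ "[]"] exI[of _ "letter_image u x"]) auto
next
  case (snoc y v)
  let ?w = "v @ [y]"
  have wd: "?w \<in> words n" "fst y < n" "fst x < n" "x \<noteq> inv_letter y"
    using snoc.prems by (simp_all add: words_iff reduced_append mem_Times_iff del: reduced_singleton)
      (simp_all add: reduced_Cons)
  obtain z t s where IH: "subst u ?w = z @ s" "letter_image u y = t @ s" "length v \<le> length z"
    "\<forall>x. fst x < n \<longrightarrow> x \<noteq> inv_letter y \<longrightarrow> canc y x < length s"
    using snoc.IH[OF wd(1) refl] by blast
  obtain a b c where *: "letter_image u y = a @ c" "letter_image u x = winv c @ b" "reduced (a @ b)"
    "length c = canc y x"
    by (rule cancellation_decomposition[OF reduced_image[of y] reduced_image[of x]]) (rule that)
  have "length c < length s" using IH(4)[rule_format, OF wd(3,4)] *(4) by simp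
  \<comment> \<open>The letters cancelled next form a proper suffix of the surviving part s; what
    remains of s is nonempty and shields z.\<close>
  have "t @ s = a @ c" using *(1) IH(2) by simp
  then obtain s' where "t = a @ s' \<and> s' @ s = c \<or> t @ s' = a \<and> s = s' @ c"
    unfolding append_eq_append_conv2 by blast
  then have s': "s = s' @ c" "a = t @ s'" "s' \<noteq> []" using \<open>length c < length s\<close> by auto
  have "reduced (z @ s)" using reduced_subst[where u = u, OF proper_reduced[OF u], of ?w] IH(1) by simp
  then have red1: "reduced (z @ s' @ b)" using *(3) s' by (auto simp: reduced_append)
  have redx: "reduced (winv c @ b)" using reduced_image[of x] *(2) by simp
  have "subst u w = wmul (subst u ?w) (letter_image u x)"
    unfolding snoc.prems(2)
    by (simp only: subst_append[where u = u, OF proper_reduced[OF u]] subst_singleton[where u = u, OF proper_reduced[OF u]])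
  also have "\<dots> = wmul (z @ s') (wmul c (winv c @ b))" by (simp add: IH(1) s' *(2) wmul_append)
  also have "wmul c (winv c @ b) = wmul c (wmul (winv c) b)" using redx by (simp add: wmul_reduced)
  also have "\<dots> = b" using redx by (intro wmul_winv_cancel) (auto simp: reduced_append)
  also have "wmul (z @ s') b = (z @ s') @ b" using red1 by (intro wmul_reduced) simp
  finally have "subst u w = (z @ s') @ b" .
  moreover have "length (v @ [y]) \<le> length (z @ s')" using IH(3) s'(3) by (cases s') auto
  moreover have "canc x x' < length b" if "fst x' < n" "x' \<noteq> inv_letter x" for x'
    using nielsen_reduced[OF wd(2,3) that(1) wd(4) that(2)] *(2,4) by simp
  ultimately show ?case using *(2) by blast
qed

text \<open>Every letter of w leaves at least one letter in the image, so an image of length 1 has a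
  single letter as its source.\<close>

lemma letter_of_singleton_image:
  assumes "w \<in> words n" "length (subst u w) = 1"
  obtains x where "w = [x]"
proof (cases w rule: rev_cases)
  case Nil
  then show ?thesis using assms(2) by simp
next
  case (snoc v x)
  obtain z t s where *: "subst u w = z @ s" "length v \<le> length z"
    "\<forall>y. fst y < n \<longrightarrow> y \<noteq> inv_letter x \<longrightarrow> canc x y < length s"
    using length_subst[OF assms(1) snoc] by blast
  have "fst x < n" using assms(1) snoc by (auto simp: words_iff)
  then have s: "0 < length s" using *(3) by (metis gr_zeroI inv_letter_neq(2) not_less_zero)
  moreover have "length z + length s = 1" using *(1) assms(2) by (metis length_append)
  ultimately have "length v = 0" using *(2) by linarith
  then show ?thesis using that snoc by simp
qed

end

text \<open>Induction on total length, then total complexity, of the basis images. Where no move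
  lowers this pair, surjectivity and the length estimate show that each basis element is the image
  of one letter, so the automorphism is a signed permutation.\<close>

theorem nielsen_generation:
  assumes H: "subgroup H (Aut n)"
    and nielsen: "\<And>x y. \<lbrakk>fst x < n; fst y < n; fst x \<noteq> fst y\<rbrakk> \<Longrightarrow> subst_aut n (nielsen x y) \<in> H"
    and perm: "\<And>p \<epsilon>. p permutes {..<n} \<Longrightarrow> subst_aut n (signed_perm n p \<epsilon>) \<in> H"
    and \<alpha>: "\<alpha> \<in> carrier (Aut n)"
  shows "\<alpha> \<in> H"
  using \<alpha>
proof (induction "(\<Sum>i<n. length (basis_images n \<alpha> i), \<Sum>i<n. complexity n (basis_images n \<alpha> i))"
    arbitrary: \<alpha> rule: wf_induct_rule[OF wf_lex_prod[OF wf_less_than wf_less_than]])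
  case (1 \<alpha>)
  interpret A: group "Aut n" by (rule group_Aut)
  interpret H: subgroup H "Aut n" by (rule H)
  define u where "u = basis_images n \<alpha>"
  have u: "proper n u" unfolding u_def by (rule proper_basis_images[OF 1(2)])
  note ru = proper_reduced[OF u]
  have \<alpha>: "\<alpha> = subst_aut n u" unfolding u_def by (rule subst_aut_basis_images[OF 1(2), symmetric])
  let ?U = "letter_image u"
  have step: "\<alpha> \<in> H" if xy: "fst x < n" "fst y < n" "fst x \<noteq> fst y"
    and less: "length (wmul (?U x) (?U y)) < length (?U x) \<or>
      length (wmul (?U x) (?U y)) = length (?U x) \<and> complexity n (wmul (?U x) (?U y)) < complexity n (?U x)" for x y
  proof -
    let ?\<nu> = "subst_aut n (nielsen x y)"
    have \<nu>: "?\<nu> \<in> carrier (Aut n)" by (rule nielsen_in_Aut[OF xy])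
    define \<beta> where "\<beta> = \<alpha> \<otimes>\<^bsub>Aut n\<^esub> ?\<nu>"
    have \<beta>A: "\<beta> \<in> carrier (Aut n)" using 1(2) \<nu> by (simp add: \<beta>_def)
    have "\<beta> = subst_aut n (comp_subst u (nielsen x y))"
      using subst_aut_mult[OF u proper_nielsen[OF xy]] 1(2) \<nu> by (simp add: \<beta>_def \<alpha>)
    then have \<beta>: "basis_images n \<beta> i = subst u (nielsen x y i)" if "i < n" for i
      using that subst_singleton[where u = "comp_subst u (nielsen x y)", OF proper_reduced[OF proper_comp_subst[OF u proper_nielsen[OF xy]]], of "(i, True)"]
      by (simp add: basis_images_def subst_aut_def singleton_words letter_image_def comp_subst_def)
    \<comment> \<open>A move changes one basis image only. Stating this for any f that ignores
      inversion treats length and complexity together and covers both signs of x.\<close>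
    have split: "(\<Sum>i<n. f (basis_images n \<beta> i)) = f (wmul (?U x) (?U y)) + (\<Sum>i\<in>{..<n} - {fst x}. f (u i))"
      "(\<Sum>i<n. f (u i)) = f (?U x) + (\<Sum>i\<in>{..<n} - {fst x}. f (u i))"
      if f: "\<And>w. f (winv w) = f w" for f :: "letter list \<Rightarrow> nat"
    proof -
      have "f (subst u (nielsen x y (fst x))) = f (wmul (?U x) (?U y))" "f (u (fst x)) = f (?U x)"
        using f by (auto simp: subst_nielsen[OF ru] letter_image_def)
      moreover have "(\<Sum>i<n. f (basis_images n \<beta> i)) = (\<Sum>i<n. f (subst u (nielsen x y i)))"
        using \<beta> by simp
      moreover have "(\<Sum>i\<in>{..<n} - {fst x}. f (subst u (nielsen x y i))) = (\<Sum>i\<in>{..<n} - {fst x}. f (u i))"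
        by (intro sum.cong) (auto simp: subst_nielsen[OF ru])
      ultimately show "(\<Sum>i<n. f (basis_images n \<beta> i)) = f (wmul (?U x) (?U y)) + (\<Sum>i\<in>{..<n} - {fst x}. f (u i))"
        "(\<Sum>i<n. f (u i)) = f (?U x) + (\<Sum>i\<in>{..<n} - {fst x}. f (u i))"
        using xy(1) by (simp_all add: sum.remove[of "{..<n}" "fst x"])
    qed
    have "((\<Sum>i<n. length (basis_images n \<beta> i), \<Sum>i<n. complexity n (basis_images n \<beta> i)),
        (\<Sum>i<n. length (basis_images n \<alpha> i), \<Sum>i<n. complexity n (basis_images n \<alpha> i)))
        \<in> less_than <*lex*> less_than"
      using less split[of length] split[of "complexity n"] by (auto simp: u_def[symmetric])
    then have "\<beta> \<in> H" using 1(1) \<beta>A by blast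
    then have "\<beta> \<otimes>\<^bsub>Aut n\<^esub> inv\<^bsub>Aut n\<^esub> ?\<nu> \<in> H" using nielsen[OF xy] by blast
    then show ?thesis using 1(2) \<nu> by (simp add: \<beta>_def A.m_assoc)
  qed
  show ?case
  proof (rule ccontr)
    assume "\<alpha> \<notin> H"
    have inj: "inj_on \<alpha> (words n)" and surj: "\<alpha> ` words n = words n"
      using 1(2) by (auto simp: carrier_Aut auto_def Bij_def bij_betw_def)
    have img: "?U x = \<alpha> [x]" if "fst x < n" for x
      using subst_basis_images[OF 1(2) singleton_words[OF that]] subst_singleton[where u = u, OF ru, of x] by (simp add: u_def)
    have short: "length (?U x) \<le> length (wmul (?U x) (?U y))" if "fst x < n" "fst y < n" "fst x \<noteq> fst y" for x y
      using step[OF that] \<open>\<alpha> \<notin> H\<close> by force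
    have simple: "complexity n (?U x) \<le> complexity n (wmul (?U x) (?U y))"
      if "fst x < n" "fst y < n" "fst x \<noteq> fst y" "length (wmul (?U x) (?U y)) = length (?U x)" for x y
      using step[OF that(1-3)] that(4) \<open>\<alpha> \<notin> H\<close> by force
    have nontrivial: "?U x \<noteq> []" if "fst x < n" for x
    proof
      assume "?U x = []"
      then have "\<alpha> [x] = \<alpha> []" using img[OF that] Aut_Nil[OF 1(2)] by simp
      then show False using inj_onD[OF inj _ singleton_words[OF that] Nil_words] by simp
    qed
    have "\<exists>x. fst x < n \<and> ?U x = [(j, True)]" if j: "j < n" for j
    proof -
      obtain w where w: "w \<in> words n" "\<alpha> w = [(j, True)]"
        using surj singleton_words[of "(j, True)" n] j by (metis fst_conv imageE)
      then have su: "subst u w = [(j, True)]" using subst_basis_images[OF 1(2)] by (simp add: u_def)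
      obtain x where x: "w = [x]"
      proof (rule letter_of_singleton_image[OF u nontrivial short simple w(1)])
        show "length (subst u w) = 1" using su by simp
      qed
      then show ?thesis using su w(1) subst_singleton[where u = u, OF ru, of x] by (auto simp: words_iff)
    qed
    then obtain l where l: "\<And>j. j < n \<Longrightarrow> fst (l j) < n" "\<And>j. j < n \<Longrightarrow> ?U (l j) = [(j, True)]" by metis
    define q where "q = (\<lambda>j. fst (l j))"
    have ul: "u (q j) = [(j, snd (l j))]" if "j < n" for j
      using l(2)[OF that] by (cases "snd (l j)") (auto simp: letter_image_def q_def winv_def inv_letter_def
          dest!: arg_cong[of _ "[(j, True)]" winv] simp: rev_map o_def)
    have "inj_on q {..<n}" using ul by (intro inj_onI) (metis Pair_inject lessThan_iff list.inject)
    moreover have "q ` {..<n} \<subseteq> {..<n}" using l(1) by (auto simp: q_def)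
    ultimately have bij: "bij_betw q {..<n} {..<n}" by (simp add: bij_betw_def endo_inj_surj)
    \<comment> \<open>q tells which basis element has an image lying over j; the permutation sought
      is its inverse, extended by the identity.\<close>
    define p where "p = (\<lambda>i. if i < n then inv_into {..<n} q i else i)"
    have bijp: "bij_betw p {..<n} {..<n}"
      using bij_betw_inv_into[OF bij] by (rule bij_betw_cong[THEN iffD1, rotated]) (simp add: p_def)
    have "p permutes {..<n}" by (rule bij_imp_permutes[OF bijp]) (simp add: p_def)
    moreover have "u i = signed_perm n p (\<lambda>i. snd (l (p i))) i" if "i < n" for i
    proof -
      have "p i < n" "q (p i) = i"
        using that bijp bij by (auto simp: p_def bij_betw_def intro!: f_inv_into_f)
      then show ?thesis using ul[of "p i"] that by (simp add: signed_perm_def)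
    qed
    then have "\<alpha> = subst_aut n (signed_perm n p (\<lambda>i. snd (l (p i))))"
      unfolding \<alpha> by (rule subst_aut_cong)
    ultimately show False using perm \<open>\<alpha> \<notin> H\<close> by simp
  qed
qed

section \<open>Isometric actions on complete CAT(0) spaces\<close>

locale isometric_action = hadamard_space M d + group G
  for M :: "'a set" and d and G :: "('g, 'x) monoid_scheme" (structure) +
  fixes act :: "'g \<Rightarrow> 'a \<Rightarrow> 'a"
  assumes act_closed: "\<lbrakk>g \<in> carrier G; x \<in> M\<rbrakk> \<Longrightarrow> act g x \<in> M"
    and act_isometric: "\<lbrakk>g \<in> carrier G; x \<in> M; y \<in> M\<rbrakk> \<Longrightarrow> d (act g x) (act g y) = d x y"
    and act_mult: "\<lbrakk>g \<in> carrier G; h \<in> carrier G; x \<in> M\<rbrakk> \<Longrightarrow> act (g \<otimes> h) x = act g (act h x)"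
    and act_one: "x \<in> M \<Longrightarrow> act \<one> x = x"
begin

definition Fix :: "'g set \<Rightarrow> 'a set" where
  "Fix S = {x\<in>M. \<forall>g\<in>S. act g x = x}"

lemma Fix_mono: "S \<subseteq> T \<Longrightarrow> Fix T \<subseteq> Fix S" by (auto simp: Fix_def)

lemma Fix_empty: "Fix {} \<noteq> {}" using nonempty by (auto simp: Fix_def)

lemma closed_convex_Fix: "S \<subseteq> carrier G \<Longrightarrow> closed_convex (Fix S)"
proof (cases "S = {}")
  case True
  then show ?thesis by (simp add: Fix_def closed_convex_M)
next
  case False
  assume S: "S \<subseteq> carrier G"
  have "Fix S = (\<Inter>g\<in>S. {x\<in>M. act g x = x})" using False by (auto simp: Fix_def)
  moreover have "closed_convex (\<Inter>g\<in>S. {x\<in>M. act g x = x})"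
    using False S act_closed act_isometric
    by (intro closed_convex_INT closed_convex_fixed_points) (auto simp: subset_iff)
  ultimately show ?thesis by simp
qed

text \<open>The fixed point set of \<open>S\<close> is invariant under \<open>T\<close>, so projecting a fixed point of \<open>T\<close>
  to it gives a common fixed point.\<close>

lemma Fix_commuting:
  assumes S: "S \<subseteq> carrier G" "Fix S \<noteq> {}" and T: "T \<subseteq> carrier G" "Fix T \<noteq> {}"
    and comm: "\<And>s t. s \<in> S \<Longrightarrow> t \<in> T \<Longrightarrow> s \<otimes> t = t \<otimes> s"
  shows "Fix (S \<union> T) \<noteq> {}"
proof -
  obtain y where y: "y \<in> M" "\<And>t. t \<in> T \<Longrightarrow> act t y = y" using T(2) by (auto simp: Fix_def)
  have inv: "act t ` Fix S \<subseteq> Fix S" if t: "t \<in> T" for t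
  proof (rule image_subsetI)
    fix x assume x: "x \<in> Fix S"
    then have xM: "x \<in> M" by (simp add: Fix_def)
    have tG: "t \<in> carrier G" using t T by auto
    have "act s (act t x) = act t x" if s: "s \<in> S" for s
    proof -
      have sG: "s \<in> carrier G" using s S by auto
      have "act s (act t x) = act (t \<otimes> s) x" using act_mult[OF sG tG xM] comm[OF s t] by simp
      also have "\<dots> = act t x" using act_mult[OF tG sG xM] x s by (simp add: Fix_def)
      finally show ?thesis .
    qed
    then show "act t x \<in> Fix S" using act_closed[OF tG xM] by (simp add: Fix_def)
  qed
  show ?thesis
  proof (rule projection_fixed_point[OF closed_convex_Fix[OF S(1)] S(2) y(1)])
    fix p assume p: "p \<in> Fix S" and fixed: "\<And>f. \<lbrakk>f y = y; f ` Fix S \<subseteq> Fix S;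
        \<And>a b. a \<in> M \<Longrightarrow> b \<in> M \<Longrightarrow> d (f a) (f b) = d a b\<rbrakk> \<Longrightarrow> f p = p"
    have "act t p = p" if t: "t \<in> T" for t
    proof (rule fixed)
      show "act t y = y" by (rule y(2)[OF t])
      show "act t ` Fix S \<subseteq> Fix S" by (rule inv[OF t])
      show "d (act t a) (act t b) = d a b" if "a \<in> M" "b \<in> M" for a b
        using act_isometric that t T(1) by auto
    qed
    then have "p \<in> Fix (S \<union> T)" using p by (auto simp: Fix_def)
    then show ?thesis by blast
  qed
qed

lemma Fix_commuting_family:
  assumes "finite I" and S: "\<And>i. i \<in> I \<Longrightarrow> S i \<subseteq> carrier G" "\<And>i. i \<in> I \<Longrightarrow> Fix (S i) \<noteq> {}"
    and comm: "\<And>i j s t. \<lbrakk>i \<in> I; j \<in> I; i \<noteq> j; s \<in> S i; t \<in> S j\<rbrakk> \<Longrightarrow> s \<otimes> t = t \<otimes> s"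
  shows "Fix (\<Union>i\<in>I. S i) \<noteq> {}"
  using assms
proof (induction I rule: finite_induct)
  case empty
  show ?case using Fix_empty by simp
next
  case (insert i I)
  have IH: "Fix (\<Union>i\<in>I. S i) \<noteq> {}"
    by (rule insert.IH) (use insert.prems in \<open>blast+\<close>)
  have "Fix (S i \<union> (\<Union>i\<in>I. S i)) \<noteq> {}"
  proof (rule Fix_commuting[OF _ _ _ IH])
    show "S i \<subseteq> carrier G" "Fix (S i) \<noteq> {}" using insert.prems(1,2) by blast+
    show "(\<Union>i\<in>I. S i) \<subseteq> carrier G" using insert.prems(1) by blast
    fix s t assume s: "s \<in> S i" and "t \<in> (\<Union>i\<in>I. S i)"
    then obtain j where j: "j \<in> I" "t \<in> S j" by blast
    have "i \<noteq> j" using j insert.hyps by blast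
    then show "s \<otimes> t = t \<otimes> s" using insert.prems(3)[of i j s t] s j by blast
  qed
  then show ?case by simp
qed

text \<open>Closure of W under left multiplication by S makes the translates of one point by W a
  finite set that S maps into itself; its barycentre is fixed.\<close>

lemma Fix_finite_orbit:
  assumes W: "finite W" "W \<noteq> {}" "W \<subseteq> carrier G" and S: "S \<subseteq> carrier G"
    and closed: "\<And>s w. s \<in> S \<Longrightarrow> w \<in> W \<Longrightarrow> s \<otimes> w \<in> W"
  shows "Fix S \<noteq> {}"
proof -
  obtain x where x: "x \<in> M" using nonempty by auto
  let ?O = "(\<lambda>w. act w x) ` W"
  have sub: "?O \<subseteq> M" using act_closed[OF _ x] W(3) by auto
  show ?thesis
  proof (rule finite_invariant_set_fixed_point[of ?O])
    show "finite ?O" "?O \<noteq> {}" using W by auto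
    show "?O \<subseteq> M" by (rule sub)
    fix z assume z: "z \<in> M" and fixed: "\<And>f. \<lbrakk>f \<in> M \<rightarrow> M; f ` ?O \<subseteq> ?O;
        \<And>a b. a \<in> M \<Longrightarrow> b \<in> M \<Longrightarrow> d (f a) (f b) = d a b\<rbrakk> \<Longrightarrow> f z = z"
    have "act s z = z" if s: "s \<in> S" for s
    proof (rule fixed)
      have sG: "s \<in> carrier G" using s S by auto
      show "act s \<in> M \<rightarrow> M" using act_closed[OF sG] by auto
      show "d (act s a) (act s b) = d a b" if "a \<in> M" "b \<in> M" for a b by (rule act_isometric[OF sG that])
      show "act s ` ?O \<subseteq> ?O"
      proof clarify
        fix w assume w: "w \<in> W"
        then have "act s (act w x) = act (s \<otimes> w) x" using act_mult[OF sG _ x, of w] W(3) by auto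
        then show "act s (act w x) \<in> ?O" using closed[OF s w] by auto
      qed
    qed
    then have "z \<in> Fix S" using z by (simp add: Fix_def)
    then show ?thesis by blast
  qed
qed

text \<open>Two involutions with this braid relation generate a quotient of the dihedral group of
  order 6, and the finite set in the proof lists its elements. The longer relation below leads to
  order 8.\<close>

lemma Fix_dihedral_3:
  assumes ab: "a \<in> carrier G" "b \<in> carrier G" "a \<otimes> a = \<one>" "b \<otimes> b = \<one>"
    and braid: "a \<otimes> (b \<otimes> a) = b \<otimes> (a \<otimes> b)"
  shows "Fix {a, b} \<noteq> {}"
proof -
  have aa: "a \<otimes> (a \<otimes> w) = w" "b \<otimes> (b \<otimes> w) = w" if "w \<in> carrier G" for w
    using ab that by (simp_all add: m_assoc[symmetric])
  have "a \<otimes> (b \<otimes> (a \<otimes> b)) = b \<otimes> a" using braid ab aa(1)[of "b \<otimes> a"] by simp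
  then show ?thesis
    by (intro Fix_finite_orbit[of "{\<one>, a, b, a \<otimes> b, b \<otimes> a, a \<otimes> (b \<otimes> a)}"]) (use ab aa braid in auto)
qed

lemma Fix_dihedral_4:
  assumes ab: "a \<in> carrier G" "b \<in> carrier G" "a \<otimes> a = \<one>" "b \<otimes> b = \<one>"
    and braid: "a \<otimes> (b \<otimes> (a \<otimes> b)) = b \<otimes> (a \<otimes> (b \<otimes> a))"
  shows "Fix {a, b} \<noteq> {}"
proof -
  have aa: "a \<otimes> (a \<otimes> w) = w" "b \<otimes> (b \<otimes> w) = w" if "w \<in> carrier G" for w
    using ab that by (simp_all add: m_assoc[symmetric])
  have "a \<otimes> (b \<otimes> (a \<otimes> (b \<otimes> a))) = b \<otimes> (a \<otimes> b)"
    using braid ab aa(1)[of "b \<otimes> (a \<otimes> b)"] by simp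
  then show ?thesis
    by (intro Fix_finite_orbit[of "{\<one>, a, b, a \<otimes> b, b \<otimes> a, a \<otimes> (b \<otimes> a), b \<otimes> (a \<otimes> b), a \<otimes> (b \<otimes> (a \<otimes> b))}"])
      (use ab aa braid in auto)
qed

lemma Fix_conjugate:
  assumes h: "h \<in> carrier G" and S: "S \<subseteq> carrier G" and x: "x \<in> Fix S"
  shows "act h x \<in> Fix ((\<lambda>s. h \<otimes> s \<otimes> inv h) ` S)"
proof -
  have xM: "x \<in> M" using x by (simp add: Fix_def)
  have "act (h \<otimes> s \<otimes> inv h) (act h x) = act h x" if s: "s \<in> S" for s
  proof -
    have sG: "s \<in> carrier G" using s S by auto
    have "act (h \<otimes> s \<otimes> inv h) (act h x) = act (h \<otimes> s \<otimes> inv h \<otimes> h) x"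
      using act_mult[of "h \<otimes> s \<otimes> inv h" h x] h sG xM by simp
    also have "h \<otimes> s \<otimes> inv h \<otimes> h = h \<otimes> s" using h sG by (simp add: m_assoc)
    also have "act (h \<otimes> s) x = act h x" using act_mult[OF h sG xM] x s by (simp add: Fix_def)
    finally show ?thesis .
  qed
  then show ?thesis using act_closed[OF h xM] by (auto simp: Fix_def)
qed

text \<open>A vertex of the product leaves out one member of each of the m conjugate families. What
  is left of each has a fixed point, and commutation combines these points. The Helly theorem
  returns one whole family with a fixed point, which is conjugated back.\<close>

theorem Fix_commuting_conjugates:
  assumes dim: "covering_dim_le mtopology D" "D + 1 \<le> m * k"
    and t: "\<And>j. j \<le> k \<Longrightarrow> t j \<in> carrier G"
    and proper: "\<And>j. j \<le> k \<Longrightarrow> Fix (t ` ({..k} - {j})) \<noteq> {}"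
    and h: "\<And>i. i < m \<Longrightarrow> h i \<in> carrier G"
    and comm: "\<And>i i' j j'. \<lbrakk>i < m; i' < m; i \<noteq> i'; j \<le> k; j' \<le> k\<rbrakk> \<Longrightarrow>
      (h i \<otimes> t j \<otimes> inv h i) \<otimes> (h i' \<otimes> t j' \<otimes> inv h i') = (h i' \<otimes> t j' \<otimes> inv h i') \<otimes> (h i \<otimes> t j \<otimes> inv h i)"
  shows "Fix (t ` {..k}) \<noteq> {}"
proof -
  define c where "c = (\<lambda>i j. h i \<otimes> t j \<otimes> inv h i)"
  have c: "c i j \<in> carrier G" if "i < m" "j \<le> k" for i j
    using h t that by (simp add: c_def)
  have "\<exists>i<m. \<exists>x\<in>M. \<forall>j\<le>k. x \<in> Fix {c i j}"
  proof (rule product_Helly[OF dim])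
    show "closed_convex (Fix {c i j})" if "i < m" "j \<le> k" for i j
      using c[OF that] by (intro closed_convex_Fix) auto
    fix v :: "nat \<Rightarrow> nat" assume v: "\<forall>i<m. v i \<le> k"
    define S where "S = (\<lambda>i. c i ` ({..k} - {v i}))"
    have "Fix (\<Union>i\<in>{..<m}. S i) \<noteq> {}"
    proof (rule Fix_commuting_family)
      fix i assume i: "i \<in> {..<m}"
      show "S i \<subseteq> carrier G" using c i by (auto simp: S_def)
      obtain x where "x \<in> Fix (t ` ({..k} - {v i}))" using proper v i by auto
      then have "act (h i) x \<in> Fix ((\<lambda>s. h i \<otimes> s \<otimes> inv h i) ` t ` ({..k} - {v i}))"
        using h i t by (intro Fix_conjugate) auto
      moreover have "(\<lambda>s. h i \<otimes> s \<otimes> inv h i) ` t ` ({..k} - {v i}) = S i"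
        by (simp add: S_def c_def image_image)
      ultimately show "Fix (S i) \<noteq> {}" by auto
    next
      fix i i' s s' assume "i \<in> {..<m}" "i' \<in> {..<m}" "i \<noteq> i'" "s \<in> S i" "s' \<in> S i'"
      then show "s \<otimes> s' = s' \<otimes> s" unfolding S_def c_def by (auto intro!: comm)
    qed auto
    then obtain x where "x \<in> Fix (\<Union>i\<in>{..<m}. S i)" by blast
    then show "\<exists>x\<in>M. \<forall>i<m. \<forall>j\<le>k. j \<noteq> v i \<longrightarrow> x \<in> Fix {c i j}"
      by (intro bexI[of _ x]) (auto simp: Fix_def S_def)
  qed
  then obtain i x where i: "i < m" "x \<in> M" "\<And>j. j \<le> k \<Longrightarrow> act (c i j) x = x"
    by (auto simp: Fix_def)
  have hi: "h i \<in> carrier G" by (rule h[OF i(1)])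
  have "act (inv h i) x \<in> Fix ((\<lambda>s. inv h i \<otimes> s \<otimes> inv (inv h i)) ` c i ` {..k})"
    using hi c i by (intro Fix_conjugate) (auto simp: Fix_def)
  moreover have "(\<lambda>s. inv h i \<otimes> s \<otimes> inv (inv h i)) ` c i ` {..k} = t ` {..k}"
  proof -
    have "inv h i \<otimes> c i j \<otimes> inv (inv h i) = t j" if "j \<le> k" for j
      using hi t[OF that] by (simp add: c_def m_assoc) (simp add: m_assoc[symmetric])
    then show ?thesis by (force simp: image_image intro: image_cong)
  qed
  ultimately show ?thesis by auto
qed

lemma subgroup_stabilizer:
  assumes x: "x \<in> M"
  shows "subgroup {g \<in> carrier G. act g x = x} G"
proof (rule subgroupI)
  show "{g \<in> carrier G. act g x = x} \<noteq> {}" using act_one[OF x] one_closed by blast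
  fix a assume a: "a \<in> {g \<in> carrier G. act g x = x}"
  then have "act (inv a) x = act (inv a) (act a x)" by simp
  also have "\<dots> = x" using a act_mult[of "inv a" a x] act_one x by simp
  finally show "inv a \<in> {g \<in> carrier G. act g x = x}" using a by simp
  fix b assume "b \<in> {g \<in> carrier G. act g x = x}"
  then show "a \<otimes> b \<in> {g \<in> carrier G. act g x = x}" using a act_mult x by simp
qed auto

end

section \<open>Generators of the automorphism group of a free group\<close>

lemma proper_signed_perm:
  assumes "p permutes {..<n}"
  shows "proper n (signed_perm n p \<epsilon>)"
proof -
  have "p i < n" if "i < n" for i using permutes_in_image[OF assms, of i] that by simp
  then show ?thesis by (simp add: proper_def signed_perm_def singleton_words)
qed

lemma letter_image_signed_perm:
  "fst x < n \<Longrightarrow> letter_image (signed_perm n p \<epsilon>) x = [(p (fst x), snd x = \<epsilon> (fst x))]"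
  by (auto simp: letter_image_def signed_perm_def winv_def inv_letter_def)

lemma comp_signed_perm:
  assumes "p permutes {..<n}" "q permutes {..<n}" "i < n"
  shows "comp_subst (signed_perm n p \<epsilon>) (signed_perm n q \<delta>) i
       = signed_perm n (p \<circ> q) (\<lambda>i. \<delta> i = \<epsilon> (q i)) i"
proof -
  have "q i < n" using permutes_in_image[OF assms(2), of i] assms(3) by simp
  then show ?thesis
    using assms(3) letter_image_signed_perm[of "(q i, \<delta> i)" n p \<epsilon>]
      subst_singleton[where u = "signed_perm n p \<epsilon>", OF proper_reduced[OF proper_signed_perm[OF assms(1)]]]
    by (simp add: comp_subst_def signed_perm_def[of n q] signed_perm_def[of n "p \<circ> q"])
qed

lemma signed_perm_in_Aut:
  assumes p: "p permutes {..<n}"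
  shows "subst_aut n (signed_perm n p \<epsilon>) \<in> carrier (Aut n)"
proof -
  have q: "inv_into UNIV p permutes {..<n}" by (rule permutes_inv[OF p])
  have pq: "p (inv_into UNIV p i) = i" "inv_into UNIV p (p i) = i" for i using p by (simp_all add: permutes_inverses)
  show ?thesis
  proof (rule subst_aut_in_Aut[OF proper_signed_perm[OF p] proper_signed_perm[OF q]])
    fix i assume i: "i < n"
    show "subst (signed_perm n p \<epsilon>) (signed_perm n (inv_into UNIV p) (\<lambda>i. \<epsilon> (inv_into UNIV p i)) i) = [(i, True)]"
      using comp_signed_perm[OF p q i, of \<epsilon> "\<lambda>i. \<epsilon> (inv_into UNIV p i)"] i pq by (simp add: comp_subst_def signed_perm_def)
    show "subst (signed_perm n (inv_into UNIV p) (\<lambda>i. \<epsilon> (inv_into UNIV p i))) (signed_perm n p \<epsilon> i) = [(i, True)]"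
      using comp_signed_perm[OF q p i, of "\<lambda>i. \<epsilon> (inv_into UNIV p i)" \<epsilon>] i pq by (simp add: comp_subst_def signed_perm_def)
  qed
qed

lemma signed_perm_mult:
  assumes "p permutes {..<n}" "q permutes {..<n}"
  shows "subst_aut n (signed_perm n p \<epsilon>) \<otimes>\<^bsub>Aut n\<^esub> subst_aut n (signed_perm n q \<delta>)
       = subst_aut n (signed_perm n (p \<circ> q) (\<lambda>i. \<delta> i = \<epsilon> (q i)))"
  unfolding subst_aut_mult[OF proper_signed_perm[OF assms(1)] proper_signed_perm[OF assms(2)]
      signed_perm_in_Aut[OF assms(1)] signed_perm_in_Aut[OF assms(2)]]
  by (rule subst_aut_cong) (rule comp_signed_perm[OF assms])

lemma finite_signed_perms: "finite {subst_aut n (signed_perm n p \<epsilon>) | p \<epsilon>. p permutes {..<n}}"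
proof (rule finite_subset)
  \<comment> \<open>Signs matter below n only, so a subset of \<open>{..<n}\<close> records
    them.\<close>
  let ?f = "\<lambda>(p, E). subst_aut n (signed_perm n p (\<lambda>i. i \<in> E))"
  show "{subst_aut n (signed_perm n p \<epsilon>) | p \<epsilon>. p permutes {..<n}} \<subseteq> ?f ` ({p. p permutes {..<n}} \<times> Pow {..<n})"
  proof clarify
    fix p \<epsilon> assume p: "p permutes {..<n}"
    have "subst_aut n (signed_perm n p \<epsilon>) = ?f (p, {i. i < n \<and> \<epsilon> i})"
      unfolding prod.case by (rule subst_aut_cong) (simp add: signed_perm_def)
    then show "subst_aut n (signed_perm n p \<epsilon>) \<in> ?f ` ({p. p permutes {..<n}} \<times> Pow {..<n})"
      using p by (intro image_eqI[of _ _ "(p, {i. i < n \<and> \<epsilon> i})"]) auto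
  qed
  show "finite (?f ` ({p. p permutes {..<n}} \<times> Pow {..<n}))"
    by (intro finite_imageI finite_cartesian_product finite_permutations) auto
qed

text \<open>A transvection composed with a sign change of the second basis element, which makes it
  an involution.\<close>

definition theta :: "nat \<Rightarrow> letter list" where
  "theta i = (if i = 0 then [(0, True), (1, True)] else if i = 1 then [(1, False)] else [(i, True)])"

text \<open>The sign in the second and third generator is what makes every pair of generators
  generate a finite group.\<close>

definition gen :: "nat \<Rightarrow> nat \<Rightarrow> nat \<Rightarrow> letter list" where
  "gen n k = (if k = 0 then theta
     else if k = 1 then signed_perm n (Transposition.transpose 0 1) (\<lambda>i. 1 < i)
     else if k = 2 then signed_perm n (Transposition.transpose 1 2) (\<lambda>i. i \<noteq> 0)
     else if k < n then signed_perm n (Transposition.transpose (k - 1) k) (\<lambda>_. True)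
     else signed_perm n id (\<lambda>i. i \<noteq> n - 1))"

lemmas word_simps = subst_Cons letter_image_def winv_def inv_letter_def wmul_Cons

lemma proper_theta: "2 \<le> n \<Longrightarrow> proper n theta"
  by (auto simp: proper_def theta_def words_iff reduced_Cons inv_letter_def)

lemma subst_theta_theta: "subst theta (theta i) = [(i, True)]"
  by (simp add: theta_def word_simps)

lemma theta_in_Aut: "2 \<le> n \<Longrightarrow> subst_aut n theta \<in> carrier (Aut n)"
  using subst_theta_theta by (intro subst_aut_in_Aut[OF proper_theta proper_theta]) auto

lemma gen_signed_perm:
  assumes "4 \<le> n" "1 \<le> k" "k \<le> n"
  shows "\<exists>p \<epsilon>. p permutes {..<n} \<and> gen n k = signed_perm n p \<epsilon>"
proof -
  have tr: "Transposition.transpose a b permutes {..<n}" if "a < n" "b < n" for a b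
    using that by (intro permutes_swap_id) auto
  consider "k = 1" | "k = 2" | "3 \<le> k" "k < n" | "3 \<le> k" "k = n" using assms by linarith
  then show ?thesis
  proof cases
    case 1
    then show ?thesis using tr[of 0 1] assms unfolding gen_def by auto
  next
    case 2
    then show ?thesis using tr[of 1 2] assms unfolding gen_def by auto
  next
    case 3
    then have "gen n k = signed_perm n (Transposition.transpose (k - 1) k) (\<lambda>_. True)" by (simp add: gen_def)
    moreover have "Transposition.transpose (k - 1) k permutes {..<n}" using 3 by (intro tr) auto
    ultimately show ?thesis by blast
  next
    case 4
    then have "gen n k = signed_perm n id (\<lambda>i. i \<noteq> n - 1)" by (simp add: gen_def)
    then show ?thesis using permutes_id by blast
  qed
qed

lemma gen_0: "gen n 0 = theta"
  by (simp add: gen_def)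

lemma proper_gen:
  assumes "4 \<le> n" "k \<le> n"
  shows "proper n (gen n k)"
proof (cases "k = 0")
  case True
  then show ?thesis using proper_theta assms by (simp add: gen_0)
next
  case False
  then obtain p \<epsilon> where "p permutes {..<n}" "gen n k = signed_perm n p \<epsilon>"
    using gen_signed_perm[of n k] assms by auto
  then show ?thesis using proper_signed_perm by simp
qed

lemma gen_in_Aut:
  assumes "4 \<le> n" "k \<le> n"
  shows "subst_aut n (gen n k) \<in> carrier (Aut n)"
proof (cases "k = 0")
  case True
  then show ?thesis using theta_in_Aut assms by (simp add: gen_0)
next
  case False
  then obtain p \<epsilon> where "p permutes {..<n}" "gen n k = signed_perm n p \<epsilon>"
    using gen_signed_perm[of n k] assms by auto
  then show ?thesis using signed_perm_in_Aut by simp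
qed

lemma gen_1: "4 \<le> n \<Longrightarrow> gen n 1 i = (if i = 0 then [(1, False)] else if i = 1 then [(0, False)] else [(i, True)])"
  by (auto simp: gen_def signed_perm_def Transposition.transpose_def)

lemma gen_2: "4 \<le> n \<Longrightarrow> gen n 2 i = (if i = 0 then [(0, False)] else if i = 1 then [(2, True)]
    else if i = 2 then [(1, True)] else [(i, True)])"
  by (auto simp: gen_def signed_perm_def Transposition.transpose_def)

lemma Aut_mult_apply:
  "\<lbrakk>\<alpha> \<in> carrier (Aut n); \<beta> \<in> carrier (Aut n); w \<in> words n\<rbrakk> \<Longrightarrow> (\<alpha> \<otimes>\<^bsub>Aut n\<^esub> \<beta>) w = \<alpha> (\<beta> w)"
  by (simp add: mult_Aut compose_def)

lemma Aut_eqI: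
  assumes "\<alpha> \<in> carrier (Aut n)" "\<beta> \<in> carrier (Aut n)" "\<And>i. i < n \<Longrightarrow> \<alpha> [(i, True)] = \<beta> [(i, True)]"
  shows "\<alpha> = \<beta>"
proof -
  have "basis_images n \<alpha> = basis_images n \<beta>" using assms(3) by (auto simp: basis_images_def)
  then show ?thesis using subst_aut_basis_images assms(1,2) by metis
qed

lemma subst_aut_apply: "\<lbrakk>proper n u; i < n\<rbrakk> \<Longrightarrow> subst_aut n u [(i, True)] = u i"
  using subst_singleton[where u = u and x = "(i, True)"] proper_reduced[of n u]
  by (simp add: subst_aut_def singleton_words letter_image_def)

text \<open>Only theta with its neighbours 1 and 2 calls for relations: the remaining generators lie
  in the finite group of signed permutations, and theta commutes with those from index 3 on.\<close>

lemma gen_relations: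
  assumes n: "4 \<le> n"
  defines "a \<equiv> \<lambda>k. subst_aut n (gen n k)"
  shows "a 0 \<otimes>\<^bsub>Aut n\<^esub> a 0 = \<one>\<^bsub>Aut n\<^esub>" "a 1 \<otimes>\<^bsub>Aut n\<^esub> a 1 = \<one>\<^bsub>Aut n\<^esub>" "a 2 \<otimes>\<^bsub>Aut n\<^esub> a 2 = \<one>\<^bsub>Aut n\<^esub>"
    "a 0 \<otimes>\<^bsub>Aut n\<^esub> (a 1 \<otimes>\<^bsub>Aut n\<^esub> a 0) = a 1 \<otimes>\<^bsub>Aut n\<^esub> (a 0 \<otimes>\<^bsub>Aut n\<^esub> a 1)"
    "a 0 \<otimes>\<^bsub>Aut n\<^esub> (a 2 \<otimes>\<^bsub>Aut n\<^esub> (a 0 \<otimes>\<^bsub>Aut n\<^esub> a 2)) = a 2 \<otimes>\<^bsub>Aut n\<^esub> (a 0 \<otimes>\<^bsub>Aut n\<^esub> (a 2 \<otimes>\<^bsub>Aut n\<^esub> a 0))"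
proof -
  interpret group "Aut n" by (rule group_Aut)
  have a: "a k \<in> carrier (Aut n)" if "k \<le> 2" for k using gen_in_Aut[OF n, of k] n that by (simp add: a_def)
  have ap: "a k w = subst (gen n k) w" "subst (gen n k) w \<in> words n" if "k \<le> 2" "w \<in> words n" for k w
    using that subst_words[OF proper_gen[OF n, of k]] n by (simp_all add: a_def subst_aut_def)
  have sg: "subst (gen n k) [(i, True)] = gen n k i" if "k \<le> 2" for k i
    using subst_singleton[where u = "gen n k", OF proper_reduced[OF proper_gen[OF n]]] that n
    by (simp add: letter_image_def)
  have gw: "gen n k i \<in> words n" if "k \<le> 2" "i < n" for k i
    using proper_gen[OF n, of k] that n by (simp add: proper_def)
  have one: "\<one>\<^bsub>Aut n\<^esub> [(i, True)] = [(i, True)]" if "i < n" for i using that by (simp add: one_Aut singleton_words)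
  note g = gen_def[of n 0] gen_1[OF n, unfolded One_nat_def] gen_2[OF n] theta_def word_simps
  show "a 0 \<otimes>\<^bsub>Aut n\<^esub> a 0 = \<one>\<^bsub>Aut n\<^esub>"
    by (rule Aut_eqI[where n = n]) (use a one in \<open>simp_all add: Aut_mult_apply ap gw singleton_words sg\<close>, simp add: g)
  show "a 1 \<otimes>\<^bsub>Aut n\<^esub> a 1 = \<one>\<^bsub>Aut n\<^esub>"
    by (rule Aut_eqI[where n = n]) (use a one in \<open>simp_all add: Aut_mult_apply ap gw singleton_words sg\<close>, simp add: g)
  show "a 2 \<otimes>\<^bsub>Aut n\<^esub> a 2 = \<one>\<^bsub>Aut n\<^esub>"
    by (rule Aut_eqI[where n = n]) (use a one in \<open>simp_all add: Aut_mult_apply ap gw singleton_words sg\<close>, simp add: g)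
  show "a 0 \<otimes>\<^bsub>Aut n\<^esub> (a 1 \<otimes>\<^bsub>Aut n\<^esub> a 0) = a 1 \<otimes>\<^bsub>Aut n\<^esub> (a 0 \<otimes>\<^bsub>Aut n\<^esub> a 1)"
    by (rule Aut_eqI[where n = n]) (use a in \<open>simp_all add: Aut_mult_apply ap gw singleton_words sg\<close>, simp add: g)
  show "a 0 \<otimes>\<^bsub>Aut n\<^esub> (a 2 \<otimes>\<^bsub>Aut n\<^esub> (a 0 \<otimes>\<^bsub>Aut n\<^esub> a 2)) = a 2 \<otimes>\<^bsub>Aut n\<^esub> (a 0 \<otimes>\<^bsub>Aut n\<^esub> (a 2 \<otimes>\<^bsub>Aut n\<^esub> a 0))"
    by (rule Aut_eqI[where n = n]) (use a in \<open>simp_all add: Aut_mult_apply ap gw singleton_words sg\<close>, simp add: g)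
qed

text \<open>The sign change of the last basis element is carried to all others by conjugation. With
  signs free, all signed permutations arise, and they conjugate one transvection to every
  other.\<close>

theorem gen_generate:
  assumes n: "4 \<le> n" and H: "subgroup H (Aut n)"
    and gens: "\<And>k. k \<le> n \<Longrightarrow> subst_aut n (gen n k) \<in> H"
    and \<alpha>: "\<alpha> \<in> carrier (Aut n)"
  shows "\<alpha> \<in> H"
proof -
  interpret A: group "Aut n" by (rule group_Aut)
  interpret H: subgroup H "Aut n" by (rule H)
  have cancel: "y \<in> H" if "y \<in> carrier (Aut n)" "x \<in> H" "y \<otimes>\<^bsub>Aut n\<^esub> x \<in> H" for x y
  proof -
    have "(y \<otimes>\<^bsub>Aut n\<^esub> x) \<otimes>\<^bsub>Aut n\<^esub> inv\<^bsub>Aut n\<^esub> x \<in> H" using that by blast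
    then show ?thesis using that by (simp add: A.m_assoc)
  qed
  define P where "P = (\<lambda>p \<epsilon>. p permutes {..<n} \<and> subst_aut n (signed_perm n p \<epsilon>) \<in> H)"
  have comp: "P (p \<circ> q) (\<lambda>i. \<delta> i = \<epsilon> (q i))" if "P p \<epsilon>" "P q \<delta>" for p q \<epsilon> \<delta>
    using that signed_perm_mult[of p n q \<epsilon> \<delta>] H.m_closed[of "subst_aut n (signed_perm n p \<epsilon>)" "subst_aut n (signed_perm n q \<delta>)"]
    by (simp add: P_def permutes_compose)
  have gen: "P p \<epsilon>" if "gen n k = signed_perm n p \<epsilon>" "k \<le> n" "p permutes {..<n}" for k p \<epsilon>
    using gens[OF that(2)] that by (simp add: P_def)
  have tr: "Transposition.transpose a b permutes {..<n}" if "a < n" "b < n" for a b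
    using that by (intro permutes_swap_id) auto
  have gen1: "P (Transposition.transpose 0 1) (\<lambda>i. 1 < i)" by (rule gen[of 1]) (use n tr in \<open>auto simp: gen_def\<close>)
  have gen2: "P (Transposition.transpose 1 2) (\<lambda>i. i \<noteq> 0)" by (rule gen[of 2]) (use n tr in \<open>auto simp: gen_def\<close>)
  have genk: "P (Transposition.transpose (k - 1) k) (\<lambda>_. True)" if "3 \<le> k" "k < n" for k
    by (rule gen[of k]) (use that tr in \<open>auto simp: gen_def\<close>)
  have genn: "P id (\<lambda>i. i \<noteq> n - 1)" by (rule gen[of n]) (use n permutes_id in \<open>auto simp: gen_def\<close>)
  \<comment> \<open>A signed permutation over p conjugates the sign change at j to the one at p j;
    its own signs drop out.\<close>
  have conj: "P id (\<lambda>i. i \<noteq> p j)" if p: "P p \<epsilon>" and j: "P id (\<lambda>i. i \<noteq> j)" for p \<epsilon> j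
  proof -
    have perm: "p permutes {..<n}" using p by (simp add: P_def)
    have "P (p \<circ> id) (\<lambda>i. (i \<noteq> j) = \<epsilon> (id i))" by (rule comp[OF p j])
    moreover have "(p \<circ> id) = id \<circ> p" by simp
    moreover have "(\<lambda>i. (i \<noteq> j) = \<epsilon> (id i)) = (\<lambda>i. \<epsilon> i = (p i \<noteq> p j))"
      using permutes_inj[OF perm] by (auto simp: inj_eq)
    ultimately have "subst_aut n (signed_perm n (id \<circ> p) (\<lambda>i. \<epsilon> i = (p i \<noteq> p j))) \<in> H"
      unfolding P_def by metis
    then have "subst_aut n (signed_perm n id (\<lambda>i. i \<noteq> p j)) \<otimes>\<^bsub>Aut n\<^esub> subst_aut n (signed_perm n p \<epsilon>) \<in> H"
      unfolding signed_perm_mult[OF permutes_id perm] .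
    then show ?thesis
      using cancel[OF signed_perm_in_Aut[OF permutes_id]] p by (auto simp: P_def permutes_id)
  qed
  \<comment> \<open>Descends from n - 1 to 2 along unsigned transpositions; 1 and 0 are reached
    through the signed generators 2 and 1.\<close>
  have chain: "P id (\<lambda>i. i \<noteq> n - 1 - i')" if "i' \<le> n - 3" for i'
    using that
  proof (induction i')
    case 0
    then show ?case using genn by (simp add: id_def comp_def)
  next
    case (Suc i')
    let ?k = "n - 1 - i'"
    have k: "3 \<le> ?k" "?k < n" using Suc n by auto
    have "P id (\<lambda>i. i \<noteq> Transposition.transpose (?k - 1) ?k ?k)"
      by (rule conj[OF genk[OF k]]) (use Suc in \<open>simp add: id_def\<close>)
    moreover have "Transposition.transpose (?k - 1) ?k ?k = n - 1 - Suc i'" by simp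
    ultimately show ?case by (simp add: id_def comp_def)
  qed
  have flip_ge2: "P id (\<lambda>i. i \<noteq> j)" if "2 \<le> j" "j < n" for j
  proof -
    have "n - 1 - (n - 1 - j) = j" "n - 1 - j \<le> n - 3" using that n by simp_all
    then show ?thesis using chain[of "n - 1 - j"] by metis
  qed
  have flip1: "P id (\<lambda>i. i \<noteq> 1)" using conj[OF gen2 flip_ge2[of 2]] n by simp
  have flip0: "P id (\<lambda>i. i \<noteq> 0)" using conj[OF gen1 flip1] by simp
  have flip: "P id (\<lambda>i. i \<noteq> j)" if "j < n" for j
    using flip_ge2[of j] flip0 flip1 that by (cases "j = 0 \<or> j = 1") auto
  have signs: "P id (\<lambda>i. i \<notin> E)" if "finite E" "E \<subseteq> {..<n}" for E
    using that
  proof (induction E rule: finite_induct)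
    case empty
    show ?case using comp[OF flip0 flip0] by (simp add: id_def comp_def)
  next
    case (insert x E)
    then have x: "P id (\<lambda>i. i \<noteq> x)" using flip by auto
    have "P id (\<lambda>i. i \<notin> E)" using insert by (simp add: id_def comp_def)
    then have "P (id \<circ> id) (\<lambda>i. (i \<notin> E) = (id i \<noteq> x))" by (rule comp[OF x])
    moreover have "(\<lambda>i. (i \<notin> E) = (id i \<noteq> x)) = (\<lambda>i. i \<notin> insert x E)" using insert by auto
    ultimately show ?case by (simp add: id_def comp_def)
  qed
  have any_sign: "P p \<epsilon>'" if p: "P p \<epsilon>" for p \<epsilon> \<epsilon>'
  proof -
    have "P (p \<circ> id) (\<lambda>i. (i \<notin> {i. i < n \<and> \<epsilon>' i \<noteq> \<epsilon> i}) = \<epsilon> (id i))"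
      by (rule comp[OF p signs]) auto
    moreover have "subst_aut n (signed_perm n p (\<lambda>i. (i \<notin> {i. i < n \<and> \<epsilon>' i \<noteq> \<epsilon> i}) = \<epsilon> (id i)))
        = subst_aut n (signed_perm n p \<epsilon>')"
      by (rule subst_aut_cong) (auto simp: signed_perm_def)
    ultimately show ?thesis by (simp add: P_def)
  qed
  have adj: "P (Transposition.transpose (k - 1) k) \<epsilon>" if k: "1 \<le> k" "k < n" for k \<epsilon>
  proof -
    consider "k = 1" | "k = 2" | "3 \<le> k" using k(1) by linarith
    then show ?thesis
      using any_sign[OF gen1] any_sign[OF gen2] any_sign[OF genk[OF _ k(2)]] by cases auto
  qed
  have transp: "P (Transposition.transpose a b) (\<lambda>_. True)" if "a < b" "b < n" for a b
    using that
  proof (induction b)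
    case (Suc b)
    have tb: "P (Transposition.transpose b (Suc b)) (\<lambda>_. True)" using adj[of "Suc b"] Suc by simp
    show ?case
    proof (cases "a = b")
      case True
      then show ?thesis using tb by simp
    next
      case False
      then have "P (Transposition.transpose a b) (\<lambda>_. True)" using Suc by simp
      note comp[OF comp[OF tb this] tb]
      moreover have "Transposition.transpose b (Suc b) \<circ> Transposition.transpose a b \<circ> Transposition.transpose b (Suc b)
          = Transposition.transpose a (Suc b)"
        using Suc.prems(1) False by (auto simp: fun_eq_iff Transposition.transpose_def)
      ultimately show ?thesis by simp
    qed
  qed simp
  have perms: "P p \<epsilon>" if "p permutes {..<n}" for p \<epsilon>
  proof (rule any_sign)
    show "P p (\<lambda>_. True)"
      using that finite_lessThan
    proof (induction rule: permutes_induct)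
      case id
      show ?case using signs[of "{}"] by (simp add: id_def comp_def)
    next
      case (swap a b p)
      have "P (Transposition.transpose a b) (\<lambda>_. True)"
        using transp[of a b] transp[of b a] swap(1-3) by (cases "a < b") (auto simp: transpose_commute[of a b])
      then show ?case using comp[of "Transposition.transpose a b" "\<lambda>_. True" p "\<lambda>_. True"] swap
        by (simp add: comp_def)
    qed
  qed
  have \<theta>: "subst_aut n theta \<in> H" using gens[of 0] by (simp add: gen_def)
  have n2: "2 \<le> n" using n by simp
  have basic: "subst_aut n (nielsen (0, True) (1, True)) \<in> H"
  proof -
    have e: "subst_aut n (signed_perm n id (\<lambda>i. i \<noteq> 1)) \<in> H" using flip1 by (simp add: P_def)
    have "subst_aut n theta \<otimes>\<^bsub>Aut n\<^esub> subst_aut n (signed_perm n id (\<lambda>i. i \<noteq> 1))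
        = subst_aut n (comp_subst theta (signed_perm n id (\<lambda>i. i \<noteq> 1)))"
      by (rule subst_aut_mult[OF proper_theta[OF n2] proper_signed_perm[OF permutes_id] theta_in_Aut[OF n2] signed_perm_in_Aut[OF permutes_id]])
    also have "\<dots> = subst_aut n (nielsen (0, True) (1, True))"
      by (rule subst_aut_cong) (simp add: comp_subst_def signed_perm_def theta_def nielsen_def word_simps)
    finally show ?thesis using H.m_closed[OF \<theta> e] by simp
  qed
  have nielsens: "subst_aut n (nielsen x y) \<in> H" if xy: "fst x < n" "fst y < n" "fst x \<noteq> fst y" for x y
  proof -
    let ?t = "Transposition.transpose"
    \<comment> \<open>Brings 0 to \<open>fst x\<close>, then the current image of 1 to
      \<open>fst y\<close>; the second swap leaves \<open>fst x\<close> in place.\<close>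
    define p where "p = ?t (?t 0 (fst x) 1) (fst y) \<circ> ?t 0 (fst x)"
    have t1: "?t 0 (fst x) 1 < n" "?t 0 (fst x) 1 \<noteq> fst x" using xy n by (auto simp: Transposition.transpose_def)
    have p: "p permutes {..<n}"
      unfolding p_def by (intro permutes_compose tr) (use xy n t1 in auto)
    have p01: "p 0 = fst x" "p 1 = fst y" using t1 xy(3) by (auto simp: p_def)
    have px: "p i \<noteq> fst x" if "i \<noteq> 0" for i using permutes_inj[OF p] p01 that by (metis injD)
    define \<epsilon> where "\<epsilon> = (\<lambda>i::nat. if i = 0 then snd x else snd y)"
    let ?X = "signed_perm n p \<epsilon>"
    have X: "proper n ?X" "subst_aut n ?X \<in> carrier (Aut n)" "subst_aut n ?X \<in> H"
      using proper_signed_perm[OF p] signed_perm_in_Aut[OF p] perms[OF p] by (auto simp: P_def)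
    have basicA: "proper n (nielsen (0, True) (1, True))" "subst_aut n (nielsen (0, True) (1, True)) \<in> carrier (Aut n)"
      using n by (auto intro!: proper_nielsen nielsen_in_Aut)
    have xy_red: "reduced [x, y]" using xy(3) by (auto simp: reduced_Cons)
    have limg: "letter_image ?X (0, True) = [x]" "letter_image ?X (1, True) = [y]"
      using n p01 by (auto simp: letter_image_signed_perm \<epsilon>_def)
    have nx: "letter_image (nielsen x y) x = [x, y]"
      by (cases x; cases y) (auto simp: letter_image_def nielsen_def winv_def inv_letter_def)
    have "comp_subst (nielsen x y) ?X i = comp_subst ?X (nielsen (0, True) (1, True)) i" if i: "i < n" for i
    proof (cases "i = 0")
      case True
      have "comp_subst (nielsen x y) ?X 0 = [x, y]"
        using subst_singleton[where u = "nielsen x y", OF proper_reduced[OF proper_nielsen[OF xy]], of x] nx p01 n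
        by (simp add: comp_subst_def signed_perm_def \<epsilon>_def)
      moreover have "comp_subst ?X (nielsen (0, True) (1, True)) 0 = [x, y]"
        using limg xy_red by (simp add: comp_subst_def nielsen_def subst_Cons wmul_Cons reduced_Cons)
      ultimately show ?thesis using True by simp
    next
      case False
      have "p i < n" using permutes_in_image[OF p, of i] i by simp
      have "comp_subst (nielsen x y) ?X i = [(p i, \<epsilon> i)]"
        using px[OF False] i by (auto simp: comp_subst_def signed_perm_def nielsen_def word_simps)
      moreover have "comp_subst ?X (nielsen (0, True) (1, True)) i = [(p i, \<epsilon> i)]"
        using False i subst_singleton[where u = ?X, OF proper_reduced[OF X(1)]]
        by (simp add: comp_subst_def nielsen_def letter_image_signed_perm)
      ultimately show ?thesis by simp
    qed
    then have "subst_aut n (comp_subst (nielsen x y) ?X) = subst_aut n (comp_subst ?X (nielsen (0, True) (1, True)))"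
      by (rule subst_aut_cong)
    then have "subst_aut n (nielsen x y) \<otimes>\<^bsub>Aut n\<^esub> subst_aut n ?X
        = subst_aut n ?X \<otimes>\<^bsub>Aut n\<^esub> subst_aut n (nielsen (0, True) (1, True))"
      using subst_aut_mult[OF proper_nielsen[OF xy] X(1) nielsen_in_Aut[OF xy] X(2)]
        subst_aut_mult[OF X(1) basicA(1) X(2) basicA(2)] by simp
    then show ?thesis
      using cancel[OF nielsen_in_Aut[OF xy] X(3)] H.m_closed[OF X(3) basic] by simp
  qed
  show ?thesis
    by (rule nielsen_generation[OF H nielsens _ \<alpha>]) (use perms in \<open>auto simp: P_def\<close>)
qed

section \<open>Supports and commuting conjugates\<close>

definition supported_on :: "nat \<Rightarrow> nat set \<Rightarrow> (letter list \<Rightarrow> letter list) \<Rightarrow> bool" where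
  "supported_on n L \<alpha> \<longleftrightarrow> (\<forall>i<n. (i \<notin> L \<longrightarrow> \<alpha> [(i, True)] = [(i, True)]) \<and>
     (i \<in> L \<longrightarrow> set (\<alpha> [(i, True)]) \<subseteq> L \<times> UNIV))"

lemma supported_on_mono: "\<lbrakk>supported_on n L \<alpha>; L \<subseteq> L'\<rbrakk> \<Longrightarrow> supported_on n L' \<alpha>"
  by (fastforce simp: supported_on_def)

lemma Aut_fixes_word:
  assumes \<alpha>: "\<alpha> \<in> carrier (Aut n)" and w: "w \<in> words n"
    and "\<And>x. x \<in> set w \<Longrightarrow> \<alpha> [(fst x, True)] = [(fst x, True)]"
  shows "\<alpha> w = w"
  using assms subst_basis_images[OF \<alpha> w] subst_trivial[of w "basis_images n \<alpha>"]
  by (simp add: basis_images_def words_iff)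

text \<open>A basis element outside L is fixed by \<alpha>, and its image under \<beta> is a word in
  letters fixed by \<alpha>, so both orders agree on it. On L the roles are exchanged.\<close>

lemma supported_on_commute:
  assumes \<alpha>: "\<alpha> \<in> carrier (Aut n)" "supported_on n L \<alpha>"
    and \<beta>: "\<beta> \<in> carrier (Aut n)" "supported_on n L' \<beta>" and disj: "L \<inter> L' = {}"
  shows "\<alpha> \<otimes>\<^bsub>Aut n\<^esub> \<beta> = \<beta> \<otimes>\<^bsub>Aut n\<^esub> \<alpha>"
proof -
  interpret group "Aut n" by (rule group_Aut)
  have half: "\<alpha> (\<beta> [(i, True)]) = \<beta> (\<alpha> [(i, True)])"
    if i: "i < n" "i \<notin> L" and \<alpha>: "\<alpha> \<in> carrier (Aut n)" "supported_on n L \<alpha>"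
      and \<beta>: "\<beta> \<in> carrier (Aut n)" "supported_on n L' \<beta>" and disj: "L \<inter> L' = {}" for i \<alpha> \<beta> L L'
  proof (cases "i \<in> L'")
    case True
    let ?w = "\<beta> [(i, True)]"
    have w: "?w \<in> words n" by (rule Aut_words[OF \<beta>(1)]) (use i in \<open>auto intro: singleton_words\<close>)
    have "\<alpha> ?w = ?w"
    proof (rule Aut_fixes_word[OF \<alpha>(1) w])
      fix x assume x: "x \<in> set ?w"
      have "set ?w \<subseteq> L' \<times> UNIV" using \<beta>(2) True i by (simp add: supported_on_def)
      then have "fst x \<in> L'" using x by auto
      moreover have "fst x < n" using x w by (auto simp: words_iff)
      ultimately show "\<alpha> [(fst x, True)] = [(fst x, True)]" using \<alpha>(2) disj by (auto simp: supported_on_def)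
    qed
    then show ?thesis using \<alpha>(2) i by (simp add: supported_on_def)
  qed (use i \<alpha> \<beta> in \<open>simp add: supported_on_def\<close>)
  show ?thesis
  proof (rule Aut_eqI)
    fix i assume i: "i < n"
    have "\<alpha> (\<beta> [(i, True)]) = \<beta> (\<alpha> [(i, True)])"
    proof (cases "i \<in> L")
      case True
      then have "i \<notin> L'" "L' \<inter> L = {}" using disj by auto
      then show ?thesis using half[OF i _ \<beta> \<alpha>] by simp
    next
      case False
      then show ?thesis by (rule half[OF i _ \<alpha> \<beta> disj])
    qed
    then show "(\<alpha> \<otimes>\<^bsub>Aut n\<^esub> \<beta>) [(i, True)] = (\<beta> \<otimes>\<^bsub>Aut n\<^esub> \<alpha>) [(i, True)]"
      using Aut_mult_apply \<alpha>(1) \<beta>(1) singleton_words[of "(i, True)" n] i by simp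
  qed (use \<alpha> \<beta> in auto)
qed

lemma set_subst_signed_perm:
  "\<lbrakk>set w \<subseteq> {..<n} \<times> UNIV\<rbrakk> \<Longrightarrow> set (subst (signed_perm n p \<epsilon>) w) \<subseteq> (p ` fst ` set w) \<times> UNIV"
proof (induction w)
  case (Cons x w)
  have "letter_image (signed_perm n p \<epsilon>) x = [(p (fst x), snd x = \<epsilon> (fst x))]"
    using Cons.prems by (intro letter_image_signed_perm) auto
  moreover have "set (subst (signed_perm n p \<epsilon>) w) \<subseteq> (p ` fst ` set w) \<times> UNIV" using Cons by auto
  ultimately show ?case
    using set_cons_letter[of "(p (fst x), snd x = \<epsilon> (fst x))" "subst (signed_perm n p \<epsilon>) w"]
    by (auto simp: subst_Cons wmul_Cons)
qed simp

lemma supported_on_conjugate: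
  assumes p: "p permutes {..<n}" and \<alpha>: "\<alpha> \<in> carrier (Aut n)" "supported_on n L \<alpha>"
  defines "h \<equiv> subst_aut n (signed_perm n p (\<lambda>_. True))"
  shows "supported_on n (p ` L) (h \<otimes>\<^bsub>Aut n\<^esub> \<alpha> \<otimes>\<^bsub>Aut n\<^esub> inv\<^bsub>Aut n\<^esub> h)"
proof -
  interpret group "Aut n" by (rule group_Aut)
  have h: "h \<in> carrier (Aut n)" unfolding h_def by (rule signed_perm_in_Aut[OF p])
  have h1: "h [(l, True)] = [(p l, True)]" if "l < n" for l
    using subst_aut_apply[OF proper_signed_perm[OF p] that] that by (simp add: h_def signed_perm_def)
  let ?\<beta> = "h \<otimes>\<^bsub>Aut n\<^esub> \<alpha> \<otimes>\<^bsub>Aut n\<^esub> inv\<^bsub>Aut n\<^esub> h"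
  have \<beta>: "?\<beta> \<in> carrier (Aut n)" using h \<alpha> by simp
  have "?\<beta> \<otimes>\<^bsub>Aut n\<^esub> h = h \<otimes>\<^bsub>Aut n\<^esub> \<alpha>" using h \<alpha> by (simp add: m_assoc)
  then have eq: "?\<beta> [(p l, True)] = h (\<alpha> [(l, True)])" if "l < n" for l
    using Aut_mult_apply[OF \<beta> h, of "[(l, True)]"] Aut_mult_apply[OF h \<alpha>(1), of "[(l, True)]"]
      h1[OF that] singleton_words[of "(l, True)" n] that by simp
  show ?thesis
    unfolding supported_on_def
  proof (intro allI impI conjI)
    fix i assume i: "i < n"
    obtain l where l: "l < n" "i = p l"
      using permutes_image[OF p] i by (metis imageE lessThan_iff)
    have w: "\<alpha> [(l, True)] \<in> words n" by (rule Aut_words[OF \<alpha>(1)]) (use l in \<open>auto intro: singleton_words\<close>)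
    show "?\<beta> [(i, True)] = [(i, True)]" if "i \<notin> p ` L"
    proof -
      have "l \<notin> L" using that l by auto
      then show ?thesis using eq[OF l(1)] h1[OF l(1)] \<alpha>(2) l by (simp add: supported_on_def)
    qed
    show "set (?\<beta> [(i, True)]) \<subseteq> p ` L \<times> UNIV" if "i \<in> p ` L"
    proof -
      have "l \<in> L" using that l permutes_inj[OF p] by (auto dest: injD)
      then have sub: "set (\<alpha> [(l, True)]) \<subseteq> L \<times> UNIV" using \<alpha>(2) l by (simp add: supported_on_def)
      have "h (\<alpha> [(l, True)]) = subst (signed_perm n p (\<lambda>_. True)) (\<alpha> [(l, True)])"
        using w by (simp add: h_def subst_aut_def)
      moreover have "set (subst (signed_perm n p (\<lambda>_. True)) (\<alpha> [(l, True)])) \<subseteq> (p ` fst ` set (\<alpha> [(l, True)])) \<times> UNIV"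
        using w by (intro set_subst_signed_perm) (auto simp: words_iff)
      moreover have "p ` fst ` set (\<alpha> [(l, True)]) \<subseteq> p ` L" using sub by auto
      ultimately show ?thesis using eq[OF l(1)] l(2) by auto
    qed
  qed
qed

text \<open>Generator 2 also changes the sign of basis element 0, hence the third element of its
  support.\<close>

definition gen_support :: "nat \<Rightarrow> nat \<Rightarrow> nat set" where
  "gen_support n k = (if k \<le> 1 then {0, 1} else if k = 2 then {0, 1, 2} else if k < n then {k - 1, k} else {n - 1})"

lemma gen_supported_on:
  assumes "4 \<le> n" "k \<le> n"
  shows "supported_on n (gen_support n k) (subst_aut n (gen n k))"
proof -
  consider "k = 0" | "k = 1" | "k = 2" | "3 \<le> k" "k < n" | "k = n" using assms by linarith
  then show ?thesis
    unfolding supported_on_def subst_aut_apply[OF proper_gen[OF assms]]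
    using assms subst_aut_apply[OF proper_gen[OF assms]]
    by cases (auto simp: gen_support_def gen_def theta_def signed_perm_def Transposition.transpose_def)
qed

text \<open>Failures to commute are thereby confined to the triangle 0, 1, 2 with the path 2, 3,
  ..., n attached; the excluded pair is the edge between theta and (1 2).\<close>

lemma gen_commute:
  assumes "4 \<le> n" "j + 2 \<le> k" "k \<le> n" "\<not> (j = 0 \<and> k = 2)"
  shows "subst_aut n (gen n j) \<otimes>\<^bsub>Aut n\<^esub> subst_aut n (gen n k) = subst_aut n (gen n k) \<otimes>\<^bsub>Aut n\<^esub> subst_aut n (gen n j)"
  by (rule supported_on_commute[OF gen_in_Aut gen_supported_on gen_in_Aut gen_supported_on])
    (use assms in \<open>auto simp: gen_support_def split: if_splits\<close>)

text \<open>Conjugation by it carries a support inside the first block of r basis elements to block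
  number i; i = 0 gives the identity.\<close>

definition block_swap :: "nat \<Rightarrow> nat \<Rightarrow> nat \<Rightarrow> nat" where
  "block_swap r i l = (if l < r then l + i * r else if i * r \<le> l \<and> l < i * r + r then l - i * r else l)"

lemma block_swap_permutes:
  assumes "i * r + r \<le> n"
  shows "block_swap r i permutes {..<n}"
proof -
  have *: "block_swap r i (block_swap r i l) = l" for l
  proof (cases i)
    case 0
    then show ?thesis by (simp add: block_swap_def)
  next
    case (Suc j)
    define q where "q = i * r"
    have "r \<le> q" using Suc by (simp add: q_def)
    then show ?thesis unfolding block_swap_def q_def[symmetric] by auto
  qed
  have "block_swap r i ` {..<n} \<subseteq> {..<n}" using assms by (auto simp: block_swap_def)
  then have "bij_betw (block_swap r i) {..<n} {..<n}"
    using * by (intro bij_betwI[where g = "block_swap r i"]) auto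
  then show ?thesis by (rule bij_imp_permutes) (use assms in \<open>auto simp: block_swap_def\<close>)
qed

lemma block_swap_disjoint:
  assumes "i \<noteq> i'"
  shows "block_swap r i ` {..<r} \<inter> block_swap r i' ` {..<r} = {}"
proof -
  have "block_swap r i x div r = i" if "x < r" for i x using that by (simp add: block_swap_def)
  then show ?thesis using assms by (auto simp: set_eq_iff) metis
qed

section \<open>Global fixed points\<close>

text \<open>A set of generators that falls into two commuting proper parts is settled by induction.
  What remains is a set without theta, a subset of a dihedral pair, or a connected set of at least
  three generators containing theta.\<close>

theorem Aut_fixed_point:
  assumes action: "isometric_action M d (Aut n) act" and n: "4 \<le> n"
    and dim: "covering_dim_le (Metric_space.mtopology M d) D"
    and bound: "\<And>k. \<lbrakk>2 \<le> k; k \<le> D + 1\<rbrakk> \<Longrightarrow> D < k * (n div (k + 2))"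
  shows "\<exists>x\<in>M. \<forall>g\<in>carrier (Aut n). act g x = x"
proof -
  interpret isometric_action M d "Aut n" act by (rule action)
  define A where "A = (\<lambda>k. subst_aut n (gen n k))"
  have A: "A k \<in> carrier (Aut n)" if "k \<le> n" for k using gen_in_Aut[OF n that] by (simp add: A_def)
  have AI: "A ` I \<subseteq> carrier (Aut n)" if "I \<subseteq> {..n}" for I using A that by auto
  have comm: "A j \<otimes>\<^bsub>Aut n\<^esub> A k = A k \<otimes>\<^bsub>Aut n\<^esub> A j"
    if "j + 2 \<le> k" "k \<le> n" "\<not> (j = 0 \<and> k = 2)" for j k
    unfolding A_def by (rule gen_commute[OF n that])
  have pair: "Fix {A 0, A 1} \<noteq> {}" "Fix {A 0, A 2} \<noteq> {}"
    using Fix_dihedral_3[OF A A] Fix_dihedral_4[OF A A] gen_relations[OF n] n by (simp_all add: A_def)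
  have without_theta: "Fix (A ` I) \<noteq> {}" if I: "I \<subseteq> {..n}" "0 \<notin> I" for I
  proof -
    define W where "W = {subst_aut n (signed_perm n p \<epsilon>) | p \<epsilon>. p permutes {..<n}}"
    have signed: "\<exists>p \<epsilon>. p permutes {..<n} \<and> A k = subst_aut n (signed_perm n p \<epsilon>)" if "k \<in> I" for k
    proof -
      have "k \<noteq> 0" using that I(2) by metis
      then show ?thesis using gen_signed_perm[OF n, of k] that I(1) unfolding A_def by force
    qed
    show ?thesis
    proof (rule Fix_finite_orbit[of W])
      show "finite W" unfolding W_def by (rule finite_signed_perms)
      show "W \<noteq> {}" unfolding W_def using permutes_id by blast
      show "W \<subseteq> carrier (Aut n)" unfolding W_def using signed_perm_in_Aut by blast
      show "A ` I \<subseteq> carrier (Aut n)" by (rule AI[OF I(1)])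
      fix s w assume "s \<in> A ` I" "w \<in> W"
      then obtain p \<epsilon> q \<delta> where pq: "p permutes {..<n}" "s = subst_aut n (signed_perm n p \<epsilon>)"
        "q permutes {..<n}" "w = subst_aut n (signed_perm n q \<delta>)"
        using signed unfolding W_def by blast
      have "s \<otimes>\<^bsub>Aut n\<^esub> w = subst_aut n (signed_perm n (p \<circ> q) (\<lambda>i. \<delta> i = \<epsilon> (q i)))"
        unfolding pq(2,4) by (rule signed_perm_mult[OF pq(1,3)])
      then show "s \<otimes>\<^bsub>Aut n\<^esub> w \<in> W" unfolding W_def using permutes_compose[OF pq(3,1)] by blast
    qed
  qed
  have all_subsets: "Fix (A ` I) \<noteq> {}" if "I \<subseteq> {..n}" for I
    using finite_subset[OF that finite_atMost] that
  proof (induction I rule: finite_psubset_induct)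
    case (psubset I)
    have split: ?case if "I = I1 \<union> I2" "I1 \<noteq> I" "I2 \<noteq> I"
      "\<And>j k. j \<in> I1 \<Longrightarrow> k \<in> I2 \<Longrightarrow> j + 2 \<le> k \<and> \<not> (j = 0 \<and> k = 2)" for I1 I2
    proof -
      have sub: "I1 \<subset> I" "I2 \<subset> I" "I1 \<subseteq> {..n}" "I2 \<subseteq> {..n}" using that(1-3) psubset.prems by auto
      have "Fix (A ` I1 \<union> A ` I2) \<noteq> {}"
      proof (rule Fix_commuting[OF AI[OF sub(3)] psubset.IH[OF sub(1,3)] AI[OF sub(4)] psubset.IH[OF sub(2,4)]])
        fix s t assume "s \<in> A ` I1" "t \<in> A ` I2"
        then show "s \<otimes>\<^bsub>Aut n\<^esub> t = t \<otimes>\<^bsub>Aut n\<^esub> s" using comm that(4) sub(4) by blast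
      qed
      then show ?thesis using that(1) by (simp add: image_Un)
    qed
    \<comment> \<open>Without generator 2, theta can fail to commute only with generator 1.\<close>
    consider "0 \<notin> I" | "0 \<in> I" "2 \<notin> I" | "0 \<in> I" "2 \<in> I" by blast
    then show ?case
    proof cases
      case 1
      then show ?thesis by (rule without_theta[OF psubset.prems])
    next
      case 2
      show ?thesis
      proof (cases "I \<subseteq> {0, 1}")
        case True
        then have "Fix {A 0, A 1} \<subseteq> Fix (A ` I)" by (intro Fix_mono) auto
        then show ?thesis using pair(1) by blast
      next
        case False
        show ?thesis
        proof (rule split[of "I \<inter> {0, 1}" "I - {0, 1}"])
          show "I = I \<inter> {0, 1} \<union> (I - {0, 1})" by blast
          show "I \<inter> {0, 1} \<noteq> I" using False by blast
          show "I - {0, 1} \<noteq> I" using 2(1) by blast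
          fix j k assume jk: "j \<in> I \<inter> {0, 1}" "k \<in> I - {0, 1}"
          then have "k \<noteq> 2" using 2(2) by auto
          then have "3 \<le> k" "j \<le> 1" using jk by auto
          then show "j + 2 \<le> k \<and> \<not> (j = 0 \<and> k = 2)" by simp
        qed
      qed
    next
      case 3
      \<comment> \<open>The first gap from 3 on. Generators beyond it commute with all those below
        it, so a set reaching past the gap splits.\<close>
      define p where "p = (LEAST p. 3 \<le> p \<and> p \<notin> I)"
      have ex: "3 \<le> n + 1 \<and> n + 1 \<notin> I" using n psubset.prems by auto
      have p: "3 \<le> p" "p \<notin> I" using LeastI[of "\<lambda>p. 3 \<le> p \<and> p \<notin> I", OF ex] by (auto simp: p_def)
      have pn: "p \<le> n + 1" unfolding p_def by (rule Least_le[where P = "\<lambda>p. 3 \<le> p \<and> p \<notin> I", OF ex])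
      have below: "j \<in> I" if "2 \<le> j" "j < p" for j
        using not_less_Least[of j "\<lambda>p. 3 \<le> p \<and> p \<notin> I"] that 3(2) unfolding p_def[symmetric]
        by (cases "j = 2") auto
      consider "\<not> I \<subseteq> {..<p}" | "I \<subseteq> {..<p}" "p = 3" "1 \<notin> I" | "I \<subseteq> {..<p}" "p \<noteq> 3 \<or> 1 \<in> I" by blast
      then show ?thesis
      proof cases
        case 1
        show ?thesis
        proof (rule split[of "I \<inter> {..<p}" "I - {..<p}"])
          show "I = I \<inter> {..<p} \<union> (I - {..<p})" by blast
          show "I \<inter> {..<p} \<noteq> I" using 1 by blast
          have "0 \<in> {..<p}" using p(1) by simp
          then show "I - {..<p} \<noteq> I" using 3(1) by blast
          fix j k assume jk: "j \<in> I \<inter> {..<p}" "k \<in> I - {..<p}"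
          then have "k \<noteq> p" using p(2) by auto
          then show "j + 2 \<le> k \<and> \<not> (j = 0 \<and> k = 2)" using jk p(1) by auto
        qed
      next
        case 2
        have "I \<subseteq> {0, 2}"
        proof
          fix j assume j: "j \<in> I"
          then have "j < 3" "j \<noteq> 1" using 2 by auto
          then show "j \<in> {0, 2}" by auto
        qed
        then have "Fix {A 0, A 2} \<subseteq> Fix (A ` I)" by (intro Fix_mono) auto
        then show ?thesis using pair(2) by blast
      next
        case 3
        note I02 = \<open>0 \<in> I\<close> \<open>2 \<in> I\<close>
        have finI: "finite I" by (rule psubset.hyps)
        \<comment> \<open>This count makes k + 1 generators act on the basis elements below p \<le>
          k + 2 only, with equality exactly when generator 1 is absent.\<close>
        have "insert 0 {2..<p} \<subseteq> I" using I02 below by auto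
        then have "card (insert 0 {2..<p}) \<le> card I" by (rule card_mono[OF finI])
        then have card_p: "p - 1 \<le> card I" using p(1) by simp
        have card3: "3 \<le> card I"
        proof (cases "p = 3")
          case True
          then have "{0, 1, 2} \<subseteq> I" using 3(2) I02 by auto
          then show ?thesis using card_mono[OF finI, of "{0, 1, 2}"] by simp
        qed (use card_p p(1) in simp)
        define k where "k = card I - 1"
        have k: "2 \<le> k" "p \<le> k + 2" "card I = Suc k" using card3 card_p by (auto simp: k_def)
        obtain e where "bij_betw e {0..<card I} I" using ex_bij_betw_nat_finite[OF finI] by blast
        moreover have "{0..<card I} = {..k}" using k(3) by auto
        ultimately have e: "bij_betw e {..k} I" by simp
        then have eI: "e ` {..k} = I" and einj: "inj_on e {..k}" by (auto simp: bij_betw_def)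
        have ej: "e j \<in> I" "e j < p" "e j \<le> n" if "j \<le> k" for j
          using that eI 3(1) psubset.prems by auto
        \<comment> \<open>As many disjoint blocks of size k + 2 as fit. For k > D + 1 the hypothesis
          \<open>bound\<close> gives nothing, but a single copy, conjugated by the identity, already
          satisfies D + 1 \<le> m * k.\<close>
        define r m where "r = k + 2" and "m = (if k \<le> D + 1 then n div r else 1)"
        define h where "h = (\<lambda>i. if k \<le> D + 1 then subst_aut n (signed_perm n (block_swap r i) (\<lambda>_. True)) else \<one>\<^bsub>Aut n\<^esub>)"
        have perm: "block_swap r i permutes {..<n}" if "i < m" "k \<le> D + 1" for i
        proof (rule block_swap_permutes)
          have "Suc i * r \<le> n div r * r" using that by (intro mult_le_mono1) (simp add: m_def)
          also have "\<dots> \<le> n" by simp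
          finally show "i * r + r \<le> n" by simp
        qed
        have "Fix ((\<lambda>j. A (e j)) ` {..k}) \<noteq> {}"
        proof (rule Fix_commuting_conjugates[OF dim, of m k _ h])
          show "D + 1 \<le> m * k"
            using bound[OF k(1)] by (cases "k \<le> D + 1") (auto simp: m_def r_def mult.commute)
          show "A (e j) \<in> carrier (Aut n)" if "j \<le> k" for j by (rule A[OF ej(3)[OF that]])
          show "Fix ((\<lambda>j. A (e j)) ` ({..k} - {j})) \<noteq> {}" if j: "j \<le> k" for j
          proof -
            have "e ` ({..k} - {j}) = I - {e j}"
              using einj eI j inj_on_image_set_diff[OF einj, of "{..k}" "{j}"] by auto
            moreover have "Fix (A ` (I - {e j})) \<noteq> {}"
              using ej(1)[OF j] psubset.prems by (intro psubset.IH) auto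
            ultimately show ?thesis by (metis image_image)
          qed
          show "h i \<in> carrier (Aut n)" if "i < m" for i
            using perm[OF that] signed_perm_in_Aut[of "block_swap r i" n] by (auto simp: h_def)
          fix i i' j j' assume *: "i < m" "i' < m" "i \<noteq> i'" "j \<le> k" "j' \<le> k"
          \<comment> \<open>Two different copies are present only if m is not 1, hence only in the
            range where the conjugating elements are block swaps.\<close>
          then have kD: "k \<le> D + 1" by (auto simp: m_def split: if_splits)
          have supp: "supported_on n (block_swap r i ` {..<r}) (h i \<otimes>\<^bsub>Aut n\<^esub> A (e j) \<otimes>\<^bsub>Aut n\<^esub> inv\<^bsub>Aut n\<^esub> h i)"
            "h i \<otimes>\<^bsub>Aut n\<^esub> A (e j) \<otimes>\<^bsub>Aut n\<^esub> inv\<^bsub>Aut n\<^esub> h i \<in> carrier (Aut n)"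
            if i: "i < m" and j: "j \<le> k" for i j
          proof -
            have "gen_support n (e j) \<subseteq> {..<r}"
              using ej[OF j] k p(1) by (auto simp: gen_support_def r_def)
            then have "supported_on n {..<r} (A (e j))"
              using supported_on_mono[OF gen_supported_on[OF n ej(3)[OF j]]] by (simp add: A_def)
            then show "supported_on n (block_swap r i ` {..<r}) (h i \<otimes>\<^bsub>Aut n\<^esub> A (e j) \<otimes>\<^bsub>Aut n\<^esub> inv\<^bsub>Aut n\<^esub> h i)"
              using supported_on_conjugate[OF perm[OF i kD] A[OF ej(3)[OF j]]] kD by (simp add: h_def)
            have "h i \<in> carrier (Aut n)"
              using signed_perm_in_Aut[OF perm[OF i kD]] kD by (simp add: h_def)
            then show "h i \<otimes>\<^bsub>Aut n\<^esub> A (e j) \<otimes>\<^bsub>Aut n\<^esub> inv\<^bsub>Aut n\<^esub> h i \<in> carrier (Aut n)"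
              using A[OF ej(3)[OF j]] by simp
          qed
          show "(h i \<otimes>\<^bsub>Aut n\<^esub> A (e j) \<otimes>\<^bsub>Aut n\<^esub> inv\<^bsub>Aut n\<^esub> h i) \<otimes>\<^bsub>Aut n\<^esub> (h i' \<otimes>\<^bsub>Aut n\<^esub> A (e j') \<otimes>\<^bsub>Aut n\<^esub> inv\<^bsub>Aut n\<^esub> h i')
            = (h i' \<otimes>\<^bsub>Aut n\<^esub> A (e j') \<otimes>\<^bsub>Aut n\<^esub> inv\<^bsub>Aut n\<^esub> h i') \<otimes>\<^bsub>Aut n\<^esub> (h i \<otimes>\<^bsub>Aut n\<^esub> A (e j) \<otimes>\<^bsub>Aut n\<^esub> inv\<^bsub>Aut n\<^esub> h i)"
            using * by (intro supported_on_commute[OF supp(2,1) supp(2,1) block_swap_disjoint])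
        qed
        moreover have "(\<lambda>j. A (e j)) ` {..k} = A ` I" using eI by (metis image_image)
        ultimately show ?thesis by simp
      qed
    qed
  qed
  obtain x where x: "x \<in> M" "\<And>k. k \<le> n \<Longrightarrow> act (A k) x = x"
    using all_subsets[of "{..n}"] by (auto simp: Fix_def)
  have "g \<in> {g \<in> carrier (Aut n). act g x = x}" if "g \<in> carrier (Aut n)" for g
  proof (rule gen_generate[OF n subgroup_stabilizer[OF x(1)] _ that])
    show "subst_aut n (gen n k) \<in> {g \<in> carrier (Aut n). act g x = x}" if "k \<le> n" for k
      using A[OF that] x(2)[OF that] by (simp add: A_def)
  qed
  then show ?thesis using x(1) by blast
qed

section \<open>From homomorphisms to actions, and the numerical bound\<close>

lemma covering_dim_le_of_covering_dim:
  assumes "covering_dim T = enat d"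
  shows "covering_dim_le T d"
proof -
  \<comment> \<open>In \<open>enat\<close> an empty infimum is infinite, which the hypothesis
    excludes; a nonempty one is attained by well-ordering.\<close>
  have "{m. covering_dim_le T m} \<noteq> {}"
  proof
    assume empty: "{m. covering_dim_le T m} = {}"
    have "covering_dim T = \<infinity>" unfolding covering_dim_def empty by (simp add: top_enat_def)
    then show False using assms by simp
  qed
  then obtain m where "enat m \<in> enat ` {m. covering_dim_le T m}" by auto
  then have "covering_dim T \<in> enat ` {m. covering_dim_le T m}"
    unfolding covering_dim_def by (rule wellorder_InfI)
  then show ?thesis using assms by auto
qed

lemma isometric_action_of_hom:
  assumes X: "X \<in> complete_CAT0_spaces d" and G: "group G" and \<phi>: "\<phi> \<in> hom G (isometry_group X)"
  shows "isometric_action (mspace X) (mdist X) G \<phi>"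
proof -
  have iso: "\<phi> g \<in> isometries X" if "g \<in> carrier G" for g
    using \<phi> that by (auto simp: hom_def isometry_group_def)
  have closed: "\<phi> g x \<in> mspace X" if "g \<in> carrier G" "x \<in> mspace X" for g x
    using iso[OF that(1)] that(2) by (auto simp: isometries_def Bij_def bij_betw_def)
  have mult: "\<phi> (g \<otimes>\<^bsub>G\<^esub> h) x = \<phi> g (\<phi> h x)" if "g \<in> carrier G" "h \<in> carrier G" "x \<in> mspace X" for g h x
  proof -
    have "\<phi> (g \<otimes>\<^bsub>G\<^esub> h) = compose (mspace X) (\<phi> g) (\<phi> h)"
      using \<phi> that iso by (auto simp: hom_def isometry_group_def BijGroup_def isometries_def)
    then show ?thesis using that by (simp add: compose_def)
  qed
  have one: "\<phi> \<one>\<^bsub>G\<^esub> x = x" if "x \<in> mspace X" for x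
  proof -
    interpret group_hom G "isometry_group X" \<phi>
      by (intro group_hom.intro group_hom_axioms.intro G group_isometry_group \<phi>)
    show ?thesis using hom_one that by (simp add: isometry_group_def BijGroup_def)
  qed
  have "hadamard_space (mspace X) (mdist X)"
    using X by (intro CAT0_imp_hadamard) (auto simp: complete_CAT0_spaces_def)
  then show ?thesis
    using G closed mult one iso
    by (intro isometric_action.intro isometric_action_axioms.intro) (auto simp: isometries_def)
qed

lemma property_FA_Aut:
  assumes "4 \<le> n" "\<And>k. \<lbrakk>2 \<le> k; k \<le> d + 1\<rbrakk> \<Longrightarrow> d < k * (n div (k + 2))"
  shows "property_FA TYPE('a) d (AutoGroup (free_group n))"
  unfolding property_FA_def
proof (intro ballI)
  fix X :: "'a metric" and \<phi> assume X: "X \<in> complete_CAT0_spaces d" and \<phi>: "\<phi> \<in> hom (Aut n) (isometry_group X)"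
  have "covering_dim_le (Metric_space.mtopology (mspace X) (mdist X)) d"
    using X by (intro covering_dim_le_of_covering_dim) (simp add: complete_CAT0_spaces_def mtopology_of_def)
  then show "\<exists>x\<in>mspace X. \<forall>g\<in>carrier (Aut n). \<phi> g x = x"
    by (rule Aut_fixed_point[OF isometric_action_of_hom[OF X group_Aut \<phi>] assms(1) _ assms(2)])
qed

text \<open>Let a = n div (k + 2) and q = n div 4, and suppose ka \<le> d. Then ka + 2 \<le> 2q,
  whereas 4q < (k + 2)(a + 1). Eliminating a gives (k - 2) 2q < (k - 2)(k + 1), against k + 1 \<le>
  d + 2 \<le> 2q.\<close>

lemma dimension_bound:
  fixes n d k :: nat
  assumes d: "int d < 2 * int (n div 4) - 1" and k: "2 \<le> k" "k \<le> d + 1"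
  shows "d < k * (n div (k + 2))"
proof -
  define q where "q = n div 4"
  have q: "4 * q \<le> n" "d + 2 \<le> 2 * q" using d by (auto simp: q_def)
  define a where "a = n div (k + 2)"
  have "n < (k + 2) * a + (k + 2)"
    using dividend_less_times_div[of "k + 2" n] by (simp add: a_def)
  then have n: "4 * q \<le> (k + 2) * a + (k + 1)" using q(1) by linarith
  show ?thesis
  proof (rule ccontr)
    assume "\<not> ?thesis"
    then have "k * a + 2 \<le> 2 * q" using q(2) by (simp add: a_def)
    then have "(k + 2) * (k * a + 2) \<le> (k + 2) * (2 * q)" by (rule mult_le_mono2)
    moreover have "k * (4 * q) \<le> k * ((k + 2) * a + (k + 1))" by (rule mult_le_mono2[OF n])
    moreover have "(k - 2) * (k + 1) \<le> (k - 2) * (2 * q)" using k q(2) by (intro mult_le_mono2) simp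
    moreover obtain j where "k = j + 2" using k(1) by (metis add.commute le_Suc_ex)
    ultimately show False by (simp add: algebra_simps)
  qed
qed

text \<open>For d = 0 the infimum ranges over the empty set and is infinite in \<open>enat\<close>,
  in accordance with the convention for the minimum.\<close>

theorem theoremA:
  fixes n d :: nat
  assumes "n \<ge> 4"
  shows "(enat d < (INF k\<in>{2..d + 1}. enat (k * (n div (k + 2))))
            \<longrightarrow> property_FA TYPE('a) d (AutoGroup (free_group n)))
       \<and> (int d < 2 * int (n div 4) - 1
            \<longrightarrow> property_FA TYPE('a) d (AutoGroup (free_group n)))"
proof (intro conjI impI)
  assume d: "enat d < (INF k\<in>{2..d + 1}. enat (k * (n div (k + 2))))"
  show "property_FA TYPE('a) d (AutoGroup (free_group n))"
  proof (rule property_FA_Aut[OF assms])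
    fix k assume "2 \<le> k" "k \<le> d + 1"
    then have "enat d < enat (k * (n div (k + 2)))"
      using d by (intro less_INF_D[OF d]) auto
    then show "d < k * (n div (k + 2))" by simp
  qed
next
  assume "int d < 2 * int (n div 4) - 1"
  then show "property_FA TYPE('a) d (AutoGroup (free_group n))"
    by (intro property_FA_Aut[OF assms] dimension_bound)
qed

end
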